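(* \textsc{Max-Min Fair Matching} can be solved in $O^{\star}(k^{O(k)})$ time, where $k=|V|$ is the number of vertices on the right side of the input bipartite graph.
   Context: Let $G=(U\cup V,E)$ be a bipartite graph with left side $U$ and right side $V$ ($U\cap V=\emptyset$); write $n=|U|$ and $k=|V|$. For a vertex $w$ and $M\subseteq E$, let $M(w)=\{w' \mid \{w,w'\}\in M\}$. A many-to-one matching is a set $M\subseteq E$ with $|M(u)|\le 1$ for every $u\in U$; it is left-perfect if $|M(u)|=1$ for every $u\in U$. Let $C$ be a finite set of colors and $\mathrm{col}\colon U\to C$; for $U'\subseteq U$ and $c\in C$ let $U'_c=\{u\in U'\mid \mathrm{col}(u)=c\}$. Define $\mathrm{MaxMin}(U')=\max_{c\in C}|U'_c|-\min_{c\in C}|U'_c|$ (over all colors of $C$, so colors absent from $U'$ count with $0$). For an integer $\ell\ge 0$, $U'$ is $\ell$-fair if $\mathrm{MaxMin}(U')\le\ell$, and a many-to-one matching $M$ is $\ell$-fair if $M(v)$ is $\ell$-fair for every $v\in V$. \textsc{Max-Min Fair Matching}: given $G$, $C$, $\mathrm{col}$ and $\ell\in\mathbb{N}$, decide whether there is a left-perfect many-to-one matching in $G$ that is $\ell$-fair. The notation $O^{\star}(\cdot)$ suppresses factors polynomial in the input size. *)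

theory Defs
  imports Complex_Main "HOL-Library.Landau_Symbols" "HOL-Library.Log_Nat"
    "HOL-Computational_Algebra.Polynomial"
begin

definition bipartite_graph :: "'v set \<Rightarrow> 'v set \<Rightarrow> 'v set set \<Rightarrow> bool" where
  "bipartite_graph U V E \<longleftrightarrow>
     finite U \<and> finite V \<and> U \<inter> V = {} \<and> (\<forall>e\<in>E. \<exists>u\<in>U. \<exists>v\<in>V. e = {u, v})"

definition partners :: "'v set set \<Rightarrow> 'v \<Rightarrow> 'v set" where
  "partners M w = {w'. {w, w'} \<in> M}"

definition many_to_one_matching :: "'v set \<Rightarrow> 'v set set \<Rightarrow> 'v set set \<Rightarrow> bool" where
  "many_to_one_matching U E M \<longleftrightarrow> M \<subseteq> E \<and> (\<forall>u\<in>U. card (partners M u) \<le> 1)"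

definition left_perfect :: "'v set \<Rightarrow> 'v set set \<Rightarrow> bool" where
  "left_perfect U M \<longleftrightarrow> (\<forall>u\<in>U. card (partners M u) = 1)"

definition color_class :: "('v \<Rightarrow> 'c) \<Rightarrow> 'v set \<Rightarrow> 'c \<Rightarrow> 'v set" where
  "color_class col U' c = {u \<in> U'. col u = c}"

text \<open>If there are no colors at all (so that the only colored set is the empty one),
  the maximum and the minimum are both read as 0.\<close>

definition MaxMin :: "'c set \<Rightarrow> ('v \<Rightarrow> 'c) \<Rightarrow> 'v set \<Rightarrow> nat" where
  "MaxMin C col U' =
     (if C = {} then 0
      else (MAX c\<in>C. card (color_class col U' c)) - (MIN c\<in>C. card (color_class col U' c)))"

definition fair_set :: "'c set \<Rightarrow> ('v \<Rightarrow> 'c) \<Rightarrow> nat \<Rightarrow> 'v set \<Rightarrow> bool" where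
  "fair_set C col l U' \<longleftrightarrow> MaxMin C col U' \<le> l"

definition fair_matching :: "'v set \<Rightarrow> 'c set \<Rightarrow> ('v \<Rightarrow> 'c) \<Rightarrow> nat \<Rightarrow> 'v set set \<Rightarrow> bool" where
  "fair_matching V C col l M \<longleftrightarrow> (\<forall>v\<in>V. fair_set C col l (partners M v))"

record ('v, 'c) mmfm =
  left :: "'v set"
  right :: "'v set"
  edges :: "'v set set"
  colors :: "'c set"
  coloring :: "'v \<Rightarrow> 'c"
  fairness :: nat

definition mmfm_instance :: "('v, 'c) mmfm \<Rightarrow> bool" where
  "mmfm_instance I \<longleftrightarrow>
     bipartite_graph (left I) (right I) (edges I) \<and> finite (colors I) \<and>
     coloring I ` left I \<subseteq> colors I"

definition mmfm_yes :: "('v, 'c) mmfm \<Rightarrow> bool" where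
  "mmfm_yes I \<longleftrightarrow>
     (\<exists>M. many_to_one_matching (left I) (edges I) M \<and> left_perfect (left I) M \<and>
          fair_matching (right I) (colors I) (coloring I) (fairness I) M)"

text \<open>
  Algorithms are programs of a first-order call-by-value functional language with recursion
  whose data are binary trees with integer leaves. Tree operations, variable accesses, branches
  and calls cost one unit; arithmetic is charged the bit lengths of its operands
  (logarithmic cost criterion). A value created during a run takes, with subtrees shared,
  space linear in the running time plus the input size, so this model and Turing machines
  simulate each other with polynomial overhead.
\<close>

datatype val = Num int | Node val val

text \<open>One unit per node and leaf, plus the number of binary digits of the absolute values of
  the leaves.\<close>

primrec val_size :: "val \<Rightarrow> nat" where
  "val_size (Num i) = 1 + floorlog 2 (nat \<bar>i\<bar>)"
| "val_size (Node a b) = 1 + val_size a + val_size b"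

datatype arith = Plus | Minus | Times | Div | Leq

fun arith_result :: "arith \<Rightarrow> int \<Rightarrow> int \<Rightarrow> int" where
  "arith_result Plus i j = i + j"
| "arith_result Minus i j = i - j"
| "arith_result Times i j = i * j"
| "arith_result Div i j = i div j"
| "arith_result Leq i j = (if i \<le> j then 1 else 0)"

text \<open>Variables are de Bruijn indices into the environment: \<open>Bind\<close> pushes the value of its
  first argument, and the body of a called function starts with the list of its arguments as
  environment.\<close>

datatype expr =
    Const int
  | Var nat
  | Bind expr expr
  | MkNode expr expr
  | LeftOf expr
  | RightOf expr
  | IsNode expr
  | Arith arith expr expr
  | Cond expr expr expr
  | Call nat "expr list"

type_synonym prog = "expr list"

text \<open>\<open>eval P env e t a\<close>: in program \<open>P\<close>, the expression \<open>e\<close> evaluates to \<open>a\<close> in exactly \<open>t\<close>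
  time units. Ill-typed operations, such as \<open>LeftOf\<close> of a leaf, have no result.\<close>

inductive eval :: "prog \<Rightarrow> val list \<Rightarrow> expr \<Rightarrow> nat \<Rightarrow> val \<Rightarrow> bool"
  and evals :: "prog \<Rightarrow> val list \<Rightarrow> expr list \<Rightarrow> nat \<Rightarrow> val list \<Rightarrow> bool"
  for P :: prog where
  eval_Const: "eval P env (Const i) 1 (Num i)"
| eval_Var: "n < length env \<Longrightarrow> eval P env (Var n) 1 (env ! n)"
| eval_Bind: "\<lbrakk>eval P env e s a; eval P (a # env) f t b\<rbrakk>
    \<Longrightarrow> eval P env (Bind e f) (1 + s + t) b"
| eval_MkNode: "\<lbrakk>eval P env e s a; eval P env f t b\<rbrakk>
    \<Longrightarrow> eval P env (MkNode e f) (1 + s + t) (Node a b)"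
| eval_LeftOf: "eval P env e t (Node a b) \<Longrightarrow> eval P env (LeftOf e) (1 + t) a"
| eval_RightOf: "eval P env e t (Node a b) \<Longrightarrow> eval P env (RightOf e) (1 + t) b"
| eval_IsNode_Num: "eval P env e t (Num i) \<Longrightarrow> eval P env (IsNode e) (1 + t) (Num 0)"
| eval_IsNode_Node: "eval P env e t (Node a b) \<Longrightarrow> eval P env (IsNode e) (1 + t) (Num 1)"
| eval_Arith: "\<lbrakk>eval P env e s (Num i); eval P env f t (Num j)\<rbrakk>
    \<Longrightarrow> eval P env (Arith a e f) (1 + s + t + val_size (Num i) + val_size (Num j))
          (Num (arith_result a i j))"
| eval_Cond_true: "\<lbrakk>eval P env e s (Num i); i \<noteq> 0; eval P env f t a\<rbrakk>
    \<Longrightarrow> eval P env (Cond e f g) (1 + s + t) a"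
| eval_Cond_false: "\<lbrakk>eval P env e s (Num 0); eval P env g t a\<rbrakk>
    \<Longrightarrow> eval P env (Cond e f g) (1 + s + t) a"
| eval_Call: "\<lbrakk>evals P env es s as; n < length P; eval P as (P ! n) t a\<rbrakk>
    \<Longrightarrow> eval P env (Call n es) (1 + s + t) a"
| evals_Nil: "evals P env [] 0 []"
| evals_Cons: "\<lbrakk>eval P env e s a; evals P env es t as\<rbrakk>
    \<Longrightarrow> evals P env (e # es) (s + t) (a # as)"

inductive_cases eval_cases:
  "eval P env (Const i) t a" "eval P env (Var n) t a" "eval P env (Bind e f) t a"
  "eval P env (MkNode e f) t a" "eval P env (LeftOf e) t a" "eval P env (RightOf e) t a"
  "eval P env (IsNode e) t a" "eval P env (Arith b e f) t a" "eval P env (Cond e f g) t a"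
  "eval P env (Call n es) t a"
inductive_cases evals_cases: "evals P env [] t as" "evals P env (e # es) t as"

lemma eval_deterministic:
  "eval P env e t a \<Longrightarrow> eval P env e t' a' \<Longrightarrow> t' = t \<and> a' = a"
  "evals P env es s as \<Longrightarrow> evals P env es s' as' \<Longrightarrow> s' = s \<and> as' = as"
proof (induction arbitrary: t' a' and s' as' rule: eval_evals.inducts)
  case eval_Const
  then show ?case by (auto elim: eval_cases)
next
  case eval_Var
  then show ?case by (auto elim: eval_cases)
next
  case eval_Bind
  show ?case by (rule eval_cases(3)[OF eval_Bind.prems]) (simp?; metis eval_Bind.IH val.inject val.distinct)+
next
  case eval_MkNode
  show ?case by (rule eval_cases(4)[OF eval_MkNode.prems]) (simp?; metis eval_MkNode.IH val.inject val.distinct)+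
next
  case eval_LeftOf
  show ?case by (rule eval_cases(5)[OF eval_LeftOf.prems]) (simp?; metis eval_LeftOf.IH val.inject val.distinct)+
next
  case eval_RightOf
  show ?case by (rule eval_cases(6)[OF eval_RightOf.prems]) (simp?; metis eval_RightOf.IH val.inject val.distinct)+
next
  case eval_IsNode_Num
  show ?case by (rule eval_cases(7)[OF eval_IsNode_Num.prems]) (simp?; metis eval_IsNode_Num.IH val.inject val.distinct)+
next
  case eval_IsNode_Node
  show ?case by (rule eval_cases(7)[OF eval_IsNode_Node.prems]) (simp?; metis eval_IsNode_Node.IH val.inject val.distinct)+
next
  case eval_Arith
  show ?case by (rule eval_cases(8)[OF eval_Arith.prems]) (simp?; metis eval_Arith.IH val.inject val.distinct)+
next
  case eval_Cond_true
  show ?case by (rule eval_cases(9)[OF eval_Cond_true.prems]) (simp?; metis eval_Cond_true.hyps eval_Cond_true.IH val.inject val.distinct)+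
next
  case eval_Cond_false
  show ?case by (rule eval_cases(9)[OF eval_Cond_false.prems]) (simp?; metis eval_Cond_false.IH val.inject val.distinct)+
next
  case eval_Call
  show ?case by (rule eval_cases(10)[OF eval_Call.prems]) (simp?; metis eval_Call.IH val.inject val.distinct)+
next
  case evals_Nil
  then show ?case by (auto elim: evals_cases)
next
  case evals_Cons
  show ?case by (rule evals_cases(2)[OF evals_Cons.prems]) (simp; metis evals_Cons.IH)
qed

definition runs :: "prog \<Rightarrow> val \<Rightarrow> nat \<Rightarrow> val \<Rightarrow> bool" where
  "runs P x t a \<longleftrightarrow> eval P [x] (Call 0 [Var 0]) t a"

text \<open>
  \<open>inst\<close> are the instances, \<open>code I x\<close> says that \<open>x\<close> is an encoding of \<open>I\<close> (an instance may
  have several), and \<open>f\<close> is the bound up to a factor polynomial in the size of the encoding.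
\<close>

definition decidable_in_Ostar_time ::
  "('i \<Rightarrow> bool) \<Rightarrow> ('i \<Rightarrow> val \<Rightarrow> bool) \<Rightarrow> ('i \<Rightarrow> bool) \<Rightarrow> ('i \<Rightarrow> nat) \<Rightarrow> bool" where
  "decidable_in_Ostar_time inst code yes f \<longleftrightarrow>
     (\<exists>(P :: prog) (q :: nat poly). \<forall>I x. inst I \<longrightarrow> code I x \<longrightarrow>
        (\<exists>t. runs P x t (Num (if yes I then 1 else 0)) \<and> t \<le> f I * poly q (val_size x)))"

definition val_of_nat :: "nat \<Rightarrow> val" where
  "val_of_nat n = Num (int n)"

definition val_of_pair :: "nat \<times> nat \<Rightarrow> val" where
  "val_of_pair p = Node (val_of_nat (fst p)) (val_of_nat (snd p))"

definition val_of_list :: "('a \<Rightarrow> val) \<Rightarrow> 'a list \<Rightarrow> val" where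
  "val_of_list f xs = foldr (\<lambda>x. Node (f x)) xs (Num 0)"

text \<open>
  Vertices and colors are named by arbitrary natural numbers. The encoding consists of the left
  vertices with their colors, the right vertices, the edges (left endpoint first), the colors
  (including those without a vertex), and the number \<open>\<ell>\<close>; each set is listed without
  repetitions in an arbitrary order.
\<close>

definition mmfm_code :: "(nat, nat) mmfm \<Rightarrow> val \<Rightarrow> bool" where
  "mmfm_code I x \<longleftrightarrow>
     (\<exists>us vs es cs.
        distinct us \<and> set us = left I \<and>
        distinct vs \<and> set vs = right I \<and>
        distinct es \<and> set es = {(u, v). u \<in> left I \<and> v \<in> right I \<and> {u, v} \<in> edges I} \<and>
        distinct cs \<and> set cs = colors I \<and>
        x = Node (val_of_list (\<lambda>u. val_of_pair (u, coloring I u)) us)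
           (Node (val_of_list val_of_nat vs)
           (Node (val_of_list val_of_pair es)
           (Node (val_of_list val_of_nat cs)
                 (val_of_nat (fairness I))))))"

end

theory Submission
  imports Defs "HOL-Library.FuncSet" "Jordan_Normal_Form.Determinant"
begin

text \<open>
  A left-perfect matching is \<open>\<ell>\<close>-fair iff for some integers \<open>a v\<close> all color loads of every right
  vertex \<open>v\<close> lie between \<open>a v\<close> and \<open>a v + \<ell>\<close>. By a Hall-type theorem such loads exist for given \<open>a\<close> iff
  \<open>lo S \<le> sum a S \<le> hi S\<close> for every set \<open>S\<close> of right vertices, where \<open>lo S\<close> and \<open>hi S\<close> are counts that
  are easily computed. So the problem is to find an integer point of a polytope in dimension \<open>k\<close>
  with 0/1 rows.

  The search for it is guided by an integer perceptron: it accepts whenever an integer point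
  exists, and what it accepts has a nearly feasible real point. Whenever \<open>v \<cdot> a\<close> takes only
  polynomially many values for some integer vector \<open>v\<close> with entries at most \<open>k\<close> that is not yet fixed,
  the search branches on \<open>v \<cdot> a\<close>. In the end every such direction is either fixed or wide. Counting
  lattice points near a central point of the polytope by a Fourier sum, a fixed direction contributes
  with nonnegative real part and a wide one negligibly; so the trivial character dominates and an
  integer point exists. By the pigeonhole principle, directions that really branch admit no small
  integer relation, so every path of the search contains at most \<open>k\<close> of them.
\<close>

text \<open>The difficulty is to bound the number of real branchings although feasibility is only
  tested approximately. The perceptron accepts points that violate each row by up to
  \<open>tol k\<close>, and exact linear dependence is invisible at such points. But it needs only
  about \<open>k * (scale * n)^2\<close> corrections, because every unknown lies between
  \<open>0\<close> and the number \<open>n\<close> of left vertices. So \<open>scale\<close> may be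
  as large as k^O(k), and \<open>tol k\<close> can be pushed below the reciprocal of
  \<open>relation_bound k\<close>. At this precision a direction that is tied to the fixed ones by
  an integer relation with coefficients up to \<open>relation_bound k\<close> varies by less than
  \<open>1\<close>, hence has at most one possible value and does not branch. The number of branches
  at a node enters the running time with exponent \<open>k\<close>, so it has to be polynomial in
  \<open>k\<close>; and the directions have to be listed one by one, so their entries have to be
  polynomial in \<open>k\<close> too. Both come from the 0/1 rows: a determinant-maximal choice of
  rows, each scaled by the room it has at a central point, controls all other rows, and it leaves
  only directions with entries up to \<open>k\<close> to be examined.\<close>

section \<open>Matchings and cut conditions\<close>

definition load :: "'u set \<Rightarrow> ('u \<Rightarrow> 'v) \<Rightarrow> 'v \<Rightarrow> int" where
  "load X f v = int (card {u \<in> X. f u = v})"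

lemma sum_load:
  assumes "finite X" "finite S"
  shows "(\<Sum>v\<in>S. load X f v) = int (card {u \<in> X. f u \<in> S})"
proof -
  have "card {u \<in> X. f u \<in> S} = card (\<Union>v\<in>S. {u \<in> X. f u = v})"
    by (rule arg_cong[where f = card]) auto
  also have "\<dots> = (\<Sum>v\<in>S. card {u \<in> X. f u = v})"
    using assms by (subst card_UN_disjoint) auto
  finally show ?thesis by (simp add: load_def)
qed

lemma load_update:
  assumes "finite X" "u \<in> X"
  shows "load X (f(u := w)) v = load X f v - of_bool (f u = v) + of_bool (w = v)"
proof -
  have 1: "{x \<in> X. (f(u := w)) x = v} = (if w = v then insert u else (\<lambda>A. A)) ({x \<in> X. f x = v} - {u})"
    using assms(2) by auto
  have "card {x \<in> X. f x = v} = card ({x \<in> X. f x = v} - {u}) + of_bool (f u = v)"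
  proof (cases "f u = v")
    case True
    then show ?thesis using assms card.remove[of "{x \<in> X. f x = v}" u] by simp
  next
    case False
    then have "{x \<in> X. f x = v} - {u} = {x \<in> X. f x = v}" by auto
    then show ?thesis using False by simp
  qed
  then show ?thesis unfolding load_def 1 using assms(1) by (cases "w = v") (auto simp del: insert_Diff_single)
qed

text \<open>The exchange graph of an assignment: an arc allows one element to be moved, and paths
  play the role of augmenting paths.\<close>

definition shift_rel :: "'u set \<Rightarrow> ('u \<Rightarrow> 'v set) \<Rightarrow> ('u \<Rightarrow> 'v) \<Rightarrow> ('v \<times> 'v) set" where
  "shift_rel X N f = {(v, w). \<exists>u\<in>X. f u = v \<and> w \<in> N u}"

text \<open>Loops are cut out: if \<open>x\<close> already lies on the path, the part from
  \<open>x\<close> on is kept. Distinctness matters when elements are shifted along the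
  path.\<close>

lemma rtrancl_distinct_path:
  assumes "(x, y) \<in> r\<^sup>*"
  shows "\<exists>p. p \<noteq> [] \<and> hd p = x \<and> last p = y \<and> distinct p \<and> successively (\<lambda>a b. (a, b) \<in> r) p"
  using assms
proof (induction rule: converse_rtrancl_induct)
  case base
  show ?case by (rule exI[of _ "[y]"]) simp
next
  case (step x z)
  then obtain p where p: "p \<noteq> []" "hd p = z" "last p = y" "distinct p"
    "successively (\<lambda>a b. (a, b) \<in> r) p" by blast
  show ?case
  proof (cases "x \<in> set p")
    case False
    then show ?thesis using p step.hyps
      by (intro exI[of _ "x # p"]) (auto simp: successively_Cons)
  next
    case True
    then obtain a b where "p = a @ x # b" by (meson split_list)
    then show ?thesis using p
      by (intro exI[of _ "x # b"]) (auto simp: successively_append_iff)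
  qed
qed

text \<open>Induction from the far end: after the tail has been shifted, the element
  \<open>u\<close> behind the first arc still sits at \<open>x\<close>, because \<open>x\<close> is
  not on the tail. The clause on elements with \<open>f u \<notin> set p\<close> is carried along
  for exactly this. Interior vertices lose one element and gain one.\<close>

lemma shift_along_path:
  assumes "finite X" and "\<forall>u\<in>X. f u \<in> N u"
    and "p \<noteq> []" "distinct p" "successively (\<lambda>a b. (a, b) \<in> shift_rel X N f) p"
  shows "\<exists>g. (\<forall>u\<in>X. g u \<in> N u) \<and> (\<forall>u. f u \<notin> set p \<longrightarrow> g u = f u) \<and>
    (\<forall>v. load X g v = load X f v - of_bool (v = hd p) + of_bool (v = last p))"
  using assms(3-5)
proof (induction p rule: list_nonempty_induct)
  case (single x)
  show ?case using assms(2) by (intro exI[of _ f]) auto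
next
  case (cons x p)
  then have succ: "successively (\<lambda>a b. (a, b) \<in> shift_rel X N f) p" "(x, hd p) \<in> shift_rel X N f"
    by (auto simp: successively_Cons)
  then obtain g where g: "\<forall>u\<in>X. g u \<in> N u" "\<forall>u. f u \<notin> set p \<longrightarrow> g u = f u"
    "\<forall>v. load X g v = load X f v - of_bool (v = hd p) + of_bool (v = last p)"
    using cons by auto
  obtain u where u: "u \<in> X" "f u = x" "hd p \<in> N u"
    using succ(2) by (auto simp: shift_rel_def)
  have gu: "g u = x" using g(2) u(2) cons.prems by auto
  have hd: "hd p \<in> set p" using cons.hyps by simp
  have "load X (g(u := hd p)) v = load X f v - of_bool (v = x) + of_bool (v = last p)" for v
    using g(3) gu by (subst load_update[OF assms(1) u(1)]) auto
  moreover have "\<forall>u'\<in>X. (g(u := hd p)) u' \<in> N u'" using g(1) u(3) by simp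
  moreover have "\<forall>u'. f u' \<notin> set (x # p) \<longrightarrow> (g(u := hd p)) u' = f u'" using g(2) u(2) by auto
  moreover have "hd (x # p) = x" "last (x # p) = last p" using cons.hyps by auto
  ultimately show ?case by (intro exI[of _ "g(u := hd p)"] conjI) (simp_all only:, blast)
qed

lemma shift_reachable:
  assumes "finite X" and "\<forall>u\<in>X. f u \<in> N u" and "(v, w) \<in> (shift_rel X N f)\<^sup>*"
  shows "\<exists>g. (\<forall>u\<in>X. g u \<in> N u) \<and>
    (\<forall>x. load X g x = load X f x - of_bool (x = v) + of_bool (x = w))"
proof -
  obtain p where "p \<noteq> []" "hd p = v" "last p = w" "distinct p"
    "successively (\<lambda>a b. (a, b) \<in> shift_rel X N f) p"
    using rtrancl_distinct_path[OF assms(3)] by blast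
  then show ?thesis using shift_along_path[OF assms(1,2)] by metis
qed

text \<open>Take an assignment of least total deviation from the load bounds. The vertices that are
  reachable from an overloaded vertex (or that reach an underloaded one) by shifting
  elements form a set violating the cut condition, as otherwise a shift would decrease the
  deviation.\<close>

theorem load_bounds_iff_cut_condition:
  fixes a b :: "'v \<Rightarrow> int"
  assumes fin: "finite X" "finite V" and N: "\<And>u. u \<in> X \<Longrightarrow> N u \<subseteq> V"
    and ab: "\<And>v. v \<in> V \<Longrightarrow> a v \<le> b v"
  shows "(\<exists>f. (\<forall>u\<in>X. f u \<in> N u) \<and> (\<forall>v\<in>V. a v \<le> load X f v \<and> load X f v \<le> b v)) \<longleftrightarrow>
    (\<forall>S. S \<subseteq> V \<longrightarrow> sum a S \<le> int (card {u \<in> X. N u \<inter> S \<noteq> {}}) \<and>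
       int (card {u \<in> X. N u \<subseteq> S}) \<le> sum b S)" (is "?L \<longleftrightarrow> ?R")
proof
  assume ?L
  then obtain f where f: "\<forall>u\<in>X. f u \<in> N u" "\<forall>v\<in>V. a v \<le> load X f v \<and> load X f v \<le> b v"
    by blast
  show ?R
  proof (intro allI impI conjI)
    fix S assume S: "S \<subseteq> V"
    then have finS: "finite S" using fin finite_subset by blast
    have "sum a S \<le> (\<Sum>v\<in>S. load X f v)" using f S by (intro sum_mono) auto
    also have "\<dots> \<le> int (card {u \<in> X. N u \<inter> S \<noteq> {}})"
      unfolding sum_load[OF fin(1) finS] using f fin by (intro of_nat_mono card_mono) auto
    finally show "sum a S \<le> int (card {u \<in> X. N u \<inter> S \<noteq> {}})" .
    have "int (card {u \<in> X. N u \<subseteq> S}) \<le> (\<Sum>v\<in>S. load X f v)"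
      unfolding sum_load[OF fin(1) finS] using f fin by (intro of_nat_mono card_mono) auto
    also have "\<dots> \<le> sum b S" using f S by (intro sum_mono) auto
    finally show "int (card {u \<in> X. N u \<subseteq> S}) \<le> sum b S" .
  qed
next
  assume R: ?R
  define dev where "dev x v = nat (a v - x v) + nat (x v - b v)" for x :: "'v \<Rightarrow> int" and v
  let ?dev = "\<lambda>f. \<Sum>v\<in>V. dev (load X f) v"
  let ?valid = "\<lambda>f. \<forall>u\<in>X. f u \<in> N u"
  \<comment> \<open>The cut condition at the empty set says that no element has an empty
    neighborhood, so there is an assignment to start from.\<close>
  have "card {u \<in> X. N u \<subseteq> {}} = 0" using R by (auto dest: spec[of _ "{}"])
  then have "\<forall>u\<in>X. \<exists>v. v \<in> N u" using fin by auto
  then have "\<exists>f. ?valid f" by (rule bchoice)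
  then obtain f0 where f0: "?valid f0" by (rule exE)
  obtain f where f: "?valid f" and min: "\<And>g. ?valid g \<Longrightarrow> ?dev f \<le> ?dev g"
    by (rule that[OF arg_min_natI[of ?valid f0 ?dev, OF f0] arg_min_nat_le[of ?valid _ ?dev]])
  let ?r = "shift_rel X N f"
  have shift: "?dev f \<le> (\<Sum>x\<in>V. dev (\<lambda>x. load X f x - of_bool (x = v) + of_bool (x = w)) x)"
    if vw: "(v, w) \<in> ?r\<^sup>*" for v w
  proof -
    obtain g where g: "?valid g"
      "\<forall>x. load X g x = load X f x - of_bool (x = v) + of_bool (x = w)"
      using shift_reachable[OF fin(1) f vw] by blast
    then show ?thesis using min[OF g(1)] by (simp add: dev_def)
  qed
  have over: "load X f v \<le> b v" if v: "v \<in> V" for v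
  proof (rule ccontr)
    assume less: "\<not> load X f v \<le> b v"
    define S where "S = {w \<in> V. (v, w) \<in> ?r\<^sup>*}"
    have S: "S \<subseteq> V" "finite S" "v \<in> S" using fin v by (auto simp: S_def)
    \<comment> \<open>\<open>v\<close> can give up one element since its load exceeds
      \<open>b v \<ge> a v\<close>. If \<open>w\<close> were below \<open>b w\<close>, it could take
      one, and the deviation would drop at \<open>v\<close> without rising at
      \<open>w\<close>.\<close>
    have "load X f w \<ge> b w" if w: "w \<in> S" for w
    proof (rule ccontr)
      assume less': "\<not> load X f w \<ge> b w"
      have "(\<Sum>x\<in>V. dev (\<lambda>x. load X f x - of_bool (x = v) + of_bool (x = w)) x) < ?dev f"
      proof (rule sum_strict_mono_ex1)
        show "\<forall>x\<in>V. dev (\<lambda>x. load X f x - of_bool (x = v) + of_bool (x = w)) x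
            \<le> dev (load X f) x"
          using less less' ab v by (auto simp: dev_def)
        show "\<exists>x\<in>V. dev (\<lambda>x. load X f x - of_bool (x = v) + of_bool (x = w)) x
            < dev (load X f) x"
          using less less' ab[of v] v by (intro bexI[of _ v]) (auto simp: dev_def)
      qed (rule fin(2))
      moreover have "(v, w) \<in> ?r\<^sup>*" using w by (simp add: S_def)
      ultimately show False using shift[of v w] by simp
    qed
    then have "sum b S < (\<Sum>w\<in>S. load X f w)"
      using S less by (intro sum_strict_mono_ex1 ballI bexI[of _ v]) simp_all
    also have "\<dots> \<le> int (card {u \<in> X. N u \<subseteq> S})"
    proof -
      \<comment> \<open>\<open>S\<close> is closed under arcs of the exchange graph, so elements
        assigned into \<open>S\<close> have nowhere else to go.\<close>
      have "N u \<subseteq> S" if "u \<in> X" "f u \<in> S" for u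
      proof
        fix w assume w: "w \<in> N u"
        then have "(f u, w) \<in> ?r" using that by (auto simp: shift_rel_def)
        moreover have "(v, f u) \<in> ?r\<^sup>*" using that by (simp add: S_def)
        ultimately have "(v, w) \<in> ?r\<^sup>*" by (metis rtrancl_into_rtrancl)
        then show "w \<in> S" using that(1) w N by (auto simp: S_def)
      qed
      then show ?thesis
        unfolding sum_load[OF fin(1) S(2)] using fin by (auto intro!: card_mono)
    qed
    finally show False using R[rule_format, OF S(1)] by simp
  qed
  have under: "a v \<le> load X f v" if v: "v \<in> V" for v
  proof (rule ccontr)
    assume less: "\<not> a v \<le> load X f v"
    define S where "S = {w \<in> V. (w, v) \<in> ?r\<^sup>*}"
    have S: "S \<subseteq> V" "finite S" "v \<in> S" using fin v by (auto simp: S_def)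
    have "load X f w \<le> a w" if w: "w \<in> S" for w
    proof (rule ccontr)
      assume less': "\<not> load X f w \<le> a w"
      have "(\<Sum>x\<in>V. dev (\<lambda>x. load X f x - of_bool (x = w) + of_bool (x = v)) x) < ?dev f"
      proof (rule sum_strict_mono_ex1)
        show "\<forall>x\<in>V. dev (\<lambda>x. load X f x - of_bool (x = w) + of_bool (x = v)) x
            \<le> dev (load X f) x"
          using less less' ab v by (auto simp: dev_def)
        show "\<exists>x\<in>V. dev (\<lambda>x. load X f x - of_bool (x = w) + of_bool (x = v)) x
            < dev (load X f) x"
          using less less' ab[of v] v by (intro bexI[of _ v]) (auto simp: dev_def)
      qed (rule fin(2))
      moreover have "(w, v) \<in> ?r\<^sup>*" using w by (simp add: S_def)
      ultimately show False using shift[of w v] by simp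
    qed
    then have "(\<Sum>w\<in>S. load X f w) < sum a S"
      using S less by (intro sum_strict_mono_ex1 ballI bexI[of _ v]) simp_all
    moreover have "int (card {u \<in> X. N u \<inter> S \<noteq> {}}) \<le> (\<Sum>w\<in>S. load X f w)"
    proof -
      have "f u \<in> S" if "u \<in> X" "w \<in> N u" "w \<in> S" for u w
      proof -
        have "(f u, w) \<in> ?r" using that by (auto simp: shift_rel_def)
        moreover have "(w, v) \<in> ?r\<^sup>*" using that by (simp add: S_def)
        ultimately have "(f u, v) \<in> ?r\<^sup>*" by (rule converse_rtrancl_into_rtrancl)
        then show ?thesis using that(1) f N by (auto simp: S_def)
      qed
      then show ?thesis
        unfolding sum_load[OF fin(1) S(2)] using fin by (auto intro!: card_mono)
    qed
    ultimately show False using R[rule_format, OF S(1)] by simp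
  qed
  show ?L using f over under by blast
qed

section \<open>Central points\<close>

definition col_mat :: "nat \<Rightarrow> (nat \<Rightarrow> nat \<Rightarrow> real) \<Rightarrow> real mat" where
  "col_mat d b = mat d d (\<lambda>(r, c). b c r)"

lemma col_mat_carrier [simp]: "col_mat d b \<in> carrier_mat d d"
  by (simp add: col_mat_def)

text \<open>Leibniz expansion. Its only purpose is that the determinants have a supremum.\<close>

lemma abs_det_col_mat_le:
  assumes "\<And>i c. i < d \<Longrightarrow> c < d \<Longrightarrow> \<bar>b i c\<bar> \<le> M"
  shows "\<bar>det (col_mat d b)\<bar> \<le> fact d * M ^ d"
proof -
  have *: "\<bar>\<Prod>i = 0..<d. col_mat d b $$ (i, p i)\<bar> \<le> M ^ d" if "p permutes {0..<d}" for p
  proof -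
    have "\<bar>\<Prod>i = 0..<d. col_mat d b $$ (i, p i)\<bar> = (\<Prod>i = 0..<d. \<bar>col_mat d b $$ (i, p i)\<bar>)"
      by (simp add: abs_prod)
    also have "\<dots> \<le> (\<Prod>i = 0..<d. M)"
    proof (intro prod_mono conjI abs_ge_zero)
      fix i assume "i \<in> {0..<d}"
      moreover from this that have "p i < d" using permutes_in_image by fastforce
      ultimately show "\<bar>col_mat d b $$ (i, p i)\<bar> \<le> M"
        by (simp add: col_mat_def assms)
    qed
    finally show ?thesis by simp
  qed
  have "\<bar>det (col_mat d b)\<bar>
      \<le> (\<Sum>p | p permutes {0..<d}. \<bar>signof p * (\<Prod>i = 0..<d. col_mat d b $$ (i, p i))\<bar>)"
    by (subst det_def') (auto intro: sum_abs)
  also have "\<dots> \<le> (\<Sum>p | p permutes {0..<d}. M ^ d)"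
    using * by (intro sum_mono) (auto simp: abs_mult sign_def)
  also have "\<dots> = fact d * M ^ d"
    by (simp add: card_permutations)
  finally show ?thesis .
qed

text \<open>A choice of the basis whose determinant is within a factor 2 of the supremum makes all
  coordinates at most 2, by Cramer's rule.\<close>

lemma bounded_coordinates_basis:
  fixes S :: "(nat \<Rightarrow> real) set"
  assumes bounded: "\<And>s c. s \<in> S \<Longrightarrow> c < d \<Longrightarrow> \<bar>s c\<bar> \<le> M"
    and b0: "\<And>i. i < d \<Longrightarrow> b0 i \<in> S"
    and inv0: "\<And>i j. i < d \<Longrightarrow> j < d \<Longrightarrow> (\<Sum>c<d. \<Lambda>0 i c * b0 c j) = (if i = j then 1 else 0)"
  obtains b \<Lambda> where "\<And>i. i < d \<Longrightarrow> b i \<in> S"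
    and "\<And>s. s \<in> S \<Longrightarrow> \<exists>l. (\<forall>i<d. \<bar>l i\<bar> \<le> 2) \<and> (\<forall>c<d. s c = (\<Sum>i<d. l i * b i c))"
    and "\<And>i j. i < d \<Longrightarrow> j < d \<Longrightarrow> (\<Sum>c<d. b i c * \<Lambda> c j) = (if i = j then 1 else (0::real))"
    and "\<And>i j. i < d \<Longrightarrow> j < d \<Longrightarrow> (\<Sum>c<d. \<Lambda> i c * b c j) = (if i = j then 1 else (0::real))"
proof -
  \<comment> \<open>\<open>S\<close> is not assumed closed, so the supremum need not be attained. It
    is positive because of \<open>b0\<close>, hence some choice exceeds half of it.\<close>
  define D where "D = (\<lambda>b. \<bar>det (col_mat d b)\<bar>) ` {b. \<forall>i<d. b i \<in> S}"
  have bdd: "bdd_above D"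
    unfolding D_def using abs_det_col_mat_le[of d _ M] bounded by (auto intro!: bdd_aboveI2)
  have "mat d d (\<lambda>(c, i). \<Lambda>0 i c) \<in> carrier_mat d d" by simp
  moreover have "col_mat d b0 * mat d d (\<lambda>(c, i). \<Lambda>0 i c) = 1\<^sub>m d"
    using inv0
    by (auto intro!: eq_matI simp: col_mat_def scalar_prod_def lessThan_atLeast0 mult.commute)
  ultimately have "det (col_mat d b0) * det (mat d d (\<lambda>(c, i). \<Lambda>0 i c)) = 1"
    by (metis col_mat_carrier det_mult det_one)
  then have "\<bar>det (col_mat d b0)\<bar> > 0" by auto
  moreover have "\<bar>det (col_mat d b0)\<bar> \<in> D" using b0 by (auto simp: D_def)
  ultimately have pos: "Sup D > 0"
    using cSup_upper[OF _ bdd] by fastforce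
  then have "Sup D / 2 < Sup D" by simp
  moreover have "D \<noteq> {}" using b0 by (auto simp: D_def)
  ultimately obtain b where bS: "\<forall>i<d. b i \<in> S" and bD: "Sup D / 2 < \<bar>det (col_mat d b)\<bar>"
    using less_cSupD[of D "Sup D / 2"] by (auto simp: D_def)
  let ?B = "col_mat d b"
  have det0: "det ?B \<noteq> 0" using bD pos by auto
  then obtain B' where B': "B' \<in> carrier_mat d d" "?B * B' = 1\<^sub>m d" "B' * ?B = 1\<^sub>m d"
  proof -
    have "?B * ((1 / det ?B) \<cdot>\<^sub>m adj_mat ?B) = (1 / det ?B) \<cdot>\<^sub>m (det ?B \<cdot>\<^sub>m 1\<^sub>m d)"
      using adj_mat[of ?B d] by (metis col_mat_carrier mult_smult_distrib)
    moreover have "((1 / det ?B) \<cdot>\<^sub>m adj_mat ?B) * ?B = (1 / det ?B) \<cdot>\<^sub>m (det ?B \<cdot>\<^sub>m 1\<^sub>m d)"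
      using adj_mat[of ?B d] by (metis col_mat_carrier mult_smult_assoc_mat)
    moreover have "(1 / det ?B) \<cdot>\<^sub>m (det ?B \<cdot>\<^sub>m 1\<^sub>m d) = 1\<^sub>m d"
      using det0 by (auto intro!: eq_matI)
    moreover have "(1 / det ?B) \<cdot>\<^sub>m adj_mat ?B \<in> carrier_mat d d"
      using adj_mat[of ?B d] by simp
    ultimately show thesis using that by metis
  qed
  have coord: "\<exists>l. (\<forall>i<d. \<bar>l i\<bar> \<le> 2) \<and> (\<forall>c<d. s c = (\<Sum>i<d. l i * b i c))" if s: "s \<in> S" for s
  proof -
    define l where "l = B' *\<^sub>v vec d s"
    have l: "l \<in> carrier_vec d" using B' by (simp add: l_def)
    have Bl: "?B *\<^sub>v l = vec d s"
      unfolding l_def using B' 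
      by (metis assoc_mult_mat_vec col_mat_carrier one_mult_mat_vec vec_carrier)
    have "\<bar>l $ i\<bar> \<le> 2" if i: "i < d" for i
    proof -
      \<comment> \<open>Exchanging a column for \<open>s\<close> is again a choice from
        \<open>S\<close>, so its determinant is at most \<open>Sup D\<close>, which is at most twice
        that of \<open>b\<close>.\<close>
      have "replace_col ?B (vec d s) i = col_mat d (b(i := s))"
        by (rule eq_matI) (auto simp: replace_col_def col_mat_def)
      then have "det (col_mat d (b(i := s))) = l $ i * det ?B"
        using cramer_lemma_mat[OF _ l i, of ?B] Bl by simp
      moreover have "\<bar>det (col_mat d (b(i := s)))\<bar> \<in> D"
        using bS s unfolding D_def by (intro imageI) auto
      ultimately have "\<bar>l $ i\<bar> * \<bar>det ?B\<bar> \<le> Sup D"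
        using cSup_upper[OF _ bdd] by (metis abs_mult)
      also have "\<dots> \<le> 2 * \<bar>det ?B\<bar>" using bD by simp
      finally show ?thesis using det0 by simp
    qed
    moreover have "s c = (\<Sum>i<d. l $ i * b i c)" if "c < d" for c
    proof -
      have "s c = (?B *\<^sub>v l) $ c" using that Bl by simp
      also have "\<dots> = (\<Sum>i<d. l $ i * b i c)"
        using that l by (simp add: col_mat_def scalar_prod_def lessThan_atLeast0 mult.commute)
      finally show ?thesis .
    qed
    ultimately show ?thesis by blast
  qed
  have "(\<Sum>c<d. b i c * B' $$ (j, c)) = (if i = j then 1 else 0)" if "i < d" "j < d" for i j
  proof -
    have "(\<Sum>c<d. b i c * B' $$ (j, c)) = (B' * ?B) $$ (j, i)"
      using that B'(1) by (simp add: col_mat_def scalar_prod_def lessThan_atLeast0 mult.commute)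
    also have "\<dots> = (if i = j then 1 else 0)" using that B'(3) by simp
    finally show ?thesis .
  qed
  moreover have "(\<Sum>i<d. B' $$ (i, c) * b i c') = (if c = c' then 1 else 0)"
    if "c < d" "c' < d" for c c'
  proof -
    have "(\<Sum>i<d. B' $$ (i, c) * b i c') = (?B * B') $$ (c', c)"
      using that B'(1) by (simp add: col_mat_def scalar_prod_def lessThan_atLeast0 mult.commute)
    also have "\<dots> = (if c = c' then 1 else 0)" using that B'(2) by simp
    finally show ?thesis .
  qed
  ultimately show thesis using that[of b "\<lambda>c j. B' $$ (j, c)"] bS coord by blast
qed

section \<open>Fourier sums over residues and flatness\<close>

text \<open>The function usually written e(x), a character of the reals modulo
  \<open>1\<close>.\<close>

definition unit_char :: "real \<Rightarrow> complex" where
  "unit_char x = cis (2 * pi * x)"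

lemma unit_char_add: "unit_char (x + y) = unit_char x * unit_char y"
  by (simp add: unit_char_def cis_mult distrib_left)

lemma unit_char_0 [simp]: "unit_char 0 = 1"
  by (simp add: unit_char_def)

lemma norm_unit_char [simp]: "norm (unit_char x) = 1"
  by (simp add: unit_char_def)

lemma unit_char_sum: "unit_char (\<Sum>i\<in>A. f i) = (\<Prod>i\<in>A. unit_char (f i))"
  by (induction A rule: infinite_finite_induct) (simp_all add: unit_char_add)

lemma unit_char_of_int [simp]: "unit_char (of_int m) = 1"
  by (simp add: unit_char_def)

lemma unit_char_eq_1_iff: "unit_char x = 1 \<longleftrightarrow> x \<in> \<int>"
proof
  assume "unit_char x = 1"
  then have "cos (2 * pi * x) = 1" by (auto simp: unit_char_def complex_eq_iff)
  then obtain m :: int where "2 * pi * x = of_int m * 2 * pi" using cos_one_2pi_int by blast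
  then have "x = of_int m" by simp
  then show "x \<in> \<int>" by simp
qed (auto elim!: Ints_cases)

lemma unit_char_uminus: "unit_char (- x) = cnj (unit_char x)"
  by (simp add: unit_char_def cis_cnj)

lemma Re_unit_char_nonneg: "\<bar>x - of_int m\<bar> \<le> 1/4 \<Longrightarrow> Re (unit_char x) \<ge> 0"
proof -
  assume *: "\<bar>x - of_int m\<bar> \<le> 1/4"
  have "unit_char x = unit_char (x - of_int m) * unit_char (of_int m)"
    unfolding unit_char_add[symmetric] by simp
  then have "Re (unit_char x) = cos (2 * pi * (x - of_int m))"
    by (simp add: unit_char_def)
  moreover have "\<bar>2 * pi * (x - of_int m)\<bar> \<le> 2 * pi * (1/4)"
    using * by (simp add: abs_mult del: abs_mult_self_eq)
  ultimately show ?thesis using cos_ge_zero[of "2 * pi * (x - of_int m)"] by linarith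
qed

text \<open>Third-order Taylor: \<open>x ^ 3 / 6\<close> is at most \<open>2 * x / 3\<close> on the
  interval up to \<open>2\<close>, which contains \<open>pi / 2\<close>.\<close>

lemma sin_ge_third:
  assumes "0 \<le> x" "x \<le> (2::real)"
  shows "x / 3 \<le> sin x"
proof -
  have "\<bar>sin x - x\<bar> \<le> x ^ 3 / 6"
    using Maclaurin_sin_bound[of x 3] assms(1)
    by (simp add: numeral_3_eq_3 sin_coeff_def fact_numeral)
  moreover have "x ^ 3 \<le> 4 * x"
    using mult_right_mono[OF power_mono[OF assms(2,1), of 2] assms(1)]
    by (simp add: power3_eq_cube power2_eq_square)
  ultimately show ?thesis by linarith
qed

text \<open>The norm equals \<open>2 * \<bar>sin (pi * x)\<bar>\<close>, which is at least
  \<open>2 * pi * \<bar>x\<bar> / 3\<close>.\<close>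

lemma norm_one_minus_unit_char_ge:
  assumes "\<bar>x\<bar> \<le> 1/2"
  shows "norm (1 - unit_char x) \<ge> \<bar>x\<bar>"
proof -
  have "(norm (1 - unit_char x))\<^sup>2 = (1 - cos (2 * pi * x))\<^sup>2 + (sin (2 * pi * x))\<^sup>2"
    by (simp add: cmod_power2 unit_char_def)
  also have "\<dots> = 2 - 2 * cos (2 * (pi * x))"
    using sin_cos_squared_add[of "2 * (pi * x)"] by (simp add: power2_eq_square algebra_simps)
  also have "\<dots> = (2 * sin (pi * x))\<^sup>2"
    unfolding cos_double_sin by (simp add: power_mult_distrib)
  also have "\<dots> = (2 * sin (pi * \<bar>x\<bar>))\<^sup>2"
    by (cases "x \<ge> 0") simp_all
  finally have "norm (1 - unit_char x) = \<bar>2 * sin (pi * \<bar>x\<bar>)\<bar>"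
    using power2_eq_iff_nonneg[of "norm (1 - unit_char x)" "\<bar>2 * sin (pi * \<bar>x\<bar>)\<bar>"] by simp
  also have "\<dots> \<ge> 2 * sin (pi * \<bar>x\<bar>)" by simp
  also have "pi * \<bar>x\<bar> \<le> 2" using mult_mono[of pi 4 "\<bar>x\<bar>" "1/2"] assms pi_less_4 by simp
  then have "2 * sin (pi * \<bar>x\<bar>) \<ge> 2 * (pi * \<bar>x\<bar> / 3)"
    using sin_ge_third[of "pi * \<bar>x\<bar>"] by simp
  moreover have "2 * \<bar>x\<bar> \<le> pi * \<bar>x\<bar>" using pi_ge_two by (intro mult_right_mono) auto
  ultimately show ?thesis by linarith
qed

text \<open>The Fourier transform of the interval from \<open>0\<close> to \<open>L - 1\<close>, a
  Dirichlet kernel.\<close>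

definition geometric_char :: "nat \<Rightarrow> real \<Rightarrow> complex" where
  "geometric_char L x = (\<Sum>a<L. unit_char (x * real a))"

lemma geometric_char_uminus: "geometric_char L (- x) = cnj (geometric_char L x)"
  by (simp add: geometric_char_def unit_char_uminus)

lemma norm_geometric_char_le: "norm (geometric_char L x) \<le> real L"
  unfolding geometric_char_def by (rule order_trans[OF norm_sum]) simp

text \<open>The geometric sum telescopes. The bound is independent of \<open>L\<close>, so it beats
  the trivial bound \<open>L\<close> as soon as \<open>L * \<bar>x\<bar>\<close> is large.\<close>

lemma norm_geometric_char_le':
  assumes "\<bar>x\<bar> \<le> 1/2" "x \<noteq> 0"
  shows "norm (geometric_char L x) \<le> 2 / \<bar>x\<bar>"
proof -
  have pow: "unit_char (x * real a) = unit_char x ^ a" for a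
    by (simp add: unit_char_def DeMoivre mult_ac)
  have "(1 - unit_char x) * geometric_char L x = 1 - unit_char x ^ L"
    unfolding geometric_char_def pow by (rule one_diff_power_eq[symmetric])
  then have "norm (1 - unit_char x) * norm (geometric_char L x) = norm (1 - unit_char x ^ L)"
    by (metis norm_mult)
  also have "\<dots> \<le> 2" using norm_triangle_ineq4[of 1 "unit_char x ^ L"] by (simp add: norm_power)
  finally have "\<bar>x\<bar> * norm (geometric_char L x) \<le> 2"
    using norm_one_minus_unit_char_ge[OF assms(1)]
    by (meson mult_right_mono norm_ge_zero order_trans)
  then show ?thesis using assms(2) by (simp add: field_simps)
qed

text \<open>Representatives modulo the integers of all \<open>w\<close> with \<open>w B\<close>
  integral. These are the characters of the quotient of the integer vectors by the lattice of all
  \<open>B z\<close>. Coordinates from \<open>d\<close> on are \<open>0\<close> so that a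
  representative is determined as a function.\<close>

definition dual_reps :: "nat \<Rightarrow> (nat \<Rightarrow> nat \<Rightarrow> int) \<Rightarrow> (nat \<Rightarrow> real) set" where
  "dual_reps d B = {w. (\<forall>j<d. - 1/2 \<le> w j \<and> w j < 1/2) \<and> (\<forall>j\<ge>d. w j = 0) \<and>
     (\<forall>c<d. (\<Sum>j<d. w j * of_int (B j c)) \<in> \<int>)}"

text \<open>Reduction modulo \<open>1\<close>; addition followed by \<open>wrap\<close> makes
  \<open>dual_reps\<close> a group.\<close>

definition wrap :: "nat \<Rightarrow> (nat \<Rightarrow> real) \<Rightarrow> nat \<Rightarrow> real" where
  "wrap d w j = (if j < d then w j - of_int \<lfloor>w j + 1/2\<rfloor> else 0)"

lemma wrap_bounds: "j < d \<Longrightarrow> - 1/2 \<le> wrap d w j \<and> wrap d w j < 1/2"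
  unfolding wrap_def by (simp; linarith)

lemma sum_wrap_int:
  "(\<Sum>j<d. wrap d w j * of_int (y j)) =
     (\<Sum>j<d. w j * of_int (y j)) - of_int (\<Sum>j<d. \<lfloor>w j + 1/2\<rfloor> * y j)"
  by (simp add: wrap_def algebra_simps sum_subtractf)

lemma wrap_mem_dual_reps:
  assumes "\<And>c. c < d \<Longrightarrow> (\<Sum>j<d. w j * of_int (B j c)) \<in> \<int>"
  shows "wrap d w \<in> dual_reps d B"
  using assms wrap_bounds[of _ d w] by (auto simp: dual_reps_def sum_wrap_int) (simp add: wrap_def)

lemma wrap_dual_reps:
  assumes "w \<in> dual_reps d B"
  shows "wrap d w = w"
proof
  fix j show "wrap d w j = w j"
  proof (cases "j < d")
    case True
    then have "\<lfloor>w j + 1/2\<rfloor> = 0" using assms by (auto simp: dual_reps_def floor_eq_iff)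
    then show ?thesis by (simp add: wrap_def True)
  qed (use assms in \<open>auto simp: dual_reps_def wrap_def\<close>)
qed

lemma wrap_wrap_add: "wrap d (\<lambda>j. wrap d (\<lambda>j. w j + u j) j + v j) = wrap d (\<lambda>j. w j + u j + v j)"
proof
  fix j
  have "\<lfloor>w j + u j - of_int \<lfloor>w j + u j + 1/2\<rfloor> + v j + 1/2\<rfloor> 
      = \<lfloor>w j + u j + v j + 1/2\<rfloor> - \<lfloor>w j + u j + 1/2\<rfloor>"
    using floor_diff_of_int[of "w j + u j + v j + 1/2" "\<lfloor>w j + u j + 1/2\<rfloor>"]
    by (simp add: algebra_simps)
  then show "wrap d (\<lambda>j. wrap d (\<lambda>j. w j + u j) j + v j) j = wrap d (\<lambda>j. w j + u j + v j) j"
    by (simp add: wrap_def)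
qed

lemma bij_betw_wrap_add:
  assumes u: "u \<in> dual_reps d B"
  shows "bij_betw (\<lambda>w. wrap d (\<lambda>j. w j + u j)) (dual_reps d B) (dual_reps d B)"
proof (rule bij_betw_byWitness[where f' = "\<lambda>w. wrap d (\<lambda>j. w j - u j)"])
  show "\<forall>w\<in>dual_reps d B. wrap d (\<lambda>j. wrap d (\<lambda>j. w j + u j) j - u j) = w"
    using wrap_wrap_add[of d _ u "\<lambda>j. - u j"] by (simp add: wrap_dual_reps)
  show "\<forall>w\<in>dual_reps d B. wrap d (\<lambda>j. wrap d (\<lambda>j. w j - u j) j + u j) = w"
    using wrap_wrap_add[of d _ "\<lambda>j. - u j" u] by (simp add: wrap_dual_reps)
  have sums: "(\<Sum>j<d. (w j + u j) * real_of_int (B j c)) \<in> \<int>"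
    "(\<Sum>j<d. (w j - u j) * real_of_int (B j c)) \<in> \<int>" if "w \<in> dual_reps d B" "c < d" for w c
    using that u by (simp_all add: dual_reps_def distrib_right left_diff_distrib sum.distrib sum_subtractf)
  show "(\<lambda>w. wrap d (\<lambda>j. w j + u j)) ` dual_reps d B \<subseteq> dual_reps d B"
    using sums(1) by (intro image_subsetI wrap_mem_dual_reps)
  show "(\<lambda>w. wrap d (\<lambda>j. w j - u j)) ` dual_reps d B \<subseteq> dual_reps d B"
    using sums(2) by (intro image_subsetI wrap_mem_dual_reps)
qed

text \<open>Orthogonality of characters: translation by \<open>u\<close> permutes the
  representatives and multiplies the sum by the value of \<open>u\<close> at \<open>y\<close>, so a
  nonzero sum forces all these values to be \<open>1\<close>. Applied to the rows of the inverse
  \<open>\<Lambda>\<close>, which represent characters because \<open>\<Lambda> B\<close> is the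
  identity, this says that \<open>\<Lambda> y\<close> is integral, and it is the required
  \<open>z\<close>.\<close>

lemma lattice_point_if_char_sum_nonzero:
  fixes y :: "nat \<Rightarrow> int"
  assumes BL: "\<And>i j. i < d \<Longrightarrow> j < d \<Longrightarrow> (\<Sum>c<d. of_int (B i c) * \<Lambda> c j) = (if i = j then 1 else (0::real))"
    and LB: "\<And>i j. i < d \<Longrightarrow> j < d \<Longrightarrow> (\<Sum>c<d. \<Lambda> i c * of_int (B c j)) = (if i = j then 1 else (0::real))"
    and nz: "(\<Sum>w\<in>dual_reps d B. unit_char (\<Sum>j<d. w j * of_int (y j))) \<noteq> 0"
  shows "\<exists>z. \<forall>j<d. (\<Sum>c<d. B j c * z c) = y j"
proof -
  let ?\<Omega> = "dual_reps d B"
  have all: "(\<Sum>j<d. u j * of_int (y j)) \<in> \<int>" if u: "u \<in> ?\<Omega>" for u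
  proof (rule ccontr)
    assume n: "(\<Sum>j<d. u j * of_int (y j)) \<notin> \<int>"
    let ?s = "\<Sum>w\<in>?\<Omega>. unit_char (\<Sum>j<d. w j * of_int (y j))"
    have "?s = (\<Sum>w\<in>?\<Omega>. unit_char (\<Sum>j<d. wrap d (\<lambda>j. w j + u j) j * of_int (y j)))"
      by (rule sum.reindex_bij_betw[OF bij_betw_wrap_add[OF u], symmetric])
    also have "\<dots> = (\<Sum>w\<in>?\<Omega>. unit_char (\<Sum>j<d. u j * of_int (y j)) * unit_char (\<Sum>j<d. w j * of_int (y j)))"
    proof (rule sum.cong[OF refl])
      fix w
      have "(\<Sum>j<d. wrap d (\<lambda>j. w j + u j) j * of_int (y j))
        = (\<Sum>j<d. u j * of_int (y j)) + (\<Sum>j<d. w j * of_int (y j))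
          + of_int (- (\<Sum>j<d. \<lfloor>w j + u j + 1/2\<rfloor> * y j))"
        unfolding sum_wrap_int by (simp add: distrib_right sum.distrib)
      then show "unit_char (\<Sum>j<d. wrap d (\<lambda>j. w j + u j) j * of_int (y j))
        = unit_char (\<Sum>j<d. u j * of_int (y j)) * unit_char (\<Sum>j<d. w j * of_int (y j))"
        by (simp only: unit_char_add unit_char_of_int mult_1_right)
    qed
    also have "\<dots> = unit_char (\<Sum>j<d. u j * of_int (y j)) * ?s" by (simp add: sum_distrib_left)
    finally have "unit_char (\<Sum>j<d. u j * of_int (y j)) = 1" using nz by simp
    then show False using n unit_char_eq_1_iff by blast
  qed
  have "(\<Sum>j<d. \<Lambda> i j * of_int (y j)) \<in> \<int>" if i: "i < d" for i
  proof -
    have "wrap d (\<Lambda> i) \<in> ?\<Omega>" by (rule wrap_mem_dual_reps) (simp add: LB[OF i])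
    from all[OF this] have "(\<Sum>j<d. wrap d (\<Lambda> i) j * of_int (y j)) + of_int (\<Sum>j<d. \<lfloor>\<Lambda> i j + 1/2\<rfloor> * y j) \<in> \<int>"
      by (metis Ints_add Ints_of_int)
    then show ?thesis unfolding sum_wrap_int by simp
  qed
  then have "\<forall>i. \<exists>z. i < d \<longrightarrow> (\<Sum>j<d. \<Lambda> i j * of_int (y j)) = of_int z"
    unfolding Ints_def by blast
  then obtain z where z: "\<forall>i. i < d \<longrightarrow> (\<Sum>j<d. \<Lambda> i j * of_int (y j)) = of_int (z i)"
    by (rule choice[THEN exE])
  have "(\<Sum>c<d. B j c * z c) = y j" if j: "j < d" for j
  proof -
    have "real_of_int (\<Sum>c<d. B j c * z c) = (\<Sum>c<d. of_int (B j c) * (\<Sum>i<d. \<Lambda> c i * of_int (y i)))"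
      unfolding of_int_sum of_int_mult using z by (intro sum.cong refl) simp
    also have "\<dots> = (\<Sum>i<d. (\<Sum>c<d. of_int (B j c) * \<Lambda> c i) * of_int (y i))"
      unfolding sum_distrib_left sum_distrib_right mult.assoc[symmetric] by (rule sum.swap)
    also have "\<dots> = of_int (y j)" using j BL
      by (simp add: if_distrib[of "\<lambda>x. x * _"] cong: if_cong)
    finally show ?thesis by linarith
  qed
  then show ?thesis by blast
qed

text \<open>Opposite signs give complex conjugates, so factors pair up to squared norms. This is why
  the sums below alternate: their Fourier weights become nonnegative reals without moving the
  center.\<close>

lemma prod_geometric_char_alternating:
  "(\<Prod>q<2 * m. geometric_char L ((- 1) ^ q * x)) = of_real (norm (geometric_char L x) ^ (2 * m))"
proof (induction m)
  case (Suc m)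
  have "(\<Prod>q<2 * Suc m. geometric_char L ((- 1) ^ q * x)) =
    of_real (norm (geometric_char L x) ^ (2 * m)) * (geometric_char L x * cnj (geometric_char L x))"
    by (simp add: Suc geometric_char_uminus mult.assoc)
  then show ?case by (simp add: complex_norm_square[symmetric] power_add power2_eq_square)
qed simp

text \<open>The points \<open>y a\<close> surround \<open>s\<close> with the multiplicities of a
  \<open>2 * m\<close>-fold convolution of intervals. On the Fourier side convolution becomes a
  power, so a larger \<open>m\<close> damps the nontrivial characters more.\<close>

lemma sum_char_box:
  fixes m d :: nat and s :: "nat \<Rightarrow> int" and L :: "nat \<Rightarrow> nat" and w :: "nat \<Rightarrow> real"
  defines "y \<equiv> \<lambda>a j. s j + (\<Sum>q<2 * m. (- 1) ^ q * int (a (j, q)))"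
  shows "(\<Sum>a\<in>PiE ({..<d} \<times> {..<2 * m}) (\<lambda>x. {..<L (fst x)}). unit_char (\<Sum>j<d. w j * of_int (y a j)))
    = unit_char (\<Sum>j<d. w j * of_int (s j)) *
      of_real (\<Prod>j<d. norm (geometric_char (L j) (w j)) ^ (2 * m))"
proof -
  let ?A = "{..<d} \<times> {..<2 * m}"
  have "unit_char (\<Sum>j<d. w j * of_int (y a j)) = unit_char (\<Sum>j<d. w j * of_int (s j)) *
      (\<Prod>x\<in>?A. unit_char ((- 1) ^ snd x * w (fst x) * real (a x)))" for a
  proof -
    have "(\<Sum>j<d. w j * of_int (y a j)) = (\<Sum>j<d. w j * of_int (s j)) +
        (\<Sum>j<d. \<Sum>q<2 * m. (- 1) ^ q * w j * real (a (j, q)))"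
      by (simp add: y_def distrib_left sum.distrib sum_distrib_left mult_ac)
    also have "(\<Sum>j<d. \<Sum>q<2 * m. (- 1) ^ q * w j * real (a (j, q)))
        = (\<Sum>x\<in>?A. (- 1) ^ snd x * w (fst x) * real (a x))"
      by (simp add: sum.cartesian_product split_beta)
    finally show ?thesis by (simp add: unit_char_add unit_char_sum)
  qed
  then have "(\<Sum>a\<in>PiE ?A (\<lambda>x. {..<L (fst x)}). unit_char (\<Sum>j<d. w j * of_int (y a j))) =
     unit_char (\<Sum>j<d. w j * of_int (s j)) *
     (\<Sum>a\<in>PiE ?A (\<lambda>x. {..<L (fst x)}). \<Prod>x\<in>?A. unit_char ((- 1) ^ snd x * w (fst x) * real (a x)))"
    by (simp add: sum_distrib_left)
  also have "(\<Sum>a\<in>PiE ?A (\<lambda>x. {..<L (fst x)}). \<Prod>x\<in>?A. unit_char ((- 1) ^ snd x * w (fst x) * real (a x)))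
     = (\<Prod>x\<in>?A. geometric_char (L (fst x)) ((- 1) ^ snd x * w (fst x)))"
    unfolding geometric_char_def by (rule prod_sum_PiE[symmetric]) auto
  also have "\<dots> = (\<Prod>j<d. \<Prod>q<2 * m. geometric_char (L j) ((- 1) ^ q * w j))"
    by (simp add: prod.cartesian_product split_beta)
  also have "\<dots> = of_real (\<Prod>j<d. norm (geometric_char (L j) (w j)) ^ (2 * m))"
    by (simp add: prod_geometric_char_alternating)
  finally show ?thesis .
qed

text \<open>The number of lattice points near \<open>s\<close>, weighted by how often they are a sum of \<open>2m\<close> terms,
  is the sum over all characters of the lattice quotient; the trivial character dominates.\<close>

lemma lattice_point_near:
  fixes s :: "nat \<Rightarrow> int" and L :: "nat \<Rightarrow> nat" and B :: "nat \<Rightarrow> nat \<Rightarrow> int"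
  assumes BL: "\<And>i j. i < d \<Longrightarrow> j < d \<Longrightarrow> (\<Sum>c<d. of_int (B i c) * \<Lambda> c j) = (if i = j then 1 else (0::real))"
    and LB: "\<And>i j. i < d \<Longrightarrow> j < d \<Longrightarrow> (\<Sum>c<d. \<Lambda> i c * of_int (B c j)) = (if i = j then 1 else (0::real))"
    and fin: "finite (dual_reps d B)"
    and small: "real (card (dual_reps d B)) * \<delta> ^ (2 * m) < 1" "\<delta> \<ge> 0"
    and L: "\<And>j. j < d \<Longrightarrow> L j \<ge> 1"
    and w: "\<And>w. w \<in> dual_reps d B \<Longrightarrow> w \<noteq> (\<lambda>_. 0) \<Longrightarrow>
       Re (unit_char (\<Sum>j<d. w j * of_int (s j))) \<ge> 0 \<or>
       (\<exists>j<d. norm (geometric_char (L j) (w j)) \<le> real (L j) * \<delta>)"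
  shows "\<exists>z. \<forall>j<d. \<bar>(\<Sum>c<d. B j c * z c) - s j\<bar> \<le> 2 * int m * (int (L j) - 1)"
proof -
  let ?\<Omega> = "dual_reps d B" and ?P = "PiE ({..<d} \<times> {..<2 * m}) (\<lambda>x. {..<L (fst x)})"
  define y where "y a j = s j + (\<Sum>q<2 * m. (- 1) ^ q * int (a (j, q)))" for a j
  define \<tau> where "\<tau> w = unit_char (\<Sum>j<d. w j * of_int (s j)) *
      of_real (\<Prod>j<d. norm (geometric_char (L j) (w j)) ^ (2 * m))" for w
  define N where "N = (\<Prod>j<d. real (L j) ^ (2 * m))"
  have N: "N > 0" unfolding N_def using L by (fastforce intro!: prod_pos zero_less_power)
  have zero: "(\<lambda>_. 0) \<in> ?\<Omega>" by (simp add: dual_reps_def)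
  have \<tau>0: "\<tau> (\<lambda>_. 0) = of_real N" by (simp add: \<tau>_def N_def geometric_char_def)
  have \<tau>: "Re (\<tau> w) \<ge> - (N * \<delta> ^ (2 * m))" if wO: "w \<in> ?\<Omega>" "w \<noteq> (\<lambda>_. 0)" for w
    using w[OF wO]
  proof
    assume *: "Re (unit_char (\<Sum>j<d. w j * of_int (s j))) \<ge> 0"
    have "Re (\<tau> w) = Re (unit_char (\<Sum>j<d. w j * of_int (s j))) *
        (\<Prod>j<d. norm (geometric_char (L j) (w j)) ^ (2 * m))"
      unfolding \<tau>_def by (simp del: of_real_prod)
    also have "\<dots> \<ge> 0" using * by (intro mult_nonneg_nonneg prod_nonneg) auto
    finally have "Re (\<tau> w) \<ge> 0" .
    moreover have "N * \<delta> ^ (2 * m) \<ge> 0" using N small(2) by simp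
    ultimately show ?thesis by linarith
  next
    assume "\<exists>j<d. norm (geometric_char (L j) (w j)) \<le> real (L j) * \<delta>"
    then obtain i where i: "i < d" "norm (geometric_char (L i) (w i)) \<le> real (L i) * \<delta>" by blast
    have "norm (\<tau> w) = (\<Prod>j<d. norm (geometric_char (L j) (w j)) ^ (2 * m))"
      unfolding \<tau>_def norm_mult norm_of_real by (simp add: prod_nonneg)
    also have "\<dots> = norm (geometric_char (L i) (w i)) ^ (2 * m) *
        (\<Prod>j\<in>{..<d} - {i}. norm (geometric_char (L j) (w j)) ^ (2 * m))"
      using i by (simp add: prod.remove)
    \<comment> \<open>One damped coordinate suffices; the other factors are bounded by their values
      at the trivial character.\<close>
    also have "\<dots> \<le> (real (L i) * \<delta>) ^ (2 * m) * (\<Prod>j\<in>{..<d} - {i}. real (L j) ^ (2 * m))"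
      using i small(2)
      by (intro mult_mono power_mono prod_mono conjI prod_nonneg ballI) (auto simp: norm_geometric_char_le)
    also have "\<dots> = N * \<delta> ^ (2 * m)"
      unfolding N_def using i by (subst prod.remove[of "{..<d}" i]) (auto simp: power_mult_distrib)
    finally show ?thesis using abs_Re_le_cmod[of "\<tau> w"] by linarith
  qed
  have "(\<Sum>w\<in>?\<Omega>. Re (\<tau> w)) = N + (\<Sum>w\<in>?\<Omega> - {\<lambda>_. 0}. Re (\<tau> w))"
    using fin zero by (simp add: sum.remove \<tau>0)
  moreover have "(\<Sum>w\<in>?\<Omega> - {\<lambda>_. 0}. Re (\<tau> w)) \<ge> (\<Sum>w\<in>?\<Omega> - {\<lambda>_. 0}. - (N * \<delta> ^ (2 * m)))"
    using \<tau> by (intro sum_mono) auto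
  moreover have "(\<Sum>w\<in>?\<Omega> - {\<lambda>_. 0}. N * \<delta> ^ (2 * m)) \<le> (\<Sum>w\<in>?\<Omega>. N * \<delta> ^ (2 * m))"
    using N small(2) fin by (intro sum_mono2) auto
  moreover have "(\<Sum>w\<in>?\<Omega>. N * \<delta> ^ (2 * m)) = N * (real (card ?\<Omega>) * \<delta> ^ (2 * m))" by simp
  moreover have "N * (real (card ?\<Omega>) * \<delta> ^ (2 * m)) < N * 1"
    using N small by (intro mult_strict_left_mono)
  ultimately have "Re (\<Sum>w\<in>?\<Omega>. \<tau> w) > 0" by (simp add: sum_negf mult.left_commute)
  \<comment> \<open>Interchanging the sums turns the positive total into a single point
    \<open>y a\<close> whose character sum does not vanish, and such a point lies in the
    lattice.\<close>
  moreover have "(\<Sum>w\<in>?\<Omega>. \<tau> w) = (\<Sum>a\<in>?P. \<Sum>w\<in>?\<Omega>. unit_char (\<Sum>j<d. w j * of_int (y a j)))"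
    unfolding \<tau>_def y_def sum_char_box[symmetric] by (rule sum.swap)
  ultimately have "\<exists>a\<in>?P. (\<Sum>w\<in>?\<Omega>. unit_char (\<Sum>j<d. w j * of_int (y a j))) \<noteq> 0"
    by (metis (no_types, lifting) sum.neutral zero_complex.sel(1) less_irrefl)
  then obtain a where a: "a \<in> ?P" "(\<Sum>w\<in>?\<Omega>. unit_char (\<Sum>j<d. w j * of_int (y a j))) \<noteq> 0" by blast
  obtain z where z: "\<forall>j<d. (\<Sum>c<d. B j c * z c) = y a j"
    using lattice_point_if_char_sum_nonzero[OF BL LB a(2)] by blast
  have "\<bar>y a j - s j\<bar> \<le> 2 * int m * (int (L j) - 1)" if j: "j < d" for j
  proof -
    have "\<bar>y a j - s j\<bar> \<le> (\<Sum>q<2 * m. \<bar>(- 1) ^ q * int (a (j, q))\<bar>)"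
      unfolding y_def by (simp add: sum_abs)
    also have "\<dots> \<le> (\<Sum>q<2 * m. int (L j) - 1)"
      using a(1) j by (intro sum_mono) (force simp: abs_mult power_abs PiE_iff)
    finally show ?thesis by simp
  qed
  then show ?thesis using z by (intro exI[of _ z]) simp
qed

section \<open>Central points and relaxed polytopes\<close>

definition dot :: "nat \<Rightarrow> (nat \<Rightarrow> real) \<Rightarrow> (nat \<Rightarrow> real) \<Rightarrow> real" where
  "dot k g x = (\<Sum>c<k. g c * x c)"

lemma dot_uminus: "dot k (\<lambda>c. - g c) x = - dot k g x"
  by (simp add: dot_def sum_negf)

text \<open>The average of a near-maximal simplex is central: every functional attains on it a fixed
  fraction of its range.\<close>

lemma central_point:
  fixes Q :: "(nat \<Rightarrow> real) set"
  assumes x0: "x0 \<in> Q" and \<eta>: "\<eta> > 0"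
    and pert: "\<And>c. c < k \<Longrightarrow> (\<lambda>j. x0 j + (if j = c then \<eta> else 0)) \<in> Q"
    and bounded: "\<And>x c. x \<in> Q \<Longrightarrow> c < k \<Longrightarrow> \<bar>x c\<bar> \<le> M"
    and avg: "\<And>X. (\<And>i. i \<le> k \<Longrightarrow> X i \<in> Q) \<Longrightarrow> (\<lambda>c. (\<Sum>i\<le>k. X i c) / (real k + 1)) \<in> Q"
  obtains xb where "xb \<in> Q" and
    "\<And>g \<beta> y. (\<And>x. x \<in> Q \<Longrightarrow> dot k g x \<le> \<beta>) \<Longrightarrow> y \<in> Q \<Longrightarrow>
       \<beta> - dot k g y \<le> (2 * real k + 1) * (real k + 1) * (\<beta> - dot k g xb)"
proof -
  define S where "S = (\<lambda>x c. x c - x0 c) ` Q"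
  have 1: "\<bar>s c\<bar> \<le> M + M" if s: "s \<in> S" "c < k" for s c
  proof -
    obtain x where "s = (\<lambda>c. x c - x0 c)" "x \<in> Q" using s(1) unfolding S_def by (rule imageE)
    then show ?thesis using bounded[of x c] bounded[OF x0, of c] that(2) by simp
  qed
  \<comment> \<open>The shifts by \<open>\<eta>\<close> along the axes make the differences span the
    space; \<open>3\<close> provides the inverse of this diagonal basis.\<close>
  have 2: "(\<lambda>j. if j = i then \<eta> else 0) \<in> S" if "i < k" for i
    unfolding S_def by (rule image_eqI[OF _ pert[OF that]]) auto
  have 3: "(\<Sum>c<k. (if c = i then 1 / \<eta> else 0) * (if j = c then \<eta> else 0)) = (if i = j then 1 else 0)"
    if "i < k" "j < k" for i j
  proof -
    have "(\<Sum>c<k. (if c = i then 1 / \<eta> else 0) * (if j = c then \<eta> else 0))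
        = (\<Sum>c<k. if c = i then (if j = i then 1 else 0) else 0)"
      using \<eta> by (intro sum.cong) auto
    then show ?thesis using that by simp
  qed
  obtain b where bS: "\<And>i. i < k \<Longrightarrow> b i \<in> S"
    and coord: "\<And>s. s \<in> S \<Longrightarrow> \<exists>l. (\<forall>i<k. \<bar>l i\<bar> \<le> 2) \<and> (\<forall>c<k. s c = (\<Sum>i<k. l i * b i c))"
    by (rule bounded_coordinates_basis[of S k "M + M" "\<lambda>i j. if j = i then \<eta> else 0"
        "\<lambda>i c. if c = i then 1 / \<eta> else 0"]) (use 1 2 3 in blast)+
  have "\<forall>i. \<exists>x. i < k \<longrightarrow> x \<in> Q \<and> b i = (\<lambda>c. x c - x0 c)" using bS unfolding S_def by blast
  then obtain X where X: "\<forall>i. i < k \<longrightarrow> X i \<in> Q \<and> b i = (\<lambda>c. X i c - x0 c)" by (rule choice[THEN exE])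
  \<comment> \<open>The last index \<open>i = k\<close> stands for \<open>x0\<close>, so
    \<open>xb\<close> averages all \<open>k + 1\<close> vertices of the simplex.\<close>
  define xb where "xb = (\<lambda>c. (\<Sum>i\<le>k. (if i < k then X i else x0) c) / (real k + 1))"
  have xb: "xb \<in> Q" unfolding xb_def using X x0 by (intro avg) auto
  have dot_xb: "(real k + 1) * dot k g xb = dot k g x0 + (\<Sum>i<k. dot k g (X i))" for g
  proof -
    have "xb = (\<lambda>c. (x0 c + (\<Sum>i<k. X i c)) / (real k + 1))"
      by (simp add: xb_def lessThan_Suc_atMost[symmetric] add.commute)
    then have "(real k + 1) * dot k g xb = (\<Sum>c<k. g c * (x0 c + (\<Sum>i<k. X i c)))"
      unfolding dot_def by (simp add: sum_distrib_left)
    also have "\<dots> = dot k g x0 + (\<Sum>c<k. \<Sum>i<k. g c * X i c)"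
      by (simp add: dot_def distrib_left sum.distrib sum_distrib_left)
    also have "(\<Sum>c<k. \<Sum>i<k. g c * X i c) = (\<Sum>i<k. dot k g (X i))"
      unfolding dot_def by (rule sum.swap)
    finally show ?thesis .
  qed
  have "\<beta> - dot k g y \<le> (2 * real k + 1) * (real k + 1) * (\<beta> - dot k g xb)"
    if le: "\<And>x. x \<in> Q \<Longrightarrow> dot k g x \<le> \<beta>" and y: "y \<in> Q" for g \<beta> y
  proof -
    obtain l where l: "\<forall>i<k. \<bar>l i\<bar> \<le> 2" "\<forall>c<k. y c - x0 c = (\<Sum>i<k. l i * b i c)"
      using coord[of "\<lambda>c. y c - x0 c"] y unfolding S_def by blast
    \<comment> \<open>\<open>G\<close> is affine and nonnegative on \<open>Q\<close>. Coordinates of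
      absolute value at most \<open>2\<close> bound \<open>G y\<close> by \<open>2 * k + 1\<close>
      times the sum of \<open>G\<close> over the vertices, and this sum is
      \<open>(k + 1) * G xb\<close>.\<close>
    define G where "G x = \<beta> - dot k g x" for x
    have G0: "G x \<ge> 0" if "x \<in> Q" for x using le[OF that] by (simp add: G_def)
    have "dot k g y - dot k g x0 = (\<Sum>c<k. g c * (y c - x0 c))"
      by (simp add: dot_def right_diff_distrib sum_subtractf)
    also have "\<dots> = (\<Sum>c<k. \<Sum>i<k. g c * (l i * (X i c - x0 c)))"
      using l X by (intro sum.cong) (auto simp: sum_distrib_left)
    also have "\<dots> = (\<Sum>i<k. l i * (dot k g (X i) - dot k g x0))"
      by (subst sum.swap)
        (simp add: dot_def right_diff_distrib sum_subtractf sum_distrib_left mult.left_commute)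
    finally have "G y = G x0 + (\<Sum>i<k. l i * (G (X i) - G x0))"
      by (simp add: G_def algebra_simps sum_subtractf sum_negf sum.distrib)
    also have "\<dots> \<le> G x0 + (\<Sum>i<k. 2 * (G (X i) + G x0))"
    proof (intro add_left_mono sum_mono)
      fix i assume i: "i \<in> {..<k}"
      have "l i * (G (X i) - G x0) \<le> \<bar>l i\<bar> * \<bar>G (X i) - G x0\<bar>"
        by (metis abs_ge_self abs_mult)
      also have "\<dots> \<le> 2 * (G (X i) + G x0)"
        using l(1) i X G0[of "X i"] G0[OF x0] by (intro mult_mono) auto
      finally show "l i * (G (X i) - G x0) \<le> 2 * (G (X i) + G x0)" .
    qed
    also have "\<dots> = (2 * real k + 1) * G x0 + 2 * (\<Sum>i<k. G (X i))"
      unfolding sum_distrib_left[symmetric] by (simp add: sum.distrib algebra_simps)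
    also have "\<dots> \<le> (2 * real k + 1) * G x0 + (2 * real k + 1) * (\<Sum>i<k. G (X i))"
    proof (cases "k = 0")
      case False
      have "(\<Sum>i<k. G (X i)) \<ge> 0" using G0 X by (intro sum_nonneg) auto
      then show ?thesis using False by (intro add_left_mono mult_right_mono) auto
    qed simp
    also have "\<dots> = (2 * real k + 1) * ((real k + 1) * G xb)"
      unfolding G_def by (simp add: right_diff_distrib dot_xb sum_subtractf) (simp add: algebra_simps)
    finally show ?thesis by (simp add: G_def)
  qed
  then show thesis using that xb by blast
qed

definition relaxed ::
  "nat \<Rightarrow> 'i set \<Rightarrow> ('i \<Rightarrow> nat \<Rightarrow> int) \<Rightarrow> ('i \<Rightarrow> int) \<Rightarrow> ('i \<Rightarrow> int) \<Rightarrow> real \<Rightarrow> (nat \<Rightarrow> real) set" where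
  "relaxed k I A lo hi e = {x. \<forall>i\<in>I. of_int (lo i) - e \<le> dot k (\<lambda>c. of_int (A i c)) x \<and>
     dot k (\<lambda>c. of_int (A i c)) x \<le> of_int (hi i) + e}"

lemma relaxed_mono: "e \<le> e' \<Longrightarrow> relaxed k I A lo hi e \<subseteq> relaxed k I A lo hi e'"
  by (fastforce simp: relaxed_def)

lemma relaxed_average:
  assumes "\<And>i. i \<le> k \<Longrightarrow> X i \<in> relaxed k I A lo hi e"
  shows "(\<lambda>c. (\<Sum>i\<le>k. X i c) / (real k + 1)) \<in> relaxed k I A lo hi e"
proof -
  have dot: "(real k + 1) * dot k g (\<lambda>c. (\<Sum>i\<le>k. X i c) / (real k + 1)) = (\<Sum>i\<le>k. dot k g (X i))" for g
  proof -
    have "(real k + 1) * dot k g (\<lambda>c. (\<Sum>i\<le>k. X i c) / (real k + 1)) = (\<Sum>c<k. \<Sum>i\<le>k. g c * X i c)"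
    proof -
      have "(real k + 1) * (g c * ((\<Sum>i\<le>k. X i c) / (real k + 1))) = (\<Sum>i\<le>k. g c * X i c)" for c
        by (simp add: sum_distrib_left[symmetric])
      then show ?thesis unfolding dot_def by (simp add: sum_distrib_left)
    qed
    then show ?thesis unfolding dot_def by (simp add: sum.swap[of _ "{..<k}"])
  qed
  show ?thesis unfolding relaxed_def
  proof (intro CollectI ballI)
    fix r assume r: "r \<in> I"
    let ?g = "\<lambda>c. real_of_int (A r c)"
    let ?x = "\<lambda>c. (\<Sum>i\<le>k. X i c) / (real k + 1)"
    have "(\<Sum>i\<le>k. dot k ?g (X i)) \<ge> (\<Sum>i\<le>k. of_int (lo r) - e)"
      and "(\<Sum>i\<le>k. dot k ?g (X i)) \<le> (\<Sum>i\<le>k. of_int (hi r) + e)"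
      using assms r by (intro sum_mono; auto simp: relaxed_def)+
    then have "(real k + 1) * (of_int (lo r) - e) \<le> (real k + 1) * dot k ?g ?x"
      and "(real k + 1) * dot k ?g ?x \<le> (real k + 1) * (of_int (hi r) + e)"
      unfolding dot by (simp_all add: add.commute)
    then show "of_int (lo r) - e \<le> dot k ?g ?x \<and> dot k ?g ?x \<le> of_int (hi r) + e"
      by simp
  qed
qed

text \<open>As \<open>B\<close> is invertible, \<open>w\<close> is determined by the integer vector
  \<open>w B\<close>, whose entries are at most \<open>d\<close> in absolute value; there are
  \<open>(2 * d + 1) ^ d\<close> such vectors.\<close>

lemma dual_reps_finite_card:
  assumes LB: "\<And>i j. i < d \<Longrightarrow> j < d \<Longrightarrow> (\<Sum>c<d. of_int (B i c) * \<Lambda> c j) = (if i = j then 1 else (0::real))"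
    and B: "\<And>j c. j < d \<Longrightarrow> c < d \<Longrightarrow> \<bar>B j c\<bar> \<le> 1"
  shows "finite (dual_reps d B)" "card (dual_reps d B) \<le> (2 * d + 1) ^ d"
    and "w \<in> dual_reps d B \<Longrightarrow> c < d \<Longrightarrow> \<bar>\<Sum>j<d. w j * of_int (B j c)\<bar> \<le> real d"
proof -
  let ?v = "\<lambda>w. \<lambda>c\<in>{..<d}. \<lfloor>\<Sum>j<d. w j * of_int (B j c)\<rfloor>"
  let ?T = "PiE {..<d} (\<lambda>_. {- int d..int d})"
  have bound: "\<bar>\<Sum>j<d. w j * of_int (B j c)\<bar> \<le> real d" if w: "w \<in> dual_reps d B" and c: "c < d" for w c
  proof -
    have "\<bar>\<Sum>j<d. w j * of_int (B j c)\<bar> \<le> (\<Sum>j<d. \<bar>w j * of_int (B j c)\<bar>)" by (rule sum_abs)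
    also have "\<dots> \<le> (\<Sum>j<d. 1)"
    proof (rule sum_mono)
      fix j assume "j \<in> {..<d}"
      then have "\<bar>w j\<bar> \<le> 1/2" "\<bar>B j c\<bar> \<le> 1" using w c B by (auto simp: dual_reps_def abs_le_iff)
      then have "\<bar>w j\<bar> * \<bar>real_of_int (B j c)\<bar> \<le> 1 * 1" by (intro mult_mono) linarith+
      then show "\<bar>w j * of_int (B j c)\<bar> \<le> 1" by (simp add: abs_mult)
    qed
    finally show ?thesis by simp
  qed
  then show "w \<in> dual_reps d B \<Longrightarrow> c < d \<Longrightarrow> \<bar>\<Sum>j<d. w j * of_int (B j c)\<bar> \<le> real d" .
  have int: "of_int (?v w c) = (\<Sum>j<d. w j * of_int (B j c))" if "w \<in> dual_reps d B" "c < d" for w c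
    using that by (auto simp: dual_reps_def elim!: Ints_cases)
  have into: "?v ` dual_reps d B \<subseteq> ?T"
  proof (rule image_subsetI)
    fix w assume w: "w \<in> dual_reps d B"
    have "?v w c \<in> {- int d..int d}" if c: "c < d" for c
    proof -
      have "\<bar>real_of_int (?v w c)\<bar> \<le> real d" unfolding int[OF w c] by (rule bound[OF w c])
      then show ?thesis by (simp only: atLeastAtMost_iff) linarith
    qed
    then show "?v w \<in> ?T" by (simp add: PiE_iff)
  qed
  have inj: "inj_on ?v (dual_reps d B)"
  proof (rule inj_onI, rule ext)
    fix w w' i assume w: "w \<in> dual_reps d B" "w' \<in> dual_reps d B" and eq: "?v w = ?v w'"
    have eqs: "(\<Sum>j<d. w j * of_int (B j c)) = (\<Sum>j<d. w' j * of_int (B j c))" if "c < d" for c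
      unfolding int[OF w(1) that, symmetric] int[OF w(2) that, symmetric] eq ..
    have inv: "(\<Sum>c<d. (\<Sum>j<d. u j * of_int (B j c)) * \<Lambda> c i) = u i" if "i < d" for u
    proof -
      have "(\<Sum>c<d. (\<Sum>j<d. u j * of_int (B j c)) * \<Lambda> c i) = (\<Sum>j<d. u j * (\<Sum>c<d. of_int (B j c) * \<Lambda> c i))"
        unfolding sum_distrib_left sum_distrib_right mult.assoc by (rule sum.swap)
      also have "\<dots> = u i" using that LB by (simp add: if_distrib[of "\<lambda>x. _ * x"] cong: if_cong)
      finally show ?thesis .
    qed
    show "w i = w' i"
    proof (cases "i < d")
      case True
      have "(\<Sum>c<d. (\<Sum>j<d. w j * of_int (B j c)) * \<Lambda> c i) = (\<Sum>c<d. (\<Sum>j<d. w' j * of_int (B j c)) * \<Lambda> c i)"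
        using eqs by (intro sum.cong) auto
      then show ?thesis using inv[OF True] by simp
    qed (use w in \<open>auto simp: dual_reps_def\<close>)
  qed
  have finT: "finite ?T" by (intro finite_PiE) auto
  then show "finite (dual_reps d B)" using inj into by (meson finite_imageD finite_subset)
  have "card (dual_reps d B) \<le> card ?T" using inj into finT by (rule card_inj_on_le)
  also have "\<dots> = (\<Prod>i<d. nat (2 * int d + 1))" by (simp add: card_PiE)
  also have "\<dots> = (2 * d + 1) ^ d" by (simp add: nat_add_distrib nat_mult_distrib)
  finally show "card (dual_reps d B) \<le> (2 * d + 1) ^ d" .
qed

text \<open>Directions \<open>v\<close> with entries at most \<open>k\<close> suffice: a character of the lattice quotient is given by
  some \<open>v = w B\<close> with \<open>w\<close> in the cube \<open>[-1/2, 1/2)\<close>, where \<open>B\<close> has entries \<open>-1\<close>, \<open>0\<close> and \<open>1\<close>.\<close>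

theorem integer_point_in_wide_polytope:
  fixes A :: "'i \<Rightarrow> nat \<Rightarrow> int" and lo hi :: "'i \<Rightarrow> int" and I I0 :: "'i set" and k :: nat and e :: real
  defines "Q \<equiv> relaxed k I A lo hi"
  defines "v_dot \<equiv> \<lambda>v x. dot k (\<lambda>c. real_of_int (v c)) x"
  assumes k: "k \<ge> 1" and I: "I0 \<subseteq> I"
    and A01: "\<And>i c. i \<in> I0 \<Longrightarrow> c < k \<Longrightarrow> \<bar>A i c\<bar> \<le> 1"
    and Abd: "\<And>i c. i \<in> I \<Longrightarrow> c < k \<Longrightarrow> \<bar>A i c\<bar> \<le> int k + 1"
    and unit: "\<And>c. c < k \<Longrightarrow> \<exists>i\<in>I0. \<forall>j<k. A i j = (if j = c then 1 else 0)"
    and e: "0 < e" "e * (32 * (real k + 1)) \<le> 1"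
    and x0: "x0 \<in> Q e"
    and cases: "\<And>v. (\<And>c. c < k \<Longrightarrow> \<bar>v c\<bar> \<le> int k) \<Longrightarrow>
       (\<exists>t::int. \<forall>x\<in>Q (2 * e). \<bar>v_dot v x - of_int t\<bar> \<le> 2 * e) \<or>
       (\<exists>x\<in>Q e. \<exists>y\<in>Q e. v_dot v x - v_dot v y \<ge> 2048 * (real k + 1) ^ 6)"
  shows "\<exists>z. \<forall>i\<in>I0. lo i \<le> (\<Sum>c<k. A i c * z c) \<and> (\<Sum>c<k. A i c * z c) \<le> hi i"
proof -
  \<comment> \<open>\<open>\<kappa>\<close> is the loss in \<open>central_point\<close>.
    \<open>\<delta>\<close> is small enough for its power \<open>2 * k\<close> to beat the number of
    characters. \<open>\<theta>\<close> satisfies \<open>\<theta> * \<delta> = 32 * k^2\<close>,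
    which makes a character damped by \<open>\<delta>\<close> once
    \<open>\<rho> j * \<bar>w j\<bar>\<close> exceeds \<open>\<theta>\<close>. \<open>W\<close> is
    at least \<open>8 * k * \<theta> * \<kappa>\<close>, so that a wide direction cannot be
    assembled from undamped coordinates.\<close>
  define \<kappa> where "\<kappa> = (2 * real k + 1) * (real k + 1)"
  define W where "W = 2048 * (real k + 1) ^ 6"
  define \<theta> where "\<theta> = 64 * (real k)\<^sup>2 * (2 * real k + 1)"
  define \<delta> where "\<delta> = 1 / (2 * (2 * real k + 1))"
  have \<kappa>: "\<kappa> \<ge> 1" using mult_mono[of 1 "2 * real k + 1" 1 "real k + 1"] by (simp add: \<kappa>_def)
  have \<theta>: "\<theta> \<ge> 64" using k mult_mono[of 1 "(real k)\<^sup>2" 1 "2 * real k + 1"] by (simp add: \<theta>_def)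
  have W: "W \<ge> 8 * real k * \<theta> * \<kappa>"
  proof -
    have "8 * real k * \<theta> * \<kappa> = 512 * ((real k) ^ 3 * (2 * real k + 1)\<^sup>2 * (real k + 1))"
      by (simp add: \<theta>_def \<kappa>_def power2_eq_square power3_eq_cube)
    also have "\<dots> \<le> 512 * ((real k + 1) ^ 3 * (2 * (real k + 1))\<^sup>2 * (real k + 1))"
      by (intro mult_left_mono mult_mono power_mono) auto
    also have "\<dots> = W" 
    proof -
      have "512 * (y ^ 3 * (2 * y)\<^sup>2 * y) = 2048 * y ^ 6" for y :: real
        by (simp add: power_mult_distrib power_numeral_reduce)
      then show ?thesis unfolding W_def .
    qed
    finally show ?thesis by simp
  qed
  have e1: "e \<le> 1/32" "real k * e \<le> 1/32" 
  proof -
    have "e * (32 * (real k + 1)) = 32 * (real k * e) + 32 * e" by (simp add: algebra_simps)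
    moreover have "real k * e \<ge> 0" using e by simp
    ultimately show "e \<le> 1/32" "real k * e \<le> 1/32" using e by linarith+
  qed
  have mono: "Q e \<subseteq> Q (2 * e)" unfolding Q_def using e by (intro relaxed_mono) auto
  have v_dot_sum: "v_dot v x = (\<Sum>c<k. of_int (v c) * x c)" for v x by (simp add: v_dot_def dot_def)
  have Q_iff: "x \<in> Q \<epsilon> \<longleftrightarrow> (\<forall>i\<in>I. of_int (lo i) - \<epsilon> \<le> v_dot (A i) x \<and> v_dot (A i) x \<le> of_int (hi i) + \<epsilon>)" for x \<epsilon>
    by (simp add: Q_def relaxed_def v_dot_def)
  obtain un where un: "\<And>c. c < k \<Longrightarrow> un c \<in> I0 \<and> (\<forall>j<k. A (un c) j = (if j = c then 1 else 0))"
    using unit by metis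
  have v_dot_un: "v_dot (A (un c)) x = x c" if "c < k" for c x
  proof -
    have "v_dot (A (un c)) x = (\<Sum>j<k. if j = c then x c else 0)"
      unfolding v_dot_sum using un[OF that] by (intro sum.cong) auto
    then show ?thesis using that by simp
  qed
  \<comment> \<open>Equations among the rows may make the region almost flat; passing from
    \<open>Q e\<close> to \<open>Q (2 * e)\<close> restores full dimension. Row entries are at most
    \<open>k + 1\<close>, so a shift by \<open>e / (k + 1)\<close> along an axis changes each row by
    at most \<open>e\<close>.\<close>
  have pert: "(\<lambda>j. x0 j + (if j = c then e / (real k + 1) else 0)) \<in> Q (2 * e)" if c: "c < k" for c
  proof -
    have "\<bar>v_dot (A i) (\<lambda>j. x0 j + (if j = c then e / (real k + 1) else 0)) - v_dot (A i) x0\<bar> \<le> e"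
      if i: "i \<in> I" for i
    proof -
      have "v_dot (A i) (\<lambda>j. x0 j + (if j = c then e / (real k + 1) else 0)) - v_dot (A i) x0
        = (\<Sum>j<k. if j = c then of_int (A i j) * (e / (real k + 1)) else 0)"
        unfolding v_dot_sum sum_subtractf[symmetric] by (intro sum.cong) (auto simp: algebra_simps)
      also have "\<dots> = of_int (A i c) * (e / (real k + 1))" using c by simp
      also have "\<bar>\<dots>\<bar> \<le> (real k + 1) * (e / (real k + 1))"
        unfolding abs_mult using Abd[OF i c] e by (intro mult_mono) auto
      finally show ?thesis by simp
    qed
    then show ?thesis using x0 unfolding Q_iff abs_le_iff by (smt (verit))
  qed
  define M where "M = (\<Sum>c<k. \<bar>real_of_int (lo (un c))\<bar> + \<bar>real_of_int (hi (un c))\<bar> + 1)"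
  have bounded: "\<bar>x c\<bar> \<le> M" if x: "x \<in> Q (2 * e)" and c: "c < k" for x c
  proof -
    have "\<bar>x c\<bar> \<le> \<bar>real_of_int (lo (un c))\<bar> + \<bar>real_of_int (hi (un c))\<bar> + 1"
      using x un[OF c] I e1 v_dot_un[OF c, of x] unfolding Q_iff by fastforce
    also have "\<dots> \<le> M" unfolding M_def using c by (intro member_le_sum) auto
    finally show ?thesis .
  qed
  have eta: "e / (real k + 1) > 0" using e by simp
  obtain xb where xb: "xb \<in> Q (2 * e)"
    and central: "\<And>g \<beta> y. (\<And>x. x \<in> Q (2 * e) \<Longrightarrow> dot k g x \<le> \<beta>) \<Longrightarrow> y \<in> Q (2 * e) \<Longrightarrow>
       \<beta> - dot k g y \<le> \<kappa> * (\<beta> - dot k g xb)"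
    unfolding \<kappa>_def
    by (rule central_point[of x0 "Q (2 * e)" "e / (real k + 1)" k M])
      (use x0 mono eta pert bounded relaxed_average[of k _ I A lo hi "2 * e"] in \<open>auto simp: Q_def\<close>)
  \<comment> \<open>The room of row \<open>i\<close> at \<open>xb\<close>, with both walls moved out
    by \<open>1/2\<close>: an integer value that is at most \<open>hi i + 1/2\<close> is at most
    \<open>hi i\<close>. So an integer point whose rows differ from those of \<open>xb\<close> by at
    most \<open>r i\<close> meets the original bounds.\<close>
  define r where "r i = min (of_int (hi i) + 1/2 - v_dot (A i) xb) (v_dot (A i) xb - of_int (lo i) + 1/2)" for i
  have r_pos: "r i \<ge> 1/4" if "i \<in> I" for i
    using xb e1 that unfolding r_def Q_iff by fastforce
  have width: "\<bar>v_dot (A i) x - v_dot (A i) y\<bar> \<le> \<kappa> * r i" if i: "i \<in> I" and xy: "x \<in> Q (2 * e)" "y \<in> Q (2 * e)" for i x y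
  proof -
    have *: "v_dot (A i) x - v_dot (A i) y \<le> \<kappa> * r i" if "x \<in> Q (2 * e)" "y \<in> Q (2 * e)" for x y
    proof -
      have "of_int (hi i) + 2 * e - v_dot (A i) y \<le> \<kappa> * (of_int (hi i) + 2 * e - v_dot (A i) xb)"
        unfolding v_dot_def using i that(2) by (intro central) (auto simp: Q_iff v_dot_def)
      also have "\<dots> \<le> \<kappa> * (of_int (hi i) + 1/2 - v_dot (A i) xb)"
        using \<kappa> e1 by (intro mult_left_mono) auto
      finally have 1: "v_dot (A i) x - v_dot (A i) y \<le> \<kappa> * (of_int (hi i) + 1/2 - v_dot (A i) xb)"
        using that(1) i unfolding Q_iff by fastforce
      have "(2 * e - of_int (lo i)) - dot k (\<lambda>c. - real_of_int (A i c)) x \<le>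
          \<kappa> * ((2 * e - of_int (lo i)) - dot k (\<lambda>c. - real_of_int (A i c)) xb)"
        using i that(1) by (intro central) (auto simp: Q_iff v_dot_def dot_uminus)
      then have "v_dot (A i) x - of_int (lo i) + 2 * e \<le> \<kappa> * (v_dot (A i) xb - of_int (lo i) + 2 * e)"
        by (simp add: dot_uminus v_dot_def algebra_simps)
      also have "\<dots> \<le> \<kappa> * (v_dot (A i) xb - of_int (lo i) + 1/2)"
        using \<kappa> e1 by (intro mult_left_mono) auto
      finally have 2: "v_dot (A i) x - v_dot (A i) y \<le> \<kappa> * (v_dot (A i) xb - of_int (lo i) + 1/2)"
        using that(2) i unfolding Q_iff by fastforce
      show ?thesis using 1 2 unfolding r_def by (auto simp: min_def)
    qed
    show ?thesis using *[OF xy] *[OF xy(2,1)] by linarith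
  qed
  \<comment> \<open>Rows are compared in units of their room. With a near-maximal basis every scaled
    row is a combination of \<open>k\<close> basis rows with coefficients at most \<open>2\<close>;
    a deviation of at most \<open>\<rho> j / (2 * k)\<close> in the basis rows therefore keeps every
    row within \<open>r i\<close>.\<close>
  define S where "S = (\<lambda>i c. real_of_int (A i c) / r i) ` I0"
  have S1: "\<bar>s c\<bar> \<le> 4" if s: "s \<in> S" "c < k" for s c
  proof -
    obtain i where i: "s = (\<lambda>c. real_of_int (A i c) / r i)" "i \<in> I0" using s(1) unfolding S_def by (rule imageE)
    have "\<bar>real_of_int (A i c)\<bar> \<le> 1" using A01[OF i(2) that(2)] by linarith
    moreover have "r i \<ge> 1/4" using r_pos i(2) I by auto
    ultimately show ?thesis using i(1) by (simp add: abs_of_pos[of "r i"] pos_divide_le_eq)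
  qed
  have S2: "(\<lambda>c. real_of_int (A (un i) c) / r (un i)) \<in> S" if "i < k" for i
    unfolding S_def using un[OF that] by (intro imageI) simp
  have S3: "(\<Sum>c<k. (if c = i then r (un i) else 0) * (real_of_int (A (un c) j) / r (un c))) = (if i = j then 1 else 0)"
    if "i < k" "j < k" for i j
  proof -
    have "(\<Sum>c<k. (if c = i then r (un i) else 0) * (real_of_int (A (un c) j) / r (un c))) =
        (\<Sum>c<k. if c = i then (if i = j then 1 else 0) else 0)"
    proof (intro sum.cong refl)
      fix c assume "c \<in> {..<k}"
      then show "(if c = i then r (un i) else 0) * (real_of_int (A (un c) j) / r (un c)) =
          (if c = i then (if i = j then 1 else 0) else 0)"
        using un[OF that(1)] that r_pos[of "un i"] I by auto
    qed
    then show ?thesis using that by simp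
  qed
  obtain b \<Lambda> where bS: "\<And>j. j < k \<Longrightarrow> b j \<in> S"
    and coord: "\<And>s. s \<in> S \<Longrightarrow> \<exists>l. (\<forall>i<k. \<bar>l i\<bar> \<le> 2) \<and> (\<forall>c<k. s c = (\<Sum>i<k. l i * b i c))"
    and b\<Lambda>: "\<And>i j. i < k \<Longrightarrow> j < k \<Longrightarrow> (\<Sum>c<k. b i c * \<Lambda> c j) = (if i = j then 1 else 0)"
    and \<Lambda>b: "\<And>i j. i < k \<Longrightarrow> j < k \<Longrightarrow> (\<Sum>c<k. \<Lambda> i c * b c j) = (if i = j then 1 else 0)"
    by (rule bounded_coordinates_basis[of S k 4 "\<lambda>i c. real_of_int (A (un i) c) / r (un i)"
        "\<lambda>i c. if c = i then r (un i) else 0"]) (use S1 S2 S3 in blast)+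
  have "\<forall>j. \<exists>i. j < k \<longrightarrow> i \<in> I0 \<and> b j = (\<lambda>c. real_of_int (A i c) / r i)"
    using bS unfolding S_def by blast
  then obtain \<iota> where \<iota>: "\<forall>j. j < k \<longrightarrow> \<iota> j \<in> I0 \<and> b j = (\<lambda>c. real_of_int (A (\<iota> j) c) / r (\<iota> j))"
    by (rule choice[THEN exE])
  define B where "B j = A (\<iota> j)" for j
  define \<rho> where "\<rho> j = r (\<iota> j)" for j
  have \<rho>_pos: "\<rho> j \<ge> 1/4" if "j < k" for j using \<iota> that I r_pos by (auto simp: \<rho>_def)
  have bB: "b j c = of_int (B j c) / \<rho> j" if "j < k" for j c using \<iota> that by (simp add: B_def \<rho>_def)
  have B1: "\<bar>B j c\<bar> \<le> 1" if "j < k" "c < k" for j c using \<iota> that A01 by (simp add: B_def)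
  define \<Lambda>' where "\<Lambda>' c j = \<Lambda> c j / \<rho> j" for c j
  have B\<Lambda>: "(\<Sum>c<k. of_int (B i c) * \<Lambda>' c j) = (if i = j then 1 else 0)" if "i < k" "j < k" for i j
  proof -
    have "(\<Sum>c<k. of_int (B i c) * \<Lambda>' c j) = \<rho> i / \<rho> j * (\<Sum>c<k. b i c * \<Lambda> c j)"
      unfolding sum_distrib_left using \<rho>_pos[OF that(1)] by (intro sum.cong) (auto simp: bB[OF that(1)] \<Lambda>'_def)
    then show ?thesis using b\<Lambda>[OF that] \<rho>_pos[OF that(1)] by (cases "i = j") auto
  qed
  have \<Lambda>B: "(\<Sum>c<k. \<Lambda>' i c * of_int (B c j)) = (if i = j then 1 else 0)" if "i < k" "j < k" for i j
    using \<Lambda>b[OF that] by (simp add: \<Lambda>'_def bB)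
  define narrow where "narrow v \<longleftrightarrow> (\<exists>t::int. \<forall>x\<in>Q (2 * e). \<bar>v_dot v x - of_int t\<bar> \<le> 2 * e)" for v
  have wide: "\<exists>x\<in>Q (2 * e). \<exists>y\<in>Q (2 * e). v_dot v x - v_dot v y \<ge> W"
    if "\<not> narrow v" "\<And>c. c < k \<Longrightarrow> \<bar>v c\<bar> \<le> int k" for v
    using cases[of v] that mono unfolding narrow_def W_def by blast
  have wB: "\<rho> j \<ge> W / \<kappa>" if j: "j < k" and n: "\<not> narrow (B j)" for j
  proof -
    have "\<bar>B j c\<bar> \<le> int k" if "c < k" for c using B1[OF j that] k by linarith
    then obtain x y where xy: "x \<in> Q (2 * e)" "y \<in> Q (2 * e)" "v_dot (B j) x - v_dot (B j) y \<ge> W"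
      using wide[OF n] by blast
    then have "W \<le> \<kappa> * \<rho> j" using width[of "\<iota> j" x y] \<iota> j I unfolding B_def \<rho>_def by fastforce
    then show ?thesis using \<kappa> by (simp add: field_simps)
  qed
  have W\<kappa>: "W / \<kappa> \<ge> 8 * real k * \<theta>" using W \<kappa> by (simp add: field_simps)
  have \<theta>8: "8 * real k * \<theta> \<ge> 8 * (real k)\<^sup>2" "8 * real k * \<theta> \<ge> 2 * real k"
  proof -
    have "\<theta> \<ge> real k"
      using k mult_mono[of 1 "64 * real k" "real k" "real k * (2 * real k + 1)"]
      by (simp add: \<theta>_def power2_eq_square algebra_simps)
    then show "8 * real k * \<theta> \<ge> 8 * (real k)\<^sup>2" by (simp add: power2_eq_square mult_left_mono)
    show "8 * real k * \<theta> \<ge> 2 * real k" using \<theta> mult_mono[of 2 "8 * \<theta>" "real k" "real k"] by (simp add: mult_ac)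
  qed
  \<comment> \<open>A narrow row must take its integer value exactly, so its spread \<open>L\<close>
    is \<open>1\<close>. For a wide row the \<open>2 * k\<close> terms with spread about
    \<open>\<rho> j / (8 * k^2)\<close> move it by at most \<open>\<rho> j / (4 * k)\<close>, and
    the rounding by at most as much again.\<close>
  define s where "s j = (if narrow (B j) then SOME t. \<forall>x\<in>Q (2 * e). \<bar>v_dot (B j) x - of_int t\<bar> \<le> 2 * e
    else round (v_dot (B j) xb))" for j
  define L where "L j = (if narrow (B j) then 1 else nat \<lfloor>\<rho> j / (8 * (real k)\<^sup>2)\<rfloor>)" for j
  have s_narrow: "\<bar>v_dot (B j) x - of_int (s j)\<bar> \<le> 2 * e" if "narrow (B j)" "x \<in> Q (2 * e)" for j x
    using someI_ex[OF that(1)[unfolded narrow_def]] that by (simp add: s_def)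
  have s_wide: "\<bar>v_dot (B j) xb - of_int (s j)\<bar> \<le> 1/2" if "\<not> narrow (B j)" for j
    using that of_int_round_abs_le[of "v_dot (B j) xb"] by (simp add: s_def abs_minus_commute)
  have L_wide: "real (L j) \<le> \<rho> j / (8 * (real k)\<^sup>2)" "real (L j) \<ge> \<rho> j / (16 * (real k)\<^sup>2)" "L j \<ge> 1"
    if "j < k" "\<not> narrow (B j)" for j
  proof -
    have "8 * (real k)\<^sup>2 \<le> \<rho> j" using wB[OF that] W\<kappa> \<theta>8 by linarith
    then have 1: "\<rho> j / (8 * (real k)\<^sup>2) \<ge> 1" using k by (simp add: field_simps)
    then have "\<lfloor>\<rho> j / (8 * (real k)\<^sup>2)\<rfloor> \<ge> 0" by linarith
    then have 2: "real (L j) = of_int \<lfloor>\<rho> j / (8 * (real k)\<^sup>2)\<rfloor>" using that by (simp add: L_def)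
    then show "real (L j) \<le> \<rho> j / (8 * (real k)\<^sup>2)" by simp
    have "\<rho> j / (8 * (real k)\<^sup>2) < real (L j) + 1" using 2 by linarith
    moreover from 1 2 show "L j \<ge> 1" by linarith
    ultimately have "\<rho> j / (8 * (real k)\<^sup>2) \<le> 2 * real (L j)" by linarith
    then show "real (L j) \<ge> \<rho> j / (16 * (real k)\<^sup>2)" by simp
  qed
  have reps: "finite (dual_reps k B)" "card (dual_reps k B) \<le> (2 * k + 1) ^ k"
    and rep_entry: "\<And>w c. w \<in> dual_reps k B \<Longrightarrow> c < k \<Longrightarrow> \<bar>\<Sum>j<k. w j * of_int (B j c)\<bar> \<le> real k"
    using dual_reps_finite_card[of k B \<Lambda>'] B\<Lambda> B1 by blast+
  have "\<exists>z. \<forall>j<k. \<bar>(\<Sum>c<k. B j c * z c) - s j\<bar> \<le> 2 * int k * (int (L j) - 1)"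
  proof (rule lattice_point_near[of k B \<Lambda>' \<delta> k L s, OF B\<Lambda> \<Lambda>B reps(1)])
    have "real (card (dual_reps k B)) \<le> real ((2 * k + 1) ^ k)" using reps(2) by (simp only: of_nat_le_iff)
    then have "real (card (dual_reps k B)) * \<delta> ^ (2 * k) \<le> (2 * real k + 1) ^ k * \<delta> ^ (2 * k)"
      by (intro mult_right_mono) (auto simp: \<delta>_def add.commute)
    also have "\<dots> = ((2 * real k + 1) * \<delta>\<^sup>2) ^ k" by (simp add: power_mult power_mult_distrib)
    also have "(2 * real k + 1) * \<delta>\<^sup>2 = 1 / (4 * (2 * real k + 1))"
    proof -
      have "y * (1 / (2 * y))\<^sup>2 = 1 / (4 * y)" if "y > 0" for y :: real
        using that by (simp add: power2_eq_square)
      from this[of "2 * real k + 1"] show ?thesis unfolding \<delta>_def by simp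
    qed
    also have "(1 / (4 * (2 * real k + 1))) ^ k < 1" using k by (intro power_less_one_iff[THEN iffD2]) auto
    finally show "real (card (dual_reps k B)) * \<delta> ^ (2 * k) < 1" .
    show "\<delta> \<ge> 0" by (simp add: \<delta>_def)
    show "L j \<ge> 1" if "j < k" for j using L_wide(3)[OF that] by (cases "narrow (B j)") (auto simp: L_def)
    fix w assume w: "w \<in> dual_reps k B" "w \<noteq> (\<lambda>_. 0)"
    have w_half: "\<bar>w j\<bar> \<le> 1/2" if "j < k" for j using w(1) that by (auto simp: dual_reps_def abs_le_iff)
    show "Re (unit_char (\<Sum>j<k. w j * of_int (s j))) \<ge> 0 \<or>
       (\<exists>j<k. norm (geometric_char (L j) (w j)) \<le> real (L j) * \<delta>)"
    \<comment> \<open>Either some coordinate of \<open>w\<close> is large compared with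
      \<open>1 / \<rho> j\<close> and damps the character, or \<open>w B\<close> varies too little
      to be a wide direction.\<close>
    proof (cases "\<exists>j<k. \<not> narrow (B j) \<and> \<rho> j * \<bar>w j\<bar> > \<theta>")
      case True
      then obtain j where j: "j < k" "\<not> narrow (B j)" "\<rho> j * \<bar>w j\<bar> > \<theta>" by blast
      have w0: "w j \<noteq> 0" using j(3) \<theta> by auto
      have "norm (geometric_char (L j) (w j)) \<le> 2 / \<bar>w j\<bar>"
        using w_half[OF j(1)] w0 by (rule norm_geometric_char_le')
      also have "\<dots> \<le> \<rho> j / (16 * (real k)\<^sup>2) * \<delta>"
      proof -
        have "2 * (16 * (real k)\<^sup>2) = \<theta> * \<delta>" by (simp add: \<theta>_def \<delta>_def field_simps)
        also have "\<dots> \<le> \<rho> j * \<bar>w j\<bar> * \<delta>" using j(3) by (intro mult_right_mono) (auto simp: \<delta>_def)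
        finally show ?thesis using w0 k by (simp add: field_simps)
      qed
      also have "\<dots> \<le> real (L j) * \<delta>" using L_wide(2)[OF j(1,2)] by (intro mult_right_mono) (auto simp: \<delta>_def)
      finally show ?thesis using j(1) by blast
    next
      case False
      then have small: "\<rho> j * \<bar>w j\<bar> \<le> \<theta>" if "j < k" "\<not> narrow (B j)" for j using that by force
      define v where "v c = \<lfloor>\<Sum>j<k. w j * of_int (B j c)\<rfloor>" for c
      have v: "of_int (v c) = (\<Sum>j<k. w j * of_int (B j c))" if "c < k" for c
        using w(1) that by (auto simp: v_def dual_reps_def elim!: Ints_cases)
      have vk: "\<bar>v c\<bar> \<le> int k" if "c < k" for c
        using rep_entry[OF w(1) that] unfolding v[OF that, symmetric] by linarith
      have v_dot_v: "v_dot v x = (\<Sum>j<k. w j * v_dot (B j) x)" for x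
      proof -
        have "v_dot v x = (\<Sum>c<k. \<Sum>j<k. w j * (of_int (B j c) * x c))"
          unfolding v_dot_sum by (intro sum.cong) (auto simp: v sum_distrib_right mult.assoc)
        also have "\<dots> = (\<Sum>j<k. w j * v_dot (B j) x)"
          unfolding v_dot_sum sum_distrib_left by (rule sum.swap)
        finally show ?thesis .
      qed
      have "narrow v"
      proof (rule ccontr)
        assume "\<not> narrow v"
        then obtain x y where xy: "x \<in> Q (2 * e)" "y \<in> Q (2 * e)" "v_dot v x - v_dot v y \<ge> W"
          using wide vk by blast
        have "v_dot v x - v_dot v y = (\<Sum>j<k. w j * (v_dot (B j) x - v_dot (B j) y))"
          by (simp add: v_dot_v right_diff_distrib sum_subtractf)
        also have "\<dots> \<le> (\<Sum>j<k. \<kappa> * \<theta>)"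
        proof (rule sum_mono)
          fix j assume j: "j \<in> {..<k}"
          have "w j * (v_dot (B j) x - v_dot (B j) y) \<le> \<bar>w j\<bar> * \<bar>v_dot (B j) x - v_dot (B j) y\<bar>"
            by (metis abs_ge_self abs_mult)
          also have "\<dots> \<le> \<kappa> * \<theta>"
          proof (cases "narrow (B j)")
            case True
            have "\<bar>v_dot (B j) x - v_dot (B j) y\<bar> \<le> 4 * e"
              using s_narrow[OF True xy(1)] s_narrow[OF True xy(2)] by linarith
            then have "\<bar>w j\<bar> * \<bar>v_dot (B j) x - v_dot (B j) y\<bar> \<le> 1 * 1"
              using w_half[of j] j e1 by (intro mult_mono) auto
            also have "\<dots> \<le> \<kappa> * \<theta>" using \<kappa> \<theta> by (intro mult_mono) auto
            finally show ?thesis .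
          next
            case False
            have "\<bar>v_dot (B j) x - v_dot (B j) y\<bar> \<le> \<kappa> * \<rho> j"
              using width[of "\<iota> j" x y] xy \<iota> j I unfolding B_def \<rho>_def by auto
            then have "\<bar>w j\<bar> * \<bar>v_dot (B j) x - v_dot (B j) y\<bar> \<le> \<bar>w j\<bar> * (\<kappa> * \<rho> j)"
              by (intro mult_left_mono) auto
            also have "\<dots> = \<kappa> * (\<rho> j * \<bar>w j\<bar>)" by simp
            also have "\<dots> \<le> \<kappa> * \<theta>" using small[of j] False j \<kappa> by (intro mult_left_mono) auto
            finally show ?thesis .
          qed
          finally show "w j * (v_dot (B j) x - v_dot (B j) y) \<le> \<kappa> * \<theta>" .
        qed
        also have "\<dots> = real k * \<theta> * \<kappa>" by simp
        also have "\<dots> < 8 * (real k * \<theta> * \<kappa>)" using k \<theta> \<kappa> by simp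
        also have "\<dots> \<le> W" using W by (simp add: mult.assoc)
        finally show False using xy(3) by simp
      qed
      \<comment> \<open>On narrow rows \<open>s\<close> is almost exact, on wide rows
        \<open>w\<close> is tiny. So exchanging \<open>xb\<close> for \<open>s\<close> costs at most
        \<open>1/16\<close>, and the phase stays well within \<open>1/4\<close> of the integer
        \<open>t\<close>, where the real part is nonnegative.\<close>
      then obtain t where t: "\<bar>v_dot v xb - of_int t\<bar> \<le> 2 * e" using xb unfolding narrow_def by blast
      have "\<bar>(\<Sum>j<k. w j * of_int (s j)) - v_dot v xb\<bar> = \<bar>\<Sum>j<k. w j * (of_int (s j) - v_dot (B j) xb)\<bar>"
        by (simp add: v_dot_v right_diff_distrib sum_subtractf)
      also have "\<dots> \<le> (\<Sum>j<k. \<bar>w j\<bar> * \<bar>of_int (s j) - v_dot (B j) xb\<bar>)"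
        by (rule order_trans[OF sum_abs]) (simp add: abs_mult)
      also have "\<dots> \<le> (\<Sum>j<k. 1 / (16 * real k))"
      proof (rule sum_mono)
        fix j assume j: "j \<in> {..<k}"
        show "\<bar>w j\<bar> * \<bar>of_int (s j) - v_dot (B j) xb\<bar> \<le> 1 / (16 * real k)"
        proof (cases "narrow (B j)")
          case True
          have "\<bar>w j\<bar> * \<bar>of_int (s j) - v_dot (B j) xb\<bar> \<le> 1/2 * (2 * e)"
            using s_narrow[OF True xb] w_half[of j] j by (intro mult_mono) (auto simp: abs_minus_commute)
          also have "\<dots> \<le> 1 / (16 * real k)" using e1 k by (simp add: field_simps)
          finally show ?thesis .
        next
          case False
          have \<rho>8: "\<rho> j \<ge> 8 * real k * \<theta>" using wB[of j] False j W\<kappa> by auto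
          have "\<bar>w j\<bar> \<le> 1 / (8 * real k)"
          proof -
            have "8 * real k * \<theta> * \<bar>w j\<bar> \<le> \<rho> j * \<bar>w j\<bar>" using \<rho>8 by (intro mult_right_mono) auto
            also have "\<dots> \<le> \<theta>" using small[of j] j False by auto
            finally have "\<theta> * (8 * real k * \<bar>w j\<bar>) \<le> \<theta> * 1" by (simp add: mult_ac)
            then have "8 * real k * \<bar>w j\<bar> \<le> 1" using \<theta> by (subst (asm) mult_le_cancel_left_pos) auto
            then show ?thesis using k by (simp add: field_simps)
          qed
          then have "\<bar>w j\<bar> * \<bar>of_int (s j) - v_dot (B j) xb\<bar> \<le> 1 / (8 * real k) * (1/2)"
            using s_wide[OF False] by (intro mult_mono) (auto simp: abs_minus_commute)
          then show ?thesis by simp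
        qed
      qed
      also have "\<dots> = 1/16" using k by simp
      finally have "\<bar>(\<Sum>j<k. w j * of_int (s j)) - of_int t\<bar> \<le> 1/4" using t e1 by linarith
      then show ?thesis by (intro disjI1 Re_unit_char_nonneg)
    qed
  qed
  then obtain z where z: "\<And>j. j < k \<Longrightarrow> \<bar>(\<Sum>c<k. B j c * z c) - s j\<bar> \<le> 2 * int k * (int (L j) - 1)" by blast
  let ?z = "\<lambda>c. real_of_int (z c)"
  have near: "\<bar>v_dot (B j) ?z - v_dot (B j) xb\<bar> \<le> \<rho> j / (2 * real k)" if j: "j < k" for j
  proof -
    have "v_dot (B j) ?z - of_int (s j) = of_int ((\<Sum>c<k. B j c * z c) - s j)"
      by (simp add: v_dot_sum)
    then have 1: "\<bar>v_dot (B j) ?z - of_int (s j)\<bar> \<le> of_int (2 * int k * (int (L j) - 1))"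
      using z[OF j] by linarith
    show ?thesis
    proof (cases "narrow (B j)")
      case True
      then have "v_dot (B j) ?z = of_int (s j)" using 1 by (simp add: L_def)
      then have "\<bar>v_dot (B j) ?z - v_dot (B j) xb\<bar> \<le> 2 * e"
        using s_narrow[OF True xb] by (simp add: abs_minus_commute)
      also have "2 * e \<le> (1/4) / (2 * real k)" using e1 k by (simp add: field_simps)
      also have "\<dots> \<le> \<rho> j / (2 * real k)" using \<rho>_pos[OF j] by (intro divide_right_mono) auto
      finally show ?thesis .
    next
      case False
      have "of_int (2 * int k * (int (L j) - 1)) \<le> 2 * real k * real (L j)"
        by (simp add: mult_left_mono)
      also have "\<dots> \<le> 2 * real k * (\<rho> j / (8 * (real k)\<^sup>2))"
        using L_wide(1)[OF j False] by (intro mult_left_mono) auto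
      also have "\<dots> = \<rho> j / (4 * real k)" using k by (simp add: power2_eq_square)
      finally have 2: "\<bar>v_dot (B j) ?z - of_int (s j)\<bar> \<le> \<rho> j / (4 * real k)" using 1 by linarith
      have "1/2 \<le> \<rho> j / (4 * real k)" 
      proof -
        have "2 * real k \<le> \<rho> j" using wB[OF j False] W\<kappa> \<theta>8(2) by linarith
        then show ?thesis using k by (simp add: field_simps)
      qed
      moreover have "\<rho> j / (4 * real k) + \<rho> j / (4 * real k) = \<rho> j / (2 * real k)" by simp
      ultimately show ?thesis using 2 s_wide[OF False] by linarith
    qed
  qed
  have "lo i \<le> (\<Sum>c<k. A i c * z c) \<and> (\<Sum>c<k. A i c * z c) \<le> hi i" if i: "i \<in> I0" for i
  proof -
    have iI: "i \<in> I" using i I by blast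
    have ri: "r i > 0" using r_pos[OF iI] by simp
    obtain l where l: "\<forall>j<k. \<bar>l j\<bar> \<le> 2" "\<forall>c<k. real_of_int (A i c) / r i = (\<Sum>j<k. l j * b j c)"
      using coord[of "\<lambda>c. real_of_int (A i c) / r i"] i unfolding S_def by blast
    have Ai: "of_int (A i c) = r i * (\<Sum>j<k. l j * (of_int (B j c) / \<rho> j))" if "c < k" for c
    proof -
      have "of_int (A i c) = r i * (real_of_int (A i c) / r i)" using ri by simp
      also have "\<dots> = r i * (\<Sum>j<k. l j * (of_int (B j c) / \<rho> j))"
        using l(2) that by (simp add: bB)
      finally show ?thesis .
    qed
    have "v_dot (A i) x = r i * (\<Sum>j<k. l j * (v_dot (B j) x / \<rho> j))" for x
    proof -
      have "v_dot (A i) x = (\<Sum>c<k. \<Sum>j<k. r i * (l j * (of_int (B j c) / \<rho> j)) * x c)"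
        unfolding v_dot_sum by (intro sum.cong refl) (simp add: Ai sum_distrib_left sum_distrib_right)
      also have "\<dots> = (\<Sum>j<k. \<Sum>c<k. r i * (l j * (of_int (B j c) / \<rho> j)) * x c)" by (rule sum.swap)
      also have "\<dots> = r i * (\<Sum>j<k. l j * (v_dot (B j) x / \<rho> j))"
        unfolding v_dot_sum by (simp add: sum_distrib_left sum_divide_distrib mult_ac)
      finally show ?thesis .
    qed
    then have "\<bar>v_dot (A i) ?z - v_dot (A i) xb\<bar> = \<bar>r i * (\<Sum>j<k. l j * ((v_dot (B j) ?z - v_dot (B j) xb) / \<rho> j))\<bar>"
      by (simp add: diff_divide_distrib right_diff_distrib sum_subtractf)
    also have "\<dots> \<le> r i * (\<Sum>j<k. \<bar>l j * ((v_dot (B j) ?z - v_dot (B j) xb) / \<rho> j)\<bar>)"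
      unfolding abs_mult[of "r i"] abs_of_pos[OF ri] using ri by (intro mult_left_mono sum_abs) simp
    also have "\<dots> \<le> r i * (\<Sum>j<k. 1 / real k)"
    proof (intro mult_left_mono sum_mono)
      fix j assume j: "j \<in> {..<k}"
      have "\<bar>l j * ((v_dot (B j) ?z - v_dot (B j) xb) / \<rho> j)\<bar> = \<bar>l j\<bar> * (\<bar>v_dot (B j) ?z - v_dot (B j) xb\<bar> / \<rho> j)"
        using \<rho>_pos[of j] j by (simp add: abs_mult)
      also have "\<dots> \<le> 2 * ((\<rho> j / (2 * real k)) / \<rho> j)"
        using l(1) j near[of j] \<rho>_pos[of j] by (intro mult_mono divide_right_mono) auto
      also have "\<dots> = 1 / real k" using \<rho>_pos[of j] j by auto
      finally show "\<bar>l j * ((v_dot (B j) ?z - v_dot (B j) xb) / \<rho> j)\<bar> \<le> 1 / real k" .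
    qed (use ri in auto)
    also have "\<dots> = r i" using k by simp
    finally have "\<bar>v_dot (A i) ?z - v_dot (A i) xb\<bar> \<le> r i" .
    moreover have "r i \<le> of_int (hi i) + 1/2 - v_dot (A i) xb" "r i \<le> v_dot (A i) xb - of_int (lo i) + 1/2"
      by (auto simp: r_def)
    moreover have "v_dot (A i) ?z = of_int (\<Sum>c<k. A i c * z c)" by (simp add: v_dot_sum)
    ultimately show ?thesis by linarith
  qed
  then show ?thesis by blast
qed

section \<open>The perceptron and the branching procedure\<close>

type_synonym constr = "int list \<times> int \<times> int"

fun dotp :: "int list \<Rightarrow> int list \<Rightarrow> int" where
  "dotp (a # as) (x # xs) = a * x + dotp as xs"
| "dotp _ _ = 0"

fun axpy :: "int \<Rightarrow> int list \<Rightarrow> int list \<Rightarrow> int list" where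
  "axpy c (a # as) (x # xs) = (x + c * a) # axpy c as xs"
| "axpy c _ _ = []"

definition sat :: "int list \<Rightarrow> constr \<Rightarrow> bool" where
  "sat z C = (case C of (a, lo, hi) \<Rightarrow> lo \<le> dotp a z \<and> dotp a z \<le> hi)"

text \<open>The vector \<open>X\<close> stands for the point \<open>X / R\<close>, so that the perceptron can work with integers.\<close>

fun correct :: "int \<Rightarrow> int \<Rightarrow> int list \<Rightarrow> constr list \<Rightarrow> int list option" where
  "correct R s X [] = None"
| "correct R s X ((a, lo, hi) # L) =
    (if dotp a X \<le> R * hi + s
     then if R * lo - s \<le> dotp a X then correct R s X L else Some (axpy 1 a X)
     else Some (axpy (- 1) a X))"

fun perceptron :: "int \<Rightarrow> int \<Rightarrow> constr list \<Rightarrow> nat \<Rightarrow> int list \<Rightarrow> bool" where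
  "perceptron R s L F X = (case correct R s X L of None \<Rightarrow> True
     | Some Y \<Rightarrow> (case F of 0 \<Rightarrow> False | Suc F' \<Rightarrow> perceptron R s L F' Y))"

declare perceptron.simps [simp del]

fun sqdist :: "int \<Rightarrow> int list \<Rightarrow> int list \<Rightarrow> int" where
  "sqdist R (z # zs) (x # xs) = (R * z - x)\<^sup>2 + sqdist R zs xs"
| "sqdist R _ _ = 0"

lemma length_axpy [simp]: "length (axpy c a X) = min (length a) (length X)"
  by (induction c a X rule: axpy.induct) auto

lemma dotp_nth: "length a = length x \<Longrightarrow> dotp a x = (\<Sum>i<length a. a ! i * x ! i)"
proof (induction a x rule: dotp.induct)
  case (1 a as x xs)
  then show ?case by (simp add: sum.lessThan_Suc_shift del: sum.lessThan_Suc)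
qed auto

lemma dotp_self_nonneg: "dotp a a \<ge> 0"
  by (induction a) auto

lemma sqdist_nonneg: "sqdist R z X \<ge> 0"
  by (induction R z X rule: sqdist.induct) auto

text \<open>The potential of the perceptron: the linear term measures the violation that is
  corrected, and \<open>dotp a a\<close> is the price of the step.\<close>

lemma sqdist_axpy:
  "length a = length X \<Longrightarrow> length z = length X \<Longrightarrow>
    sqdist R z (axpy c a X) = sqdist R z X - 2 * c * (R * dotp a z - dotp a X) + c\<^sup>2 * dotp a a"
proof (induction X arbitrary: a z)
  case (Cons x X)
  then obtain a1 a' z1 z' where "a = a1 # a'" "z = z1 # z'"
    by (metis length_Suc_conv)
  then show ?case using Cons by (simp add: algebra_simps power2_eq_square)
qed auto

lemma sqdist_zero:
  "sqdist R z X \<le> 0 \<Longrightarrow> length z = length X \<Longrightarrow> X = map (\<lambda>i. R * i) z"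
proof (induction z arbitrary: X)
  case (Cons z1 z)
  then obtain x X' where X: "X = x # X'" by (cases X) auto
  have "(R * z1 - x)\<^sup>2 \<ge> 0" "sqdist R z X' \<ge> 0" by (simp_all add: sqdist_nonneg)
  moreover have "(R * z1 - x)\<^sup>2 + sqdist R z X' \<le> 0" using Cons.prems X by simp
  ultimately have "(R * z1 - x)\<^sup>2 = 0" "sqdist R z X' \<le> 0" by linarith+
  then show ?case using Cons X by auto
qed auto

lemma dotp_scale: "dotp a (map (\<lambda>i. R * i) z) = R * dotp a z"
  by (induction a z rule: dotp.induct) (auto simp: algebra_simps)

lemma correct_SomeD:
  assumes "correct R s X L = Some Y"
  shows "\<exists>a lo hi. (a, lo, hi) \<in> set L \<and>
    (dotp a X > R * hi + s \<and> Y = axpy (- 1) a X \<or> dotp a X < R * lo - s \<and> Y = axpy 1 a X)"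
  using assms
proof (induction R s X L rule: correct.induct)
  case (2 R s X a lo hi L)
  show ?case
  proof (cases "R * lo - s \<le> dotp a X \<and> dotp a X \<le> R * hi + s")
    case True
    with 2 show ?thesis by fastforce
  next
    case False
    with 2 show ?thesis by (intro exI[of _ a] exI[of _ lo] exI[of _ hi]) (auto split: if_splits)
  qed
qed simp

lemma correct_NoneD:
  "correct R s X L = None \<Longrightarrow> (a, lo, hi) \<in> set L \<Longrightarrow> R * lo - s \<le> dotp a X \<and> dotp a X \<le> R * hi + s"
  by (induction R s X L rule: correct.induct) (auto split: if_splits)

lemma perceptron_sound:
  assumes "perceptron R s L F X" "length X = k" "\<And>a lo hi. (a, lo, hi) \<in> set L \<Longrightarrow> length a = k"
  shows "\<exists>Y. length Y = k \<and> (\<forall>(a, lo, hi)\<in>set L. R * lo - s \<le> dotp a Y \<and> dotp a Y \<le> R * hi + s)"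
  using assms
proof (induction F arbitrary: X)
  case 0
  then have "correct R s X L = None" by (auto simp: perceptron.simps[of R s L 0] split: option.splits)
  then show ?case using 0 correct_NoneD by blast
next
  case (Suc F)
  show ?case
  proof (cases "correct R s X L")
    case None
    then show ?thesis using Suc.prems(2) correct_NoneD by blast
  next
    case (Some Y)
    then have "perceptron R s L F Y" using Suc.prems(1) by (simp add: perceptron.simps[of R s L "Suc F"])
    moreover have "length Y = k" using correct_SomeD[OF Some] Suc.prems(2,3) by fastforce
    ultimately show ?thesis using Suc.IH Suc.prems(3) by blast
  qed
qed

text \<open>Every correction decreases the squared distance to the scaled solution.\<close>

lemma perceptron_complete:
  assumes "sqdist R z X \<le> int F" "length X = k" "length z = k" "R \<ge> 0"
    and "\<And>a lo hi. (a, lo, hi) \<in> set L \<Longrightarrow> length a = k \<and> dotp a a \<le> s \<and> lo \<le> dotp a z \<and> dotp a z \<le> hi"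
  shows "perceptron R s L F X"
  using assms(1,2)
proof (induction F arbitrary: X)
  case 0
  \<comment> \<open>Without fuel the distance is \<open>0\<close>, so \<open>X\<close> is the scaled
    solution itself and violates nothing.\<close>
  then have X: "X = map (\<lambda>i. R * i) z" using sqdist_zero assms(3) by simp
  have "correct R s X L = None"
  proof (rule ccontr)
    assume "correct R s X L \<noteq> None"
    then obtain Y where "correct R s X L = Some Y" by blast
    from correct_SomeD[OF this] obtain a lo hi where a: "(a, lo, hi) \<in> set L"
      "dotp a X > R * hi + s \<or> dotp a X < R * lo - s" by blast
    have "dotp a X = R * dotp a z" using X dotp_scale by simp
    moreover have "R * lo \<le> R * dotp a z" "R * dotp a z \<le> R * hi" "s \<ge> 0"
      using assms(5)[OF a(1)] assms(4) dotp_self_nonneg[of a] by (auto intro: mult_left_mono)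
    ultimately show False using a(2) by linarith
  qed
  then show ?case by (simp add: perceptron.simps[of R s L 0])
next
  case (Suc F)
  show ?case
  proof (cases "correct R s X L")
    case None
    then show ?thesis by (simp add: perceptron.simps[of R s L "Suc F"])
  next
    case (Some Y)
    from correct_SomeD[OF this] obtain a lo hi where a: "(a, lo, hi) \<in> set L"
      "dotp a X > R * hi + s \<and> Y = axpy (- 1) a X \<or> dotp a X < R * lo - s \<and> Y = axpy 1 a X" by blast
    have len: "length a = length X" "length z = length X" using assms(3,5) a(1) Suc.prems by auto
    have *: "R * lo \<le> R * dotp a z" "R * dotp a z \<le> R * hi" "dotp a a \<le> s" "dotp a a \<ge> 0"
      using assms(5)[OF a(1)] assms(4) dotp_self_nonneg[of a] by (auto intro: mult_left_mono)
    have F: "sqdist R z X \<le> int F + 1" using Suc.prems(1) by simp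
    \<comment> \<open>A violation by more than \<open>s\<close> gains at least
      \<open>2 * (s + 1)\<close> in the linear term, and the quadratic term gives back at most
      \<open>s\<close>.\<close>
    have "sqdist R z Y \<le> int F"
      using a(2)
    proof
      assume 1: "dotp a X > R * hi + s \<and> Y = axpy (- 1) a X"
      then have "sqdist R z Y = sqdist R z X + 2 * (R * dotp a z - dotp a X) + dotp a a"
        using sqdist_axpy[OF len, of R "- 1"] by simp
      moreover have "R * dotp a z - dotp a X \<le> - s - 1" using conjunct1[OF 1] * by linarith
      moreover have "s \<ge> 0" using * by linarith
      ultimately show ?thesis using *(3) F by (smt (verit))
    next
      assume 1: "dotp a X < R * lo - s \<and> Y = axpy 1 a X"
      then have "sqdist R z Y = sqdist R z X - 2 * (R * dotp a z - dotp a X) + dotp a a"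
        using sqdist_axpy[OF len, of R 1] by simp
      moreover have "R * dotp a z - dotp a X \<ge> s + 1" using conjunct1[OF 1] * by linarith
      moreover have "s \<ge> 0" using * by linarith
      ultimately show ?thesis using *(3) F by (smt (verit))
    qed
    moreover have "length Y = k" using a(2) len Suc.prems by auto
    ultimately show ?thesis using Suc.IH Some by (simp add: perceptron.simps[of R s L "Suc F"])
  qed
qed

lemma sqdist_replicate_0_le:
  assumes "\<And>x. x \<in> set z \<Longrightarrow> 0 \<le> x \<and> x \<le> n"
  shows "sqdist R z (replicate (length z) 0) \<le> int (length z) * (R\<^sup>2 * n\<^sup>2)"
  using assms
proof (induction z)
  case (Cons x z)
  have "x\<^sup>2 \<le> n\<^sup>2" using Cons.prems by (intro power_mono) auto
  then have "R\<^sup>2 * x\<^sup>2 \<le> R\<^sup>2 * n\<^sup>2" by (intro mult_left_mono) auto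
  then show ?case using Cons by (simp add: power_mult_distrib algebra_simps)
qed simp

section \<open>The branching search\<close>

record params =
  scale :: int
  slack :: int
  fuel :: nat
  dim :: nat
  range :: nat
  threshold :: nat

definition feasible :: "params \<Rightarrow> constr list \<Rightarrow> bool" where
  "feasible p L = perceptron (scale p) (slack p) L (fuel p) (replicate (dim p) 0)"

text \<open>The interval is given by its start and its length, the form in which the program
  recurses on it.\<close>

definition values_from :: "params \<Rightarrow> constr list \<Rightarrow> int list \<Rightarrow> int \<Rightarrow> nat \<Rightarrow> int list" where
  "values_from p L v t m = filter (\<lambda>t. feasible p ((v, t, t) # L)) [t..t + int m - 1]"

definition possible_values :: "params \<Rightarrow> constr list \<Rightarrow> int list \<Rightarrow> int list" where
  "possible_values p L v = values_from p L v (- int (range p)) (2 * range p + 1)"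

text \<open>\<open>sk\<close> collects the rows with too many possible values; they are reconsidered once another row
  has been fixed.\<close>

function solve :: "params \<Rightarrow> constr list \<Rightarrow> int list list \<Rightarrow> int list list \<Rightarrow> bool" where
  "solve p L sk [] = feasible p L"
| "solve p L sk (v # todo) =
    (let T = possible_values p L v in
     if length T \<le> threshold p then list_ex (\<lambda>t. solve p ((v, t, t) # L) [] (sk @ todo)) T
     else solve p L (v # sk) todo)"
  by pat_completeness auto
termination
  by (relation "measures [\<lambda>(p, L, sk, todo). length sk + length todo, \<lambda>(p, L, sk, todo). length todo]") auto

text \<open>The value \<open>M\<close> solving \<open>(2 * (k + 1)^2) ^ k = M\<close>, for which the
  pigeonhole count closes: \<open>k\<close> sums of \<open>k + 1\<close> terms take at most
  \<open>(2 * (k + 1)^2 * (M + 1)) ^ k = M * (M + 1) ^ k\<close> values, fewer than the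
  \<open>(M + 1) ^ (k + 1)\<close> coefficient vectors.\<close>

definition relation_bound :: "nat \<Rightarrow> nat" where
  "relation_bound k = (2 * (k + 1)\<^sup>2) ^ k"

text \<open>\<open>slack\<close> dominates \<open>dotp a a\<close> for all admissible rows, and
  \<open>slack / scale\<close> is \<open>tol k\<close>. \<open>fuel\<close> covers the squared
  distance from the origin to a scaled solution with entries between \<open>0\<close> and
  \<open>n\<close>; \<open>range\<close> covers the values of admissible rows at such solutions.
  \<open>threshold\<close> is twice the width that the polytope theorem asks for, which leaves room
  for the tolerance.\<close>

definition algo_params :: "nat \<Rightarrow> nat \<Rightarrow> params" where
  "algo_params k n = (let R = 32 * (k + 1) ^ 4 * relation_bound k in
     \<lparr>scale = int R, slack = int ((k + 1) ^ 3), fuel = (k + 1) * R\<^sup>2 * n\<^sup>2, dim = k,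
      range = (k + 1)\<^sup>2 * n, threshold = 4096 * (k + 1) ^ 6\<rparr>)"

definition vec_ok :: "nat \<Rightarrow> int list \<Rightarrow> bool" where
  "vec_ok k v \<longleftrightarrow> length v = k \<and> (\<forall>x\<in>set v. \<bar>x\<bar> \<le> int k + 1)"

definition constrs_ok :: "nat \<Rightarrow> constr list \<Rightarrow> bool" where
  "constrs_ok k L \<longleftrightarrow> (\<forall>(a, lo, hi)\<in>set L. vec_ok k a)"

lemma constrs_ok_Cons [simp]: "constrs_ok k ((v, C) # L) \<longleftrightarrow> vec_ok k v \<and> constrs_ok k L"
  by (cases C) (auto simp: constrs_ok_def)

lemma constrs_okD: "constrs_ok k L \<Longrightarrow> (a, lo, hi) \<in> set L \<Longrightarrow> vec_ok k a"
  by (fastforce simp: constrs_ok_def)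

lemma abs_dotp_le:
  assumes "length a = length x" "\<And>y. y \<in> set a \<Longrightarrow> \<bar>y\<bar> \<le> A" "\<And>y. y \<in> set x \<Longrightarrow> \<bar>y\<bar> \<le> B" "A \<ge> 0"
  shows "\<bar>dotp a x\<bar> \<le> int (length a) * (A * B)"
proof -
  have "\<bar>dotp a x\<bar> \<le> (\<Sum>i<length a. \<bar>a ! i * x ! i\<bar>)" unfolding dotp_nth[OF assms(1)] by (rule sum_abs)
  also have "\<dots> \<le> (\<Sum>i<length a. A * B)"
    using assms by (intro sum_mono) (auto simp: abs_mult intro!: mult_mono)
  finally show ?thesis by simp
qed

lemma dotp_self_le: "vec_ok k a \<Longrightarrow> dotp a a \<le> int ((k + 1) ^ 3)"
proof -
  assume a: "vec_ok k a"
  have "\<bar>dotp a a\<bar> \<le> int (length a) * ((int k + 1) * (int k + 1))"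
    using a by (intro abs_dotp_le) (auto simp: vec_ok_def)
  also have "\<dots> \<le> (int k + 1) * ((int k + 1) * (int k + 1))"
    using a by (intro mult_right_mono) (auto simp: vec_ok_def)
  also have "\<dots> = int ((k + 1) ^ 3)" by (simp add: power3_eq_cube algebra_simps)
  finally show ?thesis by simp
qed

lemma feasible_complete:
  assumes L: "constrs_ok k L" and z: "length z = k" "\<And>x. x \<in> set z \<Longrightarrow> 0 \<le> x \<and> x \<le> int n"
    and sat: "\<And>C. C \<in> set L \<Longrightarrow> sat z C"
  shows "feasible (algo_params k n) L"
  unfolding feasible_def
proof (rule perceptron_complete[where z = z])
  let ?p = "algo_params k n"
  have "sqdist (scale ?p) z (replicate (length z) 0) \<le> int (length z) * ((scale ?p)\<^sup>2 * (int n)\<^sup>2)"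
    by (rule sqdist_replicate_0_le) (use z in auto)
  also have "\<dots> \<le> int (fuel ?p)"
    unfolding algo_params_def Let_def using z(1) by (simp add: mult_right_mono mult.assoc del: of_nat_mult of_nat_power flip: of_nat_mult of_nat_power)
  finally show "sqdist (scale ?p) z (replicate (dim ?p) 0) \<le> int (fuel ?p)"
    using z(1) by (simp add: algo_params_def Let_def)
  show "length (replicate (dim ?p) 0) = k" by (simp add: algo_params_def Let_def)
  show "scale ?p \<ge> 0" by (simp add: algo_params_def Let_def)
  fix a lo hi assume a: "(a, lo, hi) \<in> set L"
  show "length a = k \<and> dotp a a \<le> slack ?p \<and> lo \<le> dotp a z \<and> dotp a z \<le> hi"
    using constrs_okD[OF L a] sat[OF a] dotp_self_le[of k a] by (auto simp: vec_ok_def sat_def algo_params_def Let_def)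
qed (use z in auto)

text \<open>The branch with \<open>t = dotp v z\<close> is never lost: this value lies within
  \<open>range\<close>, and the system extended by the equation is still solved by \<open>z\<close>,
  so the perceptron accepts it.\<close>

lemma solve_complete:
  assumes "p = algo_params k n" and "constrs_ok k L" "\<forall>v\<in>set sk \<union> set todo. vec_ok k v"
    and z: "length z = k" "\<And>x. x \<in> set z \<Longrightarrow> 0 \<le> x \<and> x \<le> int n"
    and "\<And>C. C \<in> set L \<Longrightarrow> sat z C"
  shows "solve p L sk todo"
  using assms(1-3,6)
proof (induction p L sk todo rule: solve.induct)
  case (1 p L sk)
  then show ?case using feasible_complete[of k L z n] z by simp
next
  case (2 p L sk v todo)
  let ?T = "possible_values p L v"
  have v: "vec_ok k v" using 2 by simp
  show ?case
  proof (cases "length ?T \<le> threshold p")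
    case True
    let ?t = "dotp v z"
    have sat: "sat z C" if "C \<in> set ((v, ?t, ?t) # L)" for C
      using that 2(6)[of C] by (auto simp: sat_def)
    have "\<bar>?t\<bar> \<le> int (length v) * ((int k + 1) * int n)"
      using v z by (intro abs_dotp_le) (auto simp: vec_ok_def)
    also have "\<dots> \<le> (int k + 1) * ((int k + 1) * int n)"
      using v by (intro mult_right_mono) (auto simp: vec_ok_def)
    also have "\<dots> = int (range p)"
      unfolding 2(3) by (simp add: algo_params_def Let_def power2_eq_square algebra_simps)
    finally have "\<bar>?t\<bar> \<le> int (range p)" .
    moreover have "feasible p ((v, ?t, ?t) # L)"
      unfolding 2(3) by (rule feasible_complete[of k _ z n]) (use 2 v z sat in auto)
    ultimately have t: "?t \<in> set ?T" by (auto simp: possible_values_def values_from_def)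
    have "solve p ((v, ?t, ?t) # L) [] (sk @ todo)"
      by (rule 2(1)[OF refl True t]) (use 2 v sat in auto)
    then show ?thesis using True t by (auto simp: list_ex_iff)
  next
    case False
    then have "solve p L (v # sk) todo" by (intro 2(2)[OF refl]) (use 2 in auto)
    then show ?thesis using False by simp
  qed
qed

section \<open>Soundness of the search\<close>

abbreviation row_of :: "constr \<Rightarrow> nat \<Rightarrow> int" where "row_of C c \<equiv> fst C ! c"

text \<open>This is \<open>slack / scale\<close>, the error in a row at the rescaled point that the
  perceptron finds.\<close>

definition tol :: "nat \<Rightarrow> real" where
  "tol k = 1 / (32 * (real k + 1) * real (relation_bound k))"

abbreviation region :: "nat \<Rightarrow> constr list \<Rightarrow> real \<Rightarrow> (nat \<Rightarrow> real) set" where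
  "region k L \<equiv> relaxed k (set L) row_of (\<lambda>C. fst (snd C)) (\<lambda>C. snd (snd C))"

abbreviation rdot :: "nat \<Rightarrow> int list \<Rightarrow> (nat \<Rightarrow> real) \<Rightarrow> real" where
  "rdot k v x \<equiv> dot k (\<lambda>c. real_of_int (v ! c)) x"

lemma relation_bound_pos: "relation_bound k \<ge> 1"
  unfolding relation_bound_def by (intro one_le_power) simp

lemma tol_pos: "tol k > 0" and tol_le: "tol k * (32 * (real k + 1)) \<le> 1"
  and tol_relation: "tol k * (32 * (real k + 1) * real (relation_bound k)) = 1"
proof -
  have b: "real (relation_bound k) \<ge> 1" using relation_bound_pos[of k] by linarith
  show "tol k > 0" using b by (simp add: tol_def zero_less_mult_iff)
  show *: "tol k * (32 * (real k + 1) * real (relation_bound k)) = 1"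
    using b by (simp add: tol_def)
  have "tol k * (32 * (real k + 1)) * 1 \<le> tol k * (32 * (real k + 1)) * real (relation_bound k)"
    using b \<open>tol k > 0\<close> by (intro mult_left_mono) auto
  then show "tol k * (32 * (real k + 1)) \<le> 1" using * by (simp add: mult.assoc)
qed

lemma mem_region_Cons:
  "x \<in> region k ((v, lo, hi) # L) e \<longleftrightarrow>
     of_int lo - e \<le> rdot k v x \<and> rdot k v x \<le> of_int hi + e \<and> x \<in> region k L e"
  by (auto simp: relaxed_def)

lemma feasible_sound:
  assumes "feasible (algo_params k n) L" and L: "constrs_ok k L"
  shows "\<exists>x. x \<in> region k L (tol k)"
proof -
  let ?R = "scale (algo_params k n)" and ?s = "slack (algo_params k n)"
  obtain Y where Y: "length Y = k"
    "\<forall>(a, lo, hi)\<in>set L. ?R * lo - ?s \<le> dotp a Y \<and> dotp a Y \<le> ?R * hi + ?s"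
    using perceptron_sound[OF assms(1)[unfolded feasible_def], of k] constrs_okD[OF L]
    by (auto simp: algo_params_def Let_def vec_ok_def)
  define R where "R = real_of_int ?R"
  have R: "R = 32 * (real k + 1) ^ 4 * real (relation_bound k)"
    by (simp add: R_def algo_params_def Let_def add.commute)
  have b: "real (relation_bound k) \<ge> 1" using relation_bound_pos[of k] by linarith
  have R0: "R > 0" unfolding R using b by (intro mult_pos_pos) auto
  have s: "real_of_int ?s = tol k * R"
  proof -
    have "real_of_int ?s = (real k + 1) ^ 3" by (simp add: algo_params_def Let_def add.commute)
    moreover have "(real k + 1) ^ 4 = (real k + 1) * (real k + 1) ^ 3" by (simp add: power_numeral_reduce)
    ultimately show ?thesis using tol_relation[of k] by (simp add: R mult_ac)
  qed
  let ?x = "\<lambda>c. real_of_int (Y ! c) / R"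
  have "of_int lo - tol k \<le> rdot k a ?x \<and> rdot k a ?x \<le> of_int hi + tol k" if C: "(a, lo, hi) \<in> set L" for a lo hi
  proof -
    have "length a = length Y" using constrs_okD[OF L C] Y(1) by (simp add: vec_ok_def)
    then have d: "real_of_int (dotp a Y) = R * rdot k a ?x"
      using Y(1) R0 by (simp add: dotp_nth dot_def sum_distrib_left)
    have "?R * lo - ?s \<le> dotp a Y" "dotp a Y \<le> ?R * hi + ?s" using Y(2) C by auto
    then have "real_of_int (?R * lo - ?s) \<le> real_of_int (dotp a Y)" "real_of_int (dotp a Y) \<le> real_of_int (?R * hi + ?s)"
      by linarith+
    then have "R * (of_int lo - tol k) \<le> R * rdot k a ?x" "R * rdot k a ?x \<le> R * (of_int hi + tol k)"
      unfolding d by (simp_all add: s R_def[symmetric] algebra_simps)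
    then show ?thesis using R0 by simp
  qed
  then show ?thesis by (intro exI[of _ ?x]) (auto simp: relaxed_def)
qed

lemma possible_values_sound:
  assumes "t \<in> set (possible_values (algo_params k n) L v)" "constrs_ok k L" "vec_ok k v"
  shows "\<exists>x\<in>region k L (tol k). \<bar>rdot k v x - of_int t\<bar> \<le> tol k"
proof -
  have "feasible (algo_params k n) ((v, t, t) # L)"
    using assms(1) by (auto simp: possible_values_def values_from_def)
  then obtain x where "x \<in> region k ((v, t, t) # L) (tol k)"
    using feasible_sound[of k n] assms by fastforce
  then show ?thesis unfolding mem_region_Cons by (intro bexI[of _ x]) (auto simp: abs_le_iff)
qed

lemma distinct_possible_values: "distinct (possible_values p L v)"
  by (simp add: possible_values_def values_from_def)

lemma ex_far_apart:
  assumes "distinct (T :: int list)" "length T \<ge> w + 1"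
  shows "\<exists>a\<in>set T. \<exists>b\<in>set T. b - a \<ge> int w"
proof -
  have ne: "set T \<noteq> {}" using assms(2) by auto
  have "w + 1 \<le> card (set T)" using assms by (simp add: distinct_card)
  also have "\<dots> \<le> card {Min (set T)..Max (set T)}" by (intro card_mono) auto
  finally have "int w \<le> Max (set T) - Min (set T)" by simp
  then show ?thesis using ne by (meson Max_in Min_in finite_set)
qed

text \<open>At a leaf the dichotomy of the polytope theorem holds. An equation in \<open>L\<close>
  makes its row narrow. A row with more than \<open>threshold p\<close> possible values has two of
  them at least \<open>threshold p\<close> apart, each attained up to \<open>tol k\<close> in the
  region, so it is wide.\<close>

lemma solve_leaf:
  assumes p: "p = algo_params k n" and L: "constrs_ok k L" and sub: "set L0 \<subseteq> set L"
    and L01: "\<And>a lo hi x. (a, lo, hi) \<in> set L0 \<Longrightarrow> x \<in> set a \<Longrightarrow> \<bar>x\<bar> \<le> 1"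
    and unit: "\<And>c. c < k \<Longrightarrow> \<exists>lo hi. (map (\<lambda>j. if j = c then 1 else 0) [0..<k], lo, hi) \<in> set L0"
    and feas: "feasible p L"
    and cases: "\<And>v. vec_ok k v \<Longrightarrow> (\<exists>t. (v, t, t) \<in> set L) \<or> length (possible_values p L v) > threshold p"
  shows "\<exists>z. length z = k \<and> (\<forall>C\<in>set L0. sat z C)"
proof -
  obtain x0 where x0: "x0 \<in> region k L (tol k)" using feasible_sound feas L p by blast
  show ?thesis
  \<comment> \<open>The polytope theorem is about \<open>k \<ge> 1\<close>. For \<open>k = 0\<close>
    the empty list is the only point, and \<open>tol k < 1\<close> makes the approximate bounds
    exact.\<close>
  proof (cases "k = 0")
    case True
    have "sat [] C" if C: "C \<in> set L0" for C
    proof -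
      obtain a lo hi where Ceq: "C = (a, lo, hi)" by (cases C)
      then have "of_int lo - tol k \<le> 0" "0 \<le> of_int hi + tol k"
        using x0 subsetD[OF sub C] True unfolding relaxed_def by (force simp: dot_def)+
      moreover have "tol k < 1" using tol_le[of k] tol_pos[of k] True by simp
      ultimately show ?thesis by (simp add: Ceq sat_def)
    qed
    then show ?thesis using True by auto
  next
    case False
    have "\<exists>z. \<forall>C\<in>set L0. fst (snd C) \<le> (\<Sum>c<k. row_of C c * z c) \<and> (\<Sum>c<k. row_of C c * z c) \<le> snd (snd C)"
    proof (rule integer_point_in_wide_polytope[of k "set L0" "set L" row_of "tol k" x0])
      show "1 \<le> k" using False by simp
      show "set L0 \<subseteq> set L" by (rule sub)
      show "\<bar>row_of C c\<bar> \<le> 1" if "C \<in> set L0" "c < k" for C c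
      proof -
        obtain a lo hi where "C = (a, lo, hi)" by (cases C)
        moreover from this have "length a = k" using constrs_okD[OF L] sub that(1) by (auto simp: vec_ok_def)
        ultimately show ?thesis using L01 that by auto
      qed
      show "\<bar>row_of C c\<bar> \<le> int k + 1" if "C \<in> set L" "c < k" for C c
      proof -
        obtain a lo hi where "C = (a, lo, hi)" by (cases C)
        moreover from this have "vec_ok k a" using constrs_okD[OF L] that(1) by auto
        ultimately show ?thesis using that by (auto simp: vec_ok_def)
      qed
      show "\<exists>C\<in>set L0. \<forall>j<k. row_of C j = (if j = c then 1 else 0)" if c: "c < k" for c
        using unit[OF c] by (auto intro!: bexI)
      show "0 < tol k" by (rule tol_pos)
      show "tol k * (32 * (real k + 1)) \<le> 1" by (rule tol_le)
      show "x0 \<in> region k L (tol k)" by (rule x0)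
      fix v :: "nat \<Rightarrow> int" assume v: "\<And>c. c < k \<Longrightarrow> \<bar>v c\<bar> \<le> int k"
      let ?v = "map v [0..<k]"
      have dot: "dot k (\<lambda>c. real_of_int (v c)) x = rdot k ?v x" for x
        unfolding dot_def by (intro sum.cong) auto
      have ok: "vec_ok k ?v" using v by (force simp: vec_ok_def)
      show "(\<exists>t::int. \<forall>x\<in>region k L (2 * tol k). \<bar>dot k (\<lambda>c. real_of_int (v c)) x - of_int t\<bar> \<le> 2 * tol k) \<or>
        (\<exists>x\<in>region k L (tol k). \<exists>y\<in>region k L (tol k).
          2048 * (real k + 1) ^ 6 \<le> dot k (\<lambda>c. real_of_int (v c)) x - dot k (\<lambda>c. real_of_int (v c)) y)"
        using cases[OF ok]
      proof
        assume "\<exists>t. (?v, t, t) \<in> set L"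
        then obtain t where t: "(?v, t, t) \<in> set L" by blast
        have "\<bar>rdot k ?v x - of_int t\<bar> \<le> 2 * tol k" if "x \<in> region k L (2 * tol k)" for x
          using that t by (fastforce simp: relaxed_def abs_le_iff)
        then show ?thesis unfolding dot by blast
      next
        assume "length (possible_values p L ?v) > threshold p"
        then obtain a b where ab: "a \<in> set (possible_values p L ?v)" "b \<in> set (possible_values p L ?v)"
          "b - a \<ge> int (threshold p)"
          using ex_far_apart[OF distinct_possible_values, of "threshold p" p L ?v] by auto
        obtain x y where xy: "x \<in> region k L (tol k)" "\<bar>rdot k ?v x - of_int b\<bar> \<le> tol k"
          "y \<in> region k L (tol k)" "\<bar>rdot k ?v y - of_int a\<bar> \<le> tol k"
          using possible_values_sound[OF _ L ok] ab(1,2) p by metis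
        have "tol k * 1 \<le> tol k * (32 * (real k + 1))" using tol_pos[of k] by (intro mult_left_mono) auto
        then have "tol k \<le> 1" using tol_le[of k] by linarith
        moreover have "real_of_int (b - a) \<ge> 4096 * (real k + 1) ^ 6"
        proof -
          have "real_of_int (b - a) \<ge> real_of_int (int (threshold p))" using ab(3) by linarith
          then show ?thesis by (simp add: p algo_params_def Let_def add.commute)
        qed
        moreover have "(real k + 1) ^ 6 \<ge> 1" by (intro one_le_power) simp
        ultimately have "2048 * (real k + 1) ^ 6 \<le> rdot k ?v x - rdot k ?v y" 
          using xy(2,4) unfolding of_int_diff by linarith
        then show ?thesis using xy(1,3) unfolding dot by blast
      qed
    qed
    then obtain z where z: "\<forall>C\<in>set L0. fst (snd C) \<le> (\<Sum>c<k. row_of C c * z c) \<and> (\<Sum>c<k. row_of C c * z c) \<le> snd (snd C)"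
      by blast
    have "sat (map z [0..<k]) C" if C: "C \<in> set L0" for C
    proof -
      obtain a lo hi where Ceq: "C = (a, lo, hi)" by (cases C)
      then have "length a = k" using constrs_okD[OF L] sub C by (auto simp: vec_ok_def)
      then show ?thesis using z C by (auto simp: Ceq sat_def dotp_nth)
    qed
    then show ?thesis by (intro exI[of _ "map z [0..<k]"]) auto
  qed
qed

text \<open>The invariant on rows: each admissible row is fixed in \<open>L\<close>, was skipped
  with too many values relative to the present \<open>L\<close>, or is still to come. A new equation
  can invalidate the second case, which is why the skipped rows return to the list.\<close>

lemma solve_sound:
  assumes "p = algo_params k n" and "constrs_ok k L" and "set L0 \<subseteq> set L"
    and L01: "\<And>a lo hi x. (a, lo, hi) \<in> set L0 \<Longrightarrow> x \<in> set a \<Longrightarrow> \<bar>x\<bar> \<le> 1"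
    and unit: "\<And>c. c < k \<Longrightarrow> \<exists>lo hi. (map (\<lambda>j. if j = c then 1 else 0) [0..<k], lo, hi) \<in> set L0"
    and "\<forall>v\<in>set sk \<union> set todo. vec_ok k v"
    and "\<And>v. vec_ok k v \<Longrightarrow> (\<exists>t. (v, t, t) \<in> set L) \<or>
       v \<in> set sk \<and> length (possible_values p L v) > threshold p \<or> v \<in> set todo"
    and "solve p L sk todo"
  shows "\<exists>z. length z = k \<and> (\<forall>C\<in>set L0. sat z C)"
  using assms(1-3,6-8)
proof (induction p L sk todo rule: solve.induct)
  case (1 p L sk)
  show ?case by (rule solve_leaf[OF 1(1,2,3) L01 unit]) (use 1 in auto)
next
  case (2 p L sk v todo)
  have v: "vec_ok k v" using 2 by simp
  show ?case
  proof (cases "length (possible_values p L v) \<le> threshold p")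
    case True
    then obtain t where t: "t \<in> set (possible_values p L v)" "solve p ((v, t, t) # L) [] (sk @ todo)"
      using 2(8) by (auto simp: list_ex_iff)
    show ?thesis
    proof (rule 2(1)[OF refl True t(1) 2(3) _ _ _ _ t(2)])
      fix u assume "vec_ok k u"
      from 2(7)[OF this] show "(\<exists>t'. (u, t', t') \<in> set ((v, t, t) # L)) \<or>
        u \<in> set [] \<and> threshold p < length (possible_values p ((v, t, t) # L) u) \<or> u \<in> set (sk @ todo)"
        by auto
    qed (use 2 v in auto)
  next
    case False
    show ?thesis
    proof (rule 2(2)[OF refl False 2(3,4,5)])
      show "solve p L (v # sk) todo" using 2(8) False by simp
      fix u assume "vec_ok k u"
      from 2(7)[OF this] False show "(\<exists>t. (u, t, t) \<in> set L) \<or>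
        u \<in> set (v # sk) \<and> threshold p < length (possible_values p L u) \<or> u \<in> set todo"
        by auto
    qed (use 2 in auto)
  qed
qed

text \<open>A quantitative form of linear independence. On a region known up to \<open>tol k\<close>
  only small coefficients can be used; large ones would magnify the error beyond the distance of two
  integers.\<close>

definition no_small_relation :: "nat \<Rightarrow> nat \<Rightarrow> int list list \<Rightarrow> bool" where
  "no_small_relation M k vs \<longleftrightarrow> (\<forall>m::nat \<Rightarrow> int. (\<forall>i<length vs. \<bar>m i\<bar> \<le> int M) \<longrightarrow>
     (\<forall>c<k. (\<Sum>i<length vs. m i * vs ! i ! c) = 0) \<longrightarrow> (\<forall>i<length vs. m i = 0))"

text \<open>Pigeonhole: the combinations of more than \<open>k\<close> vectors with coefficients up to the bound are
  more numerous than their possible values.\<close>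

lemma no_small_relation_length:
  assumes ind: "no_small_relation (relation_bound k) k vs" and vs: "\<forall>v\<in>set vs. vec_ok k v"
  shows "length vs \<le> k"
proof (rule ccontr)
  assume "\<not> length vs \<le> k"
  then have len: "k + 1 \<le> length vs" by simp
  define K where "K = k + 1"
  define M where "M = relation_bound k"
  let ?D = "PiE {..<k + 1} (\<lambda>_. {0..int M})"
  let ?E = "PiE {..<k} (\<lambda>_. {- int (K * K * M)..int (K * K * M)})"
  let ?f = "\<lambda>m. \<lambda>c\<in>{..<k}. \<Sum>i<k + 1. m i * vs ! i ! c"
  have into: "?f ` ?D \<subseteq> ?E"
  proof (rule image_subsetI)
    fix m assume m: "m \<in> ?D"
    have bound: "\<bar>\<Sum>i<k + 1. m i * vs ! i ! c\<bar> \<le> int (K * K * M)" if c: "c < k" for c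
    proof -
      have "\<bar>\<Sum>i<k + 1. m i * vs ! i ! c\<bar> \<le> (\<Sum>i<k + 1. \<bar>m i * vs ! i ! c\<bar>)" by (rule sum_abs)
      also have "\<dots> \<le> (\<Sum>i<k + 1. int M * int K)"
      proof (rule sum_mono)
        fix i assume i: "i \<in> {..<k + 1}"
        then have "vs ! i \<in> set vs" using len by auto
        then have "vec_ok k (vs ! i)" using vs by blast
        then have "\<bar>vs ! i ! c\<bar> \<le> int K" using nth_mem[of c "vs ! i"] c by (simp add: vec_ok_def K_def del: nth_mem) (metis add.commute)
        moreover have "\<bar>m i\<bar> \<le> int M" using m i by (auto simp: PiE_iff)
        ultimately show "\<bar>m i * vs ! i ! c\<bar> \<le> int M * int K" unfolding abs_mult by (intro mult_mono) auto
      qed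
      also have "\<dots> = int (K * K * M)" by (simp add: K_def algebra_simps)
      finally show ?thesis .
    qed
    have "(\<Sum>i<k + 1. m i * vs ! i ! c) \<in> {- int (K * K * M)..int (K * K * M)}" if "c < k" for c
      using bound[OF that] unfolding abs_le_iff atLeastAtMost_iff by linarith
    then show "?f m \<in> ?E" unfolding restrict_PiE_iff by blast
  qed
  have "card ?E = (2 * (K * K * M) + 1) ^ k"
  proof -
    have "card ?E = (\<Prod>c<k. nat (2 * int (K * K * M) + 1))" by (simp add: card_PiE algebra_simps)
    also have "nat (2 * int (K * K * M) + 1) = 2 * (K * K * M) + 1" by linarith
    finally show ?thesis by simp
  qed
  also have "\<dots> \<le> (2 * K\<^sup>2 * (M + 1)) ^ k"
    by (intro power_mono) (auto simp: power2_eq_square K_def algebra_simps)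
  also have "\<dots> = M * (M + 1) ^ k"
  proof -
    have M: "(2 * K\<^sup>2) ^ k = M" by (simp add: M_def relation_bound_def K_def)
    show ?thesis unfolding power_mult_distrib[of "2 * K\<^sup>2" "M + 1" k] M ..
  qed
  also have "\<dots> < (M + 1) ^ (k + 1)" by simp
  also have "\<dots> = card ?D" by (simp add: card_PiE nat_add_distrib)
  finally have "\<not> inj_on ?f ?D"
    using card_inj_on_le[OF _ into] finite_PiE[of "{..<k}" "\<lambda>_. {- int (K * K * M)..int (K * K * M)}"] by auto
  then obtain m m' where m: "m \<in> ?D" "m' \<in> ?D" "m \<noteq> m'" "?f m = ?f m'"
    unfolding inj_on_def by blast
  \<comment> \<open>Two colliding combinations of the first \<open>k + 1\<close> vectors differ by a
    relation; further vectors get coefficient \<open>0\<close>.\<close>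
  define d where "d i = (if i < k + 1 then m i - m' i else 0)" for i
  have "\<bar>d i\<bar> \<le> int M" for i
  proof (cases "i < k + 1")
    case True
    then have "m i \<in> {0..int M}" "m' i \<in> {0..int M}"
      using PiE_mem[OF m(1), of i] PiE_mem[OF m(2), of i] by blast+
    then show ?thesis by (auto simp: d_def)
  qed (simp add: d_def)
  moreover have "(\<Sum>i<length vs. d i * vs ! i ! c) = 0" if c: "c < k" for c
  proof -
    have "(\<Sum>i<length vs. d i * vs ! i ! c) = (\<Sum>i<k + 1. d i * vs ! i ! c)"
      using len by (intro sum.mono_neutral_right) (auto simp: d_def)
    also have "\<dots> = (\<Sum>i<k + 1. m i * vs ! i ! c) - (\<Sum>i<k + 1. m' i * vs ! i ! c)"
      unfolding sum_subtractf[symmetric] by (intro sum.cong) (auto simp: d_def algebra_simps)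
    also have "\<dots> = 0" using fun_cong[OF m(4), of c] c by simp
    finally show ?thesis .
  qed
  ultimately have "\<forall>i<length vs. d i = 0"
    using ind unfolding no_small_relation_def M_def[symmetric] by blast
  then have "d i = 0" if "i < k + 1" for i using that len by simp
  then have "m i = m' i" if "i < k + 1" for i using that unfolding d_def by fastforce
  then have "m = m'" using m(1,2) by (intro PiE_ext[of m "{..<k + 1}" _ m']) auto
  then show False using m(3) by simp
qed

text \<open>The rows in \<open>vs\<close> are fixed up to \<open>2 * tol k\<close>. A relation with
  nonzero coefficient at \<open>v\<close> would make \<open>v\<close> vary by at most
  \<open>1/16\<close> on the region, whereas two possible values force a variation of at least
  \<open>1 - 2 * tol k\<close>. So this coefficient is \<open>0\<close> and the old independence
  applies.\<close>

lemma no_small_relation_snoc: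
  assumes ind: "no_small_relation (relation_bound k) k vs"
    and vs: "\<forall>u\<in>set vs. vec_ok k u \<and> (\<exists>t. (u, t, t) \<in> set L)"
    and L: "constrs_ok k L" and v: "vec_ok k v"
    and two: "length (possible_values (algo_params k n) L v) \<ge> 2"
  shows "no_small_relation (relation_bound k) k (vs @ [v])"
  unfolding no_small_relation_def
proof (intro allI impI)
  let ?l = "length vs" and ?M = "relation_bound k" and ?e = "tol k"
  fix m :: "nat \<Rightarrow> int" and i
  assume m: "\<forall>i<length (vs @ [v]). \<bar>m i\<bar> \<le> int ?M"
    and rel: "\<forall>c<k. (\<Sum>i<length (vs @ [v]). m i * (vs @ [v]) ! i ! c) = 0"
    and i: "i < length (vs @ [v])"
  have rel': "(\<Sum>i<?l. m i * vs ! i ! c) + m ?l * v ! c = 0" if "c < k" for c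
  proof -
    have "(\<Sum>i<?l. m i * (vs @ [v]) ! i ! c) = (\<Sum>i<?l. m i * vs ! i ! c)"
      by (intro sum.cong) (auto simp: nth_append)
    then show ?thesis using rel[rule_format, OF that] by simp
  qed
  have len: "?l \<le> k" using no_small_relation_length[OF ind] vs by blast
  obtain a b where ab: "a \<in> set (possible_values (algo_params k n) L v)"
    "b \<in> set (possible_values (algo_params k n) L v)" "b - a \<ge> 1"
    using ex_far_apart[OF distinct_possible_values, of 1 "algo_params k n" L v] two by auto
  obtain x y where xy: "x \<in> region k L ?e" "\<bar>rdot k v x - of_int b\<bar> \<le> ?e"
    "y \<in> region k L ?e" "\<bar>rdot k v y - of_int a\<bar> \<le> ?e"
    using possible_values_sound[OF _ L v] ab(1,2) by metis
  have far: "rdot k v x - rdot k v y \<ge> 1 - 2 * ?e"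
  proof -
    have "real_of_int b - real_of_int a \<ge> 1" using ab(3) by linarith
    then show ?thesis using xy(2,4) by linarith
  qed
  have close: "\<bar>rdot k (vs ! i) x - rdot k (vs ! i) y\<bar> \<le> 2 * ?e" if il: "i < ?l" for i
  proof -
    obtain t where "(vs ! i, t, t) \<in> set L" using vs nth_mem[OF il] by blast
    then have "\<bar>rdot k (vs ! i) z - of_int t\<bar> \<le> ?e" if "z \<in> region k L ?e" for z
      using that by (fastforce simp: relaxed_def abs_le_iff)
    from this[OF xy(1)] this[OF xy(3)] show ?thesis by linarith
  qed
  have m0: "m ?l = 0"
  proof (rule ccontr)
    assume "m ?l \<noteq> 0"
    then have "1 \<le> \<bar>real_of_int (m ?l)\<bar>" by linarith
    have comb: "(\<Sum>i<?l. of_int (m i) * rdot k (vs ! i) z) + of_int (m ?l) * rdot k v z = 0" for z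
    proof -
      have "(\<Sum>i<?l. of_int (m i) * rdot k (vs ! i) z) + of_int (m ?l) * rdot k v z
        = (\<Sum>c<k. \<Sum>i<?l. of_int (m i) * (of_int (vs ! i ! c) * z c)) + (\<Sum>c<k. of_int (m ?l) * (of_int (v ! c) * z c))"
        unfolding dot_def sum_distrib_left by (subst sum.swap) simp
      also have "\<dots> = (\<Sum>c<k. of_int ((\<Sum>i<?l. m i * vs ! i ! c) + m ?l * v ! c) * z c)"
        unfolding sum.distrib[symmetric]
        by (intro sum.cong) (auto simp: distrib_right sum_distrib_right mult.assoc)
      also have "\<dots> = 0" using rel' by simp
      finally show ?thesis .
    qed
    have "of_int (m ?l) * (rdot k v x - rdot k v y) = - (\<Sum>i<?l. of_int (m i) * (rdot k (vs ! i) x - rdot k (vs ! i) y))"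
      unfolding right_diff_distrib sum_subtractf using comb[of x] comb[of y] by linarith
    then have "\<bar>of_int (m ?l)\<bar> * \<bar>rdot k v x - rdot k v y\<bar> = \<bar>\<Sum>i<?l. of_int (m i) * (rdot k (vs ! i) x - rdot k (vs ! i) y)\<bar>"
      unfolding abs_mult[symmetric] by (simp only: abs_minus_cancel)
    also have "\<dots> \<le> (\<Sum>i<?l. real ?M * (2 * ?e))"
    proof (rule order_trans[OF sum_abs], rule sum_mono)
      fix i assume "i \<in> {..<?l}"
      then have "\<bar>real_of_int (m i)\<bar> \<le> real ?M" using m[rule_format, of i] by simp
      then show "\<bar>of_int (m i) * (rdot k (vs ! i) x - rdot k (vs ! i) y)\<bar> \<le> real ?M * (2 * ?e)"
        unfolding abs_mult using close[of i] \<open>i \<in> {..<?l}\<close> by (intro mult_mono) auto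
    qed
    also have "\<dots> = real ?l * (2 * (real ?M * ?e))" by simp
    also have "\<dots> \<le> (real k + 1) * (2 * (real ?M * ?e))"
      using len tol_pos[of k] by (intro mult_right_mono) auto
    also have "\<dots> = ?e * (32 * (real k + 1) * real ?M) / 16" by simp
    also have "\<dots> = 1/16" unfolding tol_relation ..
    finally have upper: "\<bar>of_int (m ?l)\<bar> * \<bar>rdot k v x - rdot k v y\<bar> \<le> 1/16" .
    have "1 * \<bar>rdot k v x - rdot k v y\<bar> \<le> \<bar>of_int (m ?l)\<bar> * \<bar>rdot k v x - rdot k v y\<bar>"
      using \<open>1 \<le> \<bar>real_of_int (m ?l)\<bar>\<close> by (intro mult_right_mono) auto
    from order_trans[OF this upper] have "\<bar>rdot k v x - rdot k v y\<bar> \<le> 1/16" by simp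
    moreover have "?e \<le> 1/32"
    proof -
      have "?e * 32 \<le> ?e * (32 * (real k + 1))" using tol_pos[of k] by (intro mult_left_mono) auto
      then show ?thesis using tol_le[of k] by linarith
    qed
    ultimately show False using far by linarith
  qed
  have "\<forall>i<?l. m i = 0"
    using ind m rel' m0 unfolding no_small_relation_def by simp
  then show "m i = 0" using i m0 by (cases "i = ?l") auto
qed

section \<open>Fair matchings as integer points\<close>

definition nbrs :: "(nat, nat) mmfm \<Rightarrow> nat \<Rightarrow> nat set" where
  "nbrs I u = {v \<in> right I. {u, v} \<in> edges I}"

lemma partners_left:
  assumes I: "bipartite_graph U V E" and M: "M \<subseteq> E" and u: "u \<in> U"
  shows "partners M u \<subseteq> V" "finite (partners M u)"
proof -
  show *: "partners M u \<subseteq> V"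
  proof
    fix w assume "w \<in> partners M u"
    then have "{u, w} \<in> E" using M by (auto simp: partners_def)
    then obtain a b where "a \<in> U" "b \<in> V" "{u, w} = {a, b}" using I unfolding bipartite_graph_def by blast
    then show "w \<in> V" using I u unfolding bipartite_graph_def by (auto simp: doubleton_eq_iff)
  qed
  show "finite (partners M u)" using * I finite_subset unfolding bipartite_graph_def by blast
qed

text \<open>The least color count serves as \<open>a\<close>. The point of the window is to decouple
  the colors: once \<open>a\<close> is chosen for every right vertex, each color is a separate load
  problem.\<close>

lemma MaxMin_le_iff:
  assumes "finite C"
  shows "MaxMin C g X \<le> l \<longleftrightarrow>
    (\<exists>a::int. \<forall>c\<in>C. a \<le> int (card (color_class g X c)) \<and> int (card (color_class g X c)) \<le> a + int l)"
proof (cases "C = {}")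
  case False
  let ?f = "\<lambda>c. card (color_class g X c)"
  show ?thesis
  proof
    assume "MaxMin C g X \<le> l"
    then have *: "Max (?f ` C) \<le> Min (?f ` C) + l" using False by (simp add: MaxMin_def)
    have "Min (?f ` C) \<le> ?f c \<and> ?f c \<le> Min (?f ` C) + l" if "c \<in> C" for c
    proof
      show "Min (?f ` C) \<le> ?f c" using assms that by (intro Min_le) auto
      have "?f c \<le> Max (?f ` C)" using assms that by (intro Max_ge) auto
      then show "?f c \<le> Min (?f ` C) + l" using * by linarith
    qed
    then show "\<exists>a::int. \<forall>c\<in>C. a \<le> int (?f c) \<and> int (?f c) \<le> a + int l"
      by (intro exI[of _ "int (Min (?f ` C))"]) (metis of_nat_add of_nat_le_iff)
  next
    assume "\<exists>a::int. \<forall>c\<in>C. a \<le> int (?f c) \<and> int (?f c) \<le> a + int l"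
    then obtain a :: int where a: "\<forall>c\<in>C. a \<le> int (?f c) \<and> int (?f c) \<le> a + int l" by blast
    have "Max (?f ` C) \<in> ?f ` C" "Min (?f ` C) \<in> ?f ` C"
      using assms False by (intro Max_in Min_in; simp)+
    then obtain c c' where c: "c \<in> C" "c' \<in> C" "Max (?f ` C) = ?f c" "Min (?f ` C) = ?f c'" by blast
    then have "int (?f c) \<le> a + int l" "a \<le> int (?f c')" using a by auto
    then show "MaxMin C g X \<le> l" using False c by (simp add: MaxMin_def)
  qed
qed (simp add: MaxMin_def)

lemma yes_iff_assignment:
  assumes I: "mmfm_instance I"
  shows "mmfm_yes I \<longleftrightarrow> (\<exists>f (a::nat \<Rightarrow> int). (\<forall>u\<in>left I. f u \<in> nbrs I u) \<and>
    (\<forall>v\<in>right I. \<forall>c\<in>colors I.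
       a v \<le> load (color_class (coloring I) (left I) c) f v \<and>
       load (color_class (coloring I) (left I) c) f v \<le> a v + int (fairness I)))"
    (is "_ \<longleftrightarrow> ?R")
proof -
  let ?U = "left I" and ?V = "right I" and ?E = "edges I" and ?C = "colors I" and ?col = "coloring I"
  have bip: "bipartite_graph ?U ?V ?E" and finC: "finite ?C" using I by (auto simp: mmfm_instance_def)
  have disj: "?U \<inter> ?V = {}" using bip by (simp add: bipartite_graph_def)
  have fair: "fair_matching ?V ?C ?col (fairness I) M \<longleftrightarrow> (\<exists>a::nat \<Rightarrow> int. \<forall>v\<in>?V. \<forall>c\<in>?C.
      a v \<le> int (card (color_class ?col (partners M v) c)) \<and>
      int (card (color_class ?col (partners M v) c)) \<le> a v + int (fairness I))" for M
    unfolding fair_matching_def fair_set_def MaxMin_le_iff[OF finC] by (rule bchoice_iff)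
  show ?thesis
  proof
    assume "mmfm_yes I"
    then obtain M where M: "M \<subseteq> ?E" "\<forall>u\<in>?U. card (partners M u) = 1"
      "fair_matching ?V ?C ?col (fairness I) M"
      unfolding mmfm_yes_def many_to_one_matching_def left_perfect_def by blast
    define f where "f u = the_elem (partners M u)" for u
    have f: "partners M u = {f u}" if u: "u \<in> ?U" for u
      using M(2) u card_1_singletonE[of "partners M u"] by (metis f_def the_elem_eq)
    have "f u \<in> nbrs I u" if u: "u \<in> ?U" for u
      using partners_left[OF bip M(1) u] f[OF u] M(1) by (auto simp: nbrs_def partners_def)
    moreover have "int (card (color_class ?col (partners M v) c)) = load (color_class ?col ?U c) f v" if v: "v \<in> ?V" for v c
    proof -
      have "w \<in> partners M v \<longleftrightarrow> w \<in> ?U \<and> f w = v" for w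
      proof
        assume w: "w \<in> partners M v"
        then have "{v, w} \<in> ?E" using M(1) by (auto simp: partners_def)
        then obtain a b where "a \<in> ?U" "b \<in> ?V" "{v, w} = {a, b}" using bip unfolding bipartite_graph_def by blast
        then have "w \<in> ?U" using disj v by (auto simp: doubleton_eq_iff)
        moreover have "v \<in> partners M w" using w by (simp add: partners_def insert_commute)
        ultimately show "w \<in> ?U \<and> f w = v" using f by auto
      next
        assume "w \<in> ?U \<and> f w = v"
        then have "v \<in> partners M w" using f by auto
        then show "w \<in> partners M v" by (simp add: partners_def insert_commute)
      qed
      then have "color_class ?col (partners M v) c = {u \<in> color_class ?col ?U c. f u = v}"
        by (auto simp: color_class_def)
      then show ?thesis by (simp add: load_def)
    qed
    ultimately show ?R using M(3) unfolding fair by fastforce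
  next
    assume ?R
    then obtain f a where f: "\<forall>u\<in>?U. f u \<in> nbrs I u" and a: "\<forall>v\<in>?V. \<forall>c\<in>?C.
       a v \<le> load (color_class ?col ?U c) f v \<and> load (color_class ?col ?U c) f v \<le> a v + int (fairness I)"
      by blast
    define M where "M = (\<lambda>u. {u, f u}) ` ?U"
    have ME: "M \<subseteq> ?E" using f by (auto simp: M_def nbrs_def)
    have fV: "f u \<in> ?V" if "u \<in> ?U" for u using f that by (auto simp: nbrs_def)
    have pu: "partners M u = {f u}" if u: "u \<in> ?U" for u
    proof -
      have "{u, w} = {u', f u'} \<longleftrightarrow> u = u' \<and> w = f u'" if "u' \<in> ?U" for u' w
        using fV[OF that] u disj by (auto simp: doubleton_eq_iff)
      then show ?thesis using u by (auto simp: M_def partners_def)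
    qed
    have pv: "partners M v = {u \<in> ?U. f u = v}" if v: "v \<in> ?V" for v
    proof -
      have "{v, w} = {u', f u'} \<longleftrightarrow> w = u' \<and> v = f u'" if "u' \<in> ?U" for u' w
        using fV[OF that] that v disj by (auto simp: doubleton_eq_iff)
      then show ?thesis by (auto simp: M_def partners_def)
    qed
    have "int (card (color_class ?col (partners M v) c)) = load (color_class ?col ?U c) f v" if v: "v \<in> ?V" for v c
    proof -
      have "color_class ?col (partners M v) c = {u \<in> color_class ?col ?U c. f u = v}"
        unfolding pv[OF v] by (auto simp: color_class_def)
      then show ?thesis by (simp add: load_def)
    qed
    then have "fair_matching ?V ?C ?col (fairness I) M" using a unfolding fair by auto
    moreover have "many_to_one_matching ?U ?E M" "left_perfect ?U M"
      using ME pu by (auto simp: many_to_one_matching_def left_perfect_def)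
    ultimately show "mmfm_yes I" unfolding mmfm_yes_def by blast
  qed
qed

text \<open>The inserted \<open>card (left I)\<close> bounds the unknowns even in the absence of
  colors.\<close>

definition hi_bound :: "(nat, nat) mmfm \<Rightarrow> nat set \<Rightarrow> int" where
  "hi_bound I S = Min (insert (int (card (left I)))
     ((\<lambda>c. int (card {u \<in> left I. coloring I u = c \<and> nbrs I u \<inter> S \<noteq> {}})) ` colors I))"

text \<open>The upper cut condition of a color, solved for \<open>sum a S\<close>. As no load
  exceeds \<open>card (left I)\<close>, the fairness may be capped there, which keeps the numbers
  small even if it is huge. The inserted \<open>0\<close> makes the unknowns nonnegative.\<close>

definition lo_bound :: "(nat, nat) mmfm \<Rightarrow> nat set \<Rightarrow> int" where
  "lo_bound I S = Max (insert 0
     ((\<lambda>c. int (card {u \<in> left I. coloring I u = c \<and> nbrs I u \<subseteq> S})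
        - int (min (fairness I) (card (left I))) * int (card S)) ` colors I))"

text \<open>For fixed \<open>a\<close> the cut conditions of the colors are independent of each
  other, and the assignments of the color classes glue along \<open>coloring I\<close>. Maximum and
  minimum over the colors merge all conditions on a set \<open>S\<close> into one row.\<close>

theorem yes_iff_integer_point:
  assumes I: "mmfm_instance I"
  shows "mmfm_yes I \<longleftrightarrow> (\<exists>a::nat \<Rightarrow> int. \<forall>S\<subseteq>right I. lo_bound I S \<le> sum a S \<and> sum a S \<le> hi_bound I S)"
    (is "_ \<longleftrightarrow> ?R")
proof -
  let ?U = "left I" and ?V = "right I" and ?C = "colors I" and ?col = "coloring I"
  let ?Uc = "color_class ?col ?U"
  have finU: "finite ?U" and finV: "finite ?V" and finC: "finite ?C" and colC: "?col ` ?U \<subseteq> ?C"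
    using I by (auto simp: mmfm_instance_def bipartite_graph_def)
  define l where "l = min (fairness I) (card ?U)"
  have finUc: "finite (?Uc c)" for c using finU by (simp add: color_class_def)
  have Uc_le: "card (?Uc c) \<le> card ?U" for c using finU by (intro card_mono) (auto simp: color_class_def)
  have load_le: "load (?Uc c) f v \<le> int (card ?U)" "load (?Uc c) f v \<ge> 0" for f :: "nat \<Rightarrow> nat" and v c
  proof -
    have "card {u \<in> ?Uc c. f u = v} \<le> card ?U" using finU by (intro card_mono) (auto simp: color_class_def)
    then show "load (?Uc c) f v \<le> int (card ?U)" "load (?Uc c) f v \<ge> 0" by (auto simp: load_def)
  qed
  have cut: "(\<exists>f. (\<forall>u\<in>?Uc c. f u \<in> nbrs I u) \<and> (\<forall>v\<in>?V. a v \<le> load (?Uc c) f v \<and> load (?Uc c) f v \<le> a v + int l)) \<longleftrightarrow>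
      (\<forall>S. S \<subseteq> ?V \<longrightarrow> sum a S \<le> int (card {u \<in> ?Uc c. nbrs I u \<inter> S \<noteq> {}}) \<and>
         int (card {u \<in> ?Uc c. nbrs I u \<subseteq> S}) \<le> sum (\<lambda>v. a v + int l) S)" for c a
    by (rule load_bounds_iff_cut_condition[OF finUc finV]) (auto simp: nbrs_def)
  have bounds: "(\<forall>S\<subseteq>?V. lo_bound I S \<le> sum a S \<and> sum a S \<le> hi_bound I S) \<longleftrightarrow>
     (\<forall>S\<subseteq>?V. 0 \<le> sum a S \<and> sum a S \<le> int (card ?U)) \<and>
     (\<forall>c\<in>?C. \<forall>S. S \<subseteq> ?V \<longrightarrow> sum a S \<le> int (card {u \<in> ?Uc c. nbrs I u \<inter> S \<noteq> {}}) \<and>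
         int (card {u \<in> ?Uc c. nbrs I u \<subseteq> S}) \<le> sum (\<lambda>v. a v + int l) S)" for a
  proof -
    have 1: "lo_bound I S \<le> sum a S \<longleftrightarrow> 0 \<le> sum a S \<and>
       (\<forall>c\<in>?C. int (card {u \<in> ?Uc c. nbrs I u \<subseteq> S}) \<le> sum (\<lambda>v. a v + int l) S)" for S
      using finC by (simp add: lo_bound_def sum.distrib l_def[symmetric] color_class_def conj_ac mult.commute diff_le_eq)
    have 2: "sum a S \<le> hi_bound I S \<longleftrightarrow> sum a S \<le> int (card ?U) \<and>
       (\<forall>c\<in>?C. sum a S \<le> int (card {u \<in> ?Uc c. nbrs I u \<inter> S \<noteq> {}}))" for S
      using finC by (simp add: hi_bound_def color_class_def conj_ac)
    show ?thesis unfolding 1 2 by blast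
  qed
  show ?thesis
  proof
    assume "mmfm_yes I"
    then obtain f a where f: "\<forall>u\<in>?U. f u \<in> nbrs I u" and a: "\<forall>v\<in>?V. \<forall>c\<in>?C.
       a v \<le> load (?Uc c) f v \<and> load (?Uc c) f v \<le> a v + int (fairness I)"
      unfolding yes_iff_assignment[OF I] by blast
    show ?R
    proof (cases "?C = {}")
      case True
      then show ?thesis using bounds[of "\<lambda>_. 0"] by (intro exI[of _ "\<lambda>_. 0"]) simp
    next
      case False
      \<comment> \<open>The given \<open>a\<close> may lie outside the bounds for the unknowns. The
        least loads are valid window ends too, are nonnegative, and sum to at most the size of a
        color class.\<close>
      define b where "b v = Min ((\<lambda>c. load (?Uc c) f v) ` ?C)" for v
      have b: "b v \<le> load (?Uc c) f v \<and> load (?Uc c) f v \<le> b v + int l" if v: "v \<in> ?V" and c: "c \<in> ?C" for v c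
      proof
        show "b v \<le> load (?Uc c) f v" unfolding b_def using finC c by (intro Min_le) auto
        have "b v \<in> (\<lambda>c. load (?Uc c) f v) ` ?C" unfolding b_def using finC False by (intro Min_in) auto
        then obtain c' where c': "c' \<in> ?C" "b v = load (?Uc c') f v" by blast
        moreover have "a v \<le> load (?Uc c') f v" "load (?Uc c) f v \<le> a v + int (fairness I)"
          using a v c c'(1) by blast+
        ultimately have "load (?Uc c) f v \<le> b v + int (fairness I)" by linarith
        moreover have "load (?Uc c) f v \<le> b v + int (card ?U)" using load_le[of c f v] load_le[of c' f v] c' by linarith
        ultimately show "load (?Uc c) f v \<le> b v + int l" by (simp add: l_def)
      qed
      have cuts: "\<forall>c\<in>?C. \<forall>S. S \<subseteq> ?V \<longrightarrow> sum b S \<le> int (card {u \<in> ?Uc c. nbrs I u \<inter> S \<noteq> {}}) \<and>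
         int (card {u \<in> ?Uc c. nbrs I u \<subseteq> S}) \<le> sum (\<lambda>v. b v + int l) S"
        using f b by (intro ballI iffD1[OF cut] exI[of _ f]) (auto simp: color_class_def)
      moreover have "\<forall>S\<subseteq>?V. 0 \<le> sum b S \<and> sum b S \<le> int (card ?U)"
      proof (intro allI impI conjI)
        fix S assume S: "S \<subseteq> ?V"
        have "0 \<le> b v" for v
          unfolding b_def using finC False load_le(2) by (intro Min.boundedI) auto
        then show "0 \<le> sum b S" by (intro sum_nonneg)
        obtain c where c: "c \<in> ?C" using False by blast
        have "sum b S \<le> int (card {u \<in> ?Uc c. nbrs I u \<inter> S \<noteq> {}})" using cuts c S by blast
        also have "\<dots> \<le> int (card (?Uc c))" using finUc by (intro of_nat_mono card_mono) auto
        finally show "sum b S \<le> int (card ?U)" using Uc_le[of c] by linarith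
      qed
      ultimately show ?thesis by (intro exI[of _ b] bounds[THEN iffD2] conjI)
    qed
  next
    assume ?R
    then obtain a where a: "\<forall>S\<subseteq>?V. lo_bound I S \<le> sum a S \<and> sum a S \<le> hi_bound I S" by blast
    have "\<forall>c\<in>?C. \<exists>f. (\<forall>u\<in>?Uc c. f u \<in> nbrs I u) \<and>
        (\<forall>v\<in>?V. a v \<le> load (?Uc c) f v \<and> load (?Uc c) f v \<le> a v + int l)"
      unfolding cut by (rule conjunct2[OF iffD1[OF bounds a]])
    from bchoice[OF this] obtain f where f: "\<And>c u. c \<in> ?C \<Longrightarrow> u \<in> ?Uc c \<Longrightarrow> f c u \<in> nbrs I u"
      "\<And>c v. c \<in> ?C \<Longrightarrow> v \<in> ?V \<Longrightarrow> a v \<le> load (?Uc c) (f c) v \<and> load (?Uc c) (f c) v \<le> a v + int l"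
      by blast
    define g where "g u = f (?col u) u" for u
    have eq: "load (?Uc c) g v = load (?Uc c) (f c) v" for c v
      unfolding load_def g_def color_class_def by (rule arg_cong[where f = "\<lambda>X. int (card X)"]) auto
    have "int l \<le> int (fairness I)" by (simp add: l_def)
    then have "a v \<le> load (?Uc c) g v \<and> load (?Uc c) g v \<le> a v + int (fairness I)"
      if "v \<in> ?V" "c \<in> ?C" for v c
      using f(2)[OF that(2,1)] unfolding eq by linarith
    moreover have "g u \<in> nbrs I u" if "u \<in> ?U" for u
      using f(1)[of "?col u" u] colC that by (auto simp: g_def color_class_def)
    ultimately show "mmfm_yes I" unfolding yes_iff_assignment[OF I]
      by (intro exI[of _ g] exI[of _ a] conjI ballI) blast+
  qed
qed

section \<open>Costs of programs\<close>

fun esize :: "expr \<Rightarrow> nat" where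
  "esize (Const i) = 1"
| "esize (Var n) = 1"
| "esize (Bind e f) = 1 + esize e + esize f"
| "esize (MkNode e f) = 1 + esize e + esize f"
| "esize (LeftOf e) = 1 + esize e"
| "esize (RightOf e) = 1 + esize e"
| "esize (IsNode e) = 1 + esize e"
| "esize (Arith a e f) = 1 + esize e + esize f"
| "esize (Cond e f g) = 1 + esize e + esize f + esize g"
| "esize (Call n es) = 1 + sum_list (map esize es)"

text \<open>\<open>ceval Z P env e n a\<close>: evaluation with at most \<open>n\<close> calls in which all operands of arithmetic
  operations have size at most \<open>Z\<close>. The time is bounded by the number of calls up to a factor
  that depends only on the program and \<open>Z\<close>.\<close>

inductive ceval :: "nat \<Rightarrow> prog \<Rightarrow> val list \<Rightarrow> expr \<Rightarrow> nat \<Rightarrow> val \<Rightarrow> bool"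
  and cevals :: "nat \<Rightarrow> prog \<Rightarrow> val list \<Rightarrow> expr list \<Rightarrow> nat \<Rightarrow> val list \<Rightarrow> bool"
  for Z :: nat and P :: prog where
  ceval_Const: "ceval Z P env (Const i) 0 (Num i)"
| ceval_Var: "n < length env \<Longrightarrow> ceval Z P env (Var n) 0 (env ! n)"
| ceval_Bind: "ceval Z P env e s a \<Longrightarrow> ceval Z P (a # env) f t b \<Longrightarrow> ceval Z P env (Bind e f) (s + t) b"
| ceval_MkNode: "ceval Z P env e s a \<Longrightarrow> ceval Z P env f t b \<Longrightarrow>
    ceval Z P env (MkNode e f) (s + t) (Node a b)"
| ceval_LeftOf: "ceval Z P env e t (Node a b) \<Longrightarrow> ceval Z P env (LeftOf e) t a"
| ceval_RightOf: "ceval Z P env e t (Node a b) \<Longrightarrow> ceval Z P env (RightOf e) t b"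
| ceval_IsNode_Num: "ceval Z P env e t (Num i) \<Longrightarrow> ceval Z P env (IsNode e) t (Num 0)"
| ceval_IsNode_Node: "ceval Z P env e t (Node a b) \<Longrightarrow> ceval Z P env (IsNode e) t (Num 1)"
| ceval_Arith: "ceval Z P env e s (Num i) \<Longrightarrow> ceval Z P env f t (Num j) \<Longrightarrow>
    val_size (Num i) \<le> Z \<Longrightarrow> val_size (Num j) \<le> Z \<Longrightarrow>
    ceval Z P env (Arith a e f) (s + t) (Num (arith_result a i j))"
| ceval_Cond_true: "ceval Z P env e s (Num i) \<Longrightarrow> i \<noteq> 0 \<Longrightarrow> ceval Z P env f t a \<Longrightarrow>
    ceval Z P env (Cond e f g) (s + t) a"
| ceval_Cond_false: "ceval Z P env e s (Num 0) \<Longrightarrow> ceval Z P env g t a \<Longrightarrow>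
    ceval Z P env (Cond e f g) (s + t) a"
| ceval_Call: "cevals Z P env es s as \<Longrightarrow> n < length P \<Longrightarrow> ceval Z P as (P ! n) t a \<Longrightarrow>
    ceval Z P env (Call n es) (s + t + 1) a"
| cevals_Nil: "cevals Z P env [] 0 []"
| cevals_Cons: "ceval Z P env e s a \<Longrightarrow> cevals Z P env es t as \<Longrightarrow>
    cevals Z P env (e # es) (s + t) (a # as)"

text \<open>Within one function body each node is evaluated at most once, at cost at most
  \<open>2 * Z + 1\<close>; a call opens one more body, of size at most \<open>M\<close>.\<close>

lemma ceval_time:
  assumes "\<And>n. n < length P \<Longrightarrow> esize (P ! n) \<le> M"
  shows "ceval Z P env e n a \<Longrightarrow> \<exists>t. eval P env e t a \<and> t \<le> (esize e + n * M) * (2 * Z + 1)"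
    and "cevals Z P env es n as \<Longrightarrow>
      \<exists>t. evals P env es t as \<and> t \<le> (sum_list (map esize es) + n * M) * (2 * Z + 1)"
proof (induction rule: ceval_cevals.inducts)
  case (ceval_Const env i)
  show ?case by (rule exI, rule conjI, rule eval_Const) simp
next
  case (ceval_Var n env)
  show ?case by (rule exI, rule conjI, rule eval_Var[OF ceval_Var]) simp
next
  case (ceval_Bind env e s a f t b)
  then obtain t1 t2 where t: "eval P env e t1 a" "t1 \<le> (esize e + s * M) * (2 * Z + 1)"
    "eval P (a # env) f t2 b" "t2 \<le> (esize f + t * M) * (2 * Z + 1)" by blast
  show ?case by (rule exI, rule conjI, rule eval_Bind[OF t(1,3)]) (use t in \<open>simp add: algebra_simps\<close>)
next
  case (ceval_MkNode env e s a f t b)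
  then obtain t1 t2 where t: "eval P env e t1 a" "t1 \<le> (esize e + s * M) * (2 * Z + 1)"
    "eval P env f t2 b" "t2 \<le> (esize f + t * M) * (2 * Z + 1)" by blast
  show ?case by (rule exI, rule conjI, rule eval_MkNode[OF t(1,3)]) (use t in \<open>simp add: algebra_simps\<close>)
next
  case (ceval_LeftOf env e t a b)
  then obtain t1 where t: "eval P env e t1 (Node a b)" "t1 \<le> (esize e + t * M) * (2 * Z + 1)" by blast
  show ?case by (rule exI, rule conjI, rule eval_LeftOf[OF t(1)]) (use t in \<open>simp add: algebra_simps\<close>)
next
  case (ceval_RightOf env e t a b)
  then obtain t1 where t: "eval P env e t1 (Node a b)" "t1 \<le> (esize e + t * M) * (2 * Z + 1)" by blast
  show ?case by (rule exI, rule conjI, rule eval_RightOf[OF t(1)]) (use t in \<open>simp add: algebra_simps\<close>)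
next
  case (ceval_IsNode_Num env e t i)
  then obtain t1 where t: "eval P env e t1 (Num i)" "t1 \<le> (esize e + t * M) * (2 * Z + 1)" by blast
  show ?case by (rule exI, rule conjI, rule eval_IsNode_Num[OF t(1)]) (use t in \<open>simp add: algebra_simps\<close>)
next
  case (ceval_IsNode_Node env e t a b)
  then obtain t1 where t: "eval P env e t1 (Node a b)" "t1 \<le> (esize e + t * M) * (2 * Z + 1)" by blast
  show ?case by (rule exI, rule conjI, rule eval_IsNode_Node[OF t(1)]) (use t in \<open>simp add: algebra_simps\<close>)
next
  case (ceval_Arith env e s i f t j a)
  then obtain t1 t2 where t: "eval P env e t1 (Num i)" "t1 \<le> (esize e + s * M) * (2 * Z + 1)"
    "eval P env f t2 (Num j)" "t2 \<le> (esize f + t * M) * (2 * Z + 1)" by blast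
  have sz: "val_size (Num i) \<le> Z" "val_size (Num j) \<le> Z" using ceval_Arith by blast+
  show ?case by (rule exI, rule conjI, rule eval_Arith[OF t(1,3)])
      (use t(2,4) sz in \<open>simp add: algebra_simps\<close>)
next
  case (ceval_Cond_true env e s i f t a g)
  then obtain t1 t2 where t: "eval P env e t1 (Num i)" "t1 \<le> (esize e + s * M) * (2 * Z + 1)"
    "eval P env f t2 a" "t2 \<le> (esize f + t * M) * (2 * Z + 1)" by blast
  show ?case by (rule exI, rule conjI, rule eval_Cond_true[OF t(1) \<open>i \<noteq> 0\<close> t(3)]) (use t in \<open>simp add: algebra_simps\<close>)
next
  case (ceval_Cond_false env e s g t a f)
  then obtain t1 t2 where t: "eval P env e t1 (Num 0)" "t1 \<le> (esize e + s * M) * (2 * Z + 1)"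
    "eval P env g t2 a" "t2 \<le> (esize g + t * M) * (2 * Z + 1)" by blast
  show ?case by (rule exI, rule conjI, rule eval_Cond_false[OF t(1,3)]) (use t in \<open>simp add: algebra_simps\<close>)
next
  case (ceval_Call env es s as n t a)
  then obtain t1 t2 where t: "evals P env es t1 as" "t1 \<le> (sum_list (map esize es) + s * M) * (2 * Z + 1)"
    "eval P as (P ! n) t2 a" "t2 \<le> (esize (P ! n) + t * M) * (2 * Z + 1)" by blast
  have "t2 \<le> (M + t * M) * (2 * Z + 1)"
    using t(4) assms[OF \<open>n < length P\<close>] by (meson add_le_mono1 le_trans mult_le_mono1)
  then have "1 + t1 + t2 \<le> (esize (Call n es) + (s + t + 1) * M) * (2 * Z + 1)"
    using t(2) by (simp add: algebra_simps)
  then show ?case using eval_Call[OF t(1) \<open>n < length P\<close> t(3)] by blast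
next
  case (cevals_Nil env)
  show ?case by (rule exI, rule conjI, rule evals_Nil) simp
next
  case (cevals_Cons env e s a es t as)
  then obtain t1 t2 where t: "eval P env e t1 a" "t1 \<le> (esize e + s * M) * (2 * Z + 1)"
    "evals P env es t2 as" "t2 \<le> (sum_list (map esize es) + t * M) * (2 * Z + 1)" by blast
  show ?case by (rule exI, rule conjI, rule evals_Cons[OF t(1,3)]) (use t in \<open>simp add: algebra_simps\<close>)
qed

text \<open>A functional form of \<open>ceval\<close>: what is proved about one routine becomes a
  rewrite rule for calls to it.\<close>

definition outcome :: "nat \<Rightarrow> prog \<Rightarrow> nat \<Rightarrow> val list \<Rightarrow> (nat \<times> val) option" where
  "outcome Z P k as = (if k < length P \<and> (\<exists>n a. ceval Z P as (P ! k) n a)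
     then Some (LEAST n. \<exists>a. ceval Z P as (P ! k) n a, THE a. \<exists>n. ceval Z P as (P ! k) n a) else None)"

text \<open>A weakest precondition that recurses on the expression but does not enter calls, for
  which it consults \<open>outcome\<close>. It can therefore be evaluated by simplification even for
  recursive routines.\<close>

fun wp :: "nat \<Rightarrow> prog \<Rightarrow> val list \<Rightarrow> expr \<Rightarrow> (nat \<Rightarrow> val \<Rightarrow> bool) \<Rightarrow> bool"
  and wps :: "nat \<Rightarrow> prog \<Rightarrow> val list \<Rightarrow> expr list \<Rightarrow> (nat \<Rightarrow> val list \<Rightarrow> bool) \<Rightarrow> bool" where
  "wp Z P env (Const i) Q = Q 0 (Num i)"
| "wp Z P env (Var n) Q = (n < length env \<and> Q 0 (env ! n))"
| "wp Z P env (Bind e f) Q = wp Z P env e (\<lambda>s a. wp Z P (a # env) f (\<lambda>t. Q (s + t)))"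
| "wp Z P env (MkNode e f) Q = wp Z P env e (\<lambda>s a. wp Z P env f (\<lambda>t b. Q (s + t) (Node a b)))"
| "wp Z P env (LeftOf e) Q = wp Z P env e (\<lambda>s a. case a of Node x y \<Rightarrow> Q s x | _ \<Rightarrow> False)"
| "wp Z P env (RightOf e) Q = wp Z P env e (\<lambda>s a. case a of Node x y \<Rightarrow> Q s y | _ \<Rightarrow> False)"
| "wp Z P env (IsNode e) Q = wp Z P env e (\<lambda>s a. case a of Node x y \<Rightarrow> Q s (Num 1) | _ \<Rightarrow> Q s (Num 0))"
| "wp Z P env (Arith ar e f) Q = wp Z P env e (\<lambda>s a. wp Z P env f (\<lambda>t b.
     case a of Num i \<Rightarrow> (case b of Num j \<Rightarrow> val_size (Num i) \<le> Z \<and> val_size (Num j) \<le> Z \<and>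
       Q (s + t) (Num (arith_result ar i j)) | _ \<Rightarrow> False) | _ \<Rightarrow> False))"
| "wp Z P env (Cond e f g) Q = wp Z P env e (\<lambda>s a. case a of
     Num i \<Rightarrow> if i \<noteq> 0 then wp Z P env f (\<lambda>t. Q (s + t)) else wp Z P env g (\<lambda>t. Q (s + t)) | _ \<Rightarrow> False)"
| "wp Z P env (Call n es) Q = wps Z P env es (\<lambda>s as.
     case outcome Z P n as of None \<Rightarrow> False | Some (t, a) \<Rightarrow> Q (s + t + 1) a)"
| "wps Z P env [] Q = Q 0 []"
| "wps Z P env (e # es) Q = wp Z P env e (\<lambda>s a. wps Z P env es (\<lambda>t as. Q (s + t) (a # as)))"

lemma ceval_value_unique:
  assumes "ceval Z P env e n a" "ceval Z P env e m b"
  shows "a = b"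
proof -
  define M where "M = Max (insert 0 (set (map esize P)))"
  have "esize (P ! n) \<le> M" if "n < length P" for n
    unfolding M_def using that by (intro Max_ge) auto
  from ceval_time(1)[OF this assms(1)] ceval_time(1)[OF this assms(2)]
  show ?thesis using eval_deterministic(1) by blast
qed

lemma outcome_SomeD:
  assumes "outcome Z P k as = Some (n, a)"
  shows "k < length P \<and> ceval Z P as (P ! k) n a"
proof -
  have k: "k < length P" and ex: "\<exists>n a. ceval Z P as (P ! k) n a"
    and n: "n = (LEAST n. \<exists>a. ceval Z P as (P ! k) n a)"
    and a: "a = (THE a. \<exists>n. ceval Z P as (P ! k) n a)"
    using assms by (auto simp: outcome_def split: if_splits)
  from LeastI_ex[OF ex] obtain b where b: "ceval Z P as (P ! k) n b" unfolding n by blast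
  have "a = b" unfolding a using b ceval_value_unique by blast
  then show ?thesis using k b by simp
qed

lemma wp_sound:
  "wp Z P env e Q \<Longrightarrow> \<exists>n a. ceval Z P env e n a \<and> Q n a"
  "wps Z P env es Q' \<Longrightarrow> \<exists>n as. cevals Z P env es n as \<and> Q' n as"
proof (induction Z P env e Q and Z P env es Q' rule: wp_wps.induct)
  case (1 Z P env i Q)
  then show ?case using ceval_Const by fastforce
next
  case (2 Z P env n Q)
  then show ?case using ceval_Var[of n env Z P] by auto
next
  case (3 Z P env e f Q)
  obtain s a where s: "ceval Z P env e s a" "wp Z P (a # env) f (\<lambda>t. Q (s + t))"
    using 3(2)[OF 3(3)[unfolded wp.simps]] by blast
  from 3(1)[OF s(2)] s(1) show ?case using ceval_Bind by blast
next
  case (4 Z P env e f Q)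
  obtain s a where s: "ceval Z P env e s a" "wp Z P env f (\<lambda>t b. Q (s + t) (Node a b))"
    using 4(2)[OF 4(3)[unfolded wp.simps]] by blast
  from 4(1)[OF s(2)] s(1) show ?case using ceval_MkNode by blast
next
  case (5 Z P env e Q)
  obtain s a where s: "ceval Z P env e s a" "case a of Node x y \<Rightarrow> Q s x | _ \<Rightarrow> False"
    using 5(1)[OF 5(2)[unfolded wp.simps]] by blast
  then obtain x y where "a = Node x y" "Q s x" by (cases a) auto
  then show ?case using s(1) ceval_LeftOf by blast
next
  case (6 Z P env e Q)
  obtain s a where s: "ceval Z P env e s a" "case a of Node x y \<Rightarrow> Q s y | _ \<Rightarrow> False"
    using 6(1)[OF 6(2)[unfolded wp.simps]] by blast
  then obtain x y where "a = Node x y" "Q s y" by (cases a) auto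
  then show ?case using s(1) ceval_RightOf by blast
next
  case (7 Z P env e Q)
  obtain s a where s: "ceval Z P env e s a" "case a of Node x y \<Rightarrow> Q s (Num 1) | _ \<Rightarrow> Q s (Num 0)"
    using 7(1)[OF 7(2)[unfolded wp.simps]] by blast
  then show ?case using ceval_IsNode_Num ceval_IsNode_Node by (cases a) (simp_all, blast+)
next
  case (8 Z P env ar e f Q)
  obtain s a where s: "ceval Z P env e s a" "wp Z P env f (\<lambda>t b.
     case a of Num i \<Rightarrow> (case b of Num j \<Rightarrow> val_size (Num i) \<le> Z \<and> val_size (Num j) \<le> Z \<and>
       Q (s + t) (Num (arith_result ar i j)) | _ \<Rightarrow> False) | _ \<Rightarrow> False)"
    using 8(2)[OF 8(3)[unfolded wp.simps]] by blast
  obtain t b where t: "ceval Z P env f t b" "case a of Num i \<Rightarrow> (case b of Num j \<Rightarrow>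
       val_size (Num i) \<le> Z \<and> val_size (Num j) \<le> Z \<and> Q (s + t) (Num (arith_result ar i j)) | _ \<Rightarrow> False) | _ \<Rightarrow> False"
    using 8(1)[OF s(2)] by blast
  obtain i j where "a = Num i" "b = Num j" using t(2) by (auto split: val.splits)
  then show ?case using s(1) t ceval_Arith[of Z P env e s i f t j ar] by (simp, blast)
next
  case (9 Z P env e f g Q)
  obtain s a where s: "ceval Z P env e s a" "case a of
     Num i \<Rightarrow> if i \<noteq> 0 then wp Z P env f (\<lambda>t. Q (s + t)) else wp Z P env g (\<lambda>t. Q (s + t)) | _ \<Rightarrow> False"
    using 9(3)[OF 9(4)[unfolded wp.simps]] by blast
  then obtain i where i: "a = Num i" by (cases a) auto
  show ?case
  proof (cases "i = 0")
    case True
    then have "wp Z P env g (\<lambda>t. Q (s + t))" using s(2) i by simp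
    then obtain n b where "ceval Z P env g n b" "Q (s + n) b" using 9(2)[of i s] True by blast
    then show ?thesis using ceval_Cond_false True s(1) i by blast
  next
    case False
    then have "wp Z P env f (\<lambda>t. Q (s + t))" using s(2) i by simp
    then obtain n b where "ceval Z P env f n b" "Q (s + n) b" using 9(1)[of i s] False by blast
    then show ?thesis using ceval_Cond_true False s(1) i by blast
  qed
next
  case (10 Z P env n es Q)
  obtain s as where s: "cevals Z P env es s as"
    "case outcome Z P n as of None \<Rightarrow> False | Some (t, a) \<Rightarrow> Q (s + t + 1) a"
    using 10(1)[OF 10(2)[unfolded wp.simps]] by blast
  then obtain t a where "outcome Z P n as = Some (t, a)" "Q (s + t + 1) a"
    by (auto split: option.splits)
  then show ?case using s(1) outcome_SomeD ceval_Call by blast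
next
  case (11 Z P env Q)
  then show ?case using cevals_Nil by fastforce
next
  case (12 Z P env e es Q)
  obtain s a where s: "ceval Z P env e s a" "wps Z P env es (\<lambda>t as. Q (s + t) (a # as))"
    using 12(2)[OF 12(3)[unfolded wps.simps]] by blast
  from 12(1)[OF s(2)] s(1) show ?case using cevals_Cons by blast
qed

text \<open>The proof rule for all routines below: by induction on the data, the recursive calls are
  already known through \<open>outcome\<close>.\<close>

lemma outcome_le:
  assumes "wp Z P as (P ! k) (\<lambda>n b. n \<le> T \<and> b = a)" "k < length P"
  shows "\<exists>n\<le>T. outcome Z P k as = Some (n, a)"
proof -
  obtain n where n: "ceval Z P as (P ! k) n a" "n \<le> T" using wp_sound(1)[OF assms(1)] by blast
  have "(LEAST n. \<exists>a. ceval Z P as (P ! k) n a) \<le> n"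
    by (rule Least_le) (use n in blast)
  then have "(LEAST n. \<exists>a. ceval Z P as (P ! k) n a) \<le> T" using n(2) by simp
  moreover have "(THE a. \<exists>n. ceval Z P as (P ! k) n a) = a"
    using n(1) ceval_value_unique by blast
  ultimately show ?thesis using n(1) assms(2) by (auto simp: outcome_def)
qed

lemma runs_if_outcome:
  assumes "\<And>n. n < length P \<Longrightarrow> esize (P ! n) \<le> M" "outcome Z P 0 [x] = Some (n, a)" "n \<le> T"
  shows "\<exists>t. runs P x t a \<and> t \<le> 2 + (M + T * M) * (2 * Z + 1)"
proof -
  have n: "0 < length P" "ceval Z P [x] (P ! 0) n a" using outcome_SomeD[OF assms(2)] by auto
  from ceval_time(1)[OF assms(1) n(2)] obtain t where
    t: "eval P [x] (P ! 0) t a" "t \<le> (esize (P ! 0) + n * M) * (2 * Z + 1)" by blast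
  have "evals P [x] [Var 0] (1 + 0) [x]"
    using eval_evals.intros(2)[of 0 "[x]" P] by (intro eval_evals.intros) auto
  then have "eval P [x] (Call 0 [Var 0]) (1 + (1 + 0) + t) a"
    using n(1) t(1) by (rule eval_Call)
  moreover have "(esize (P ! 0) + n * M) * (2 * Z + 1) \<le> (M + T * M) * (2 * Z + 1)"
    using assms(1)[OF n(1)] assms(3) by (intro mult_right_mono add_mono) auto
  ultimately show ?thesis unfolding runs_def using t(2) by fastforce
qed

lemma val_of_list_simps [simp]:
  "val_of_list f [] = Num 0" "val_of_list f (x # xs) = Node (f x) (val_of_list f xs)"
  by (simp_all add: val_of_list_def)

text \<open>Bit length is generously replaced by absolute value. This is harmless, since the numbers
  that the search computes are themselves polynomial up to a factor k^O(k).\<close>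

lemma val_size_Num_le: "\<bar>i\<bar> < int Z \<Longrightarrow> val_size (Num i) \<le> Z"
proof -
  assume i: "\<bar>i\<bar> < int Z"
  have "floorlog 2 (nat \<bar>i\<bar>) \<le> nat \<bar>i\<bar>"
    by (rule floorlog_leI) (auto simp: less_exp)
  then show ?thesis using i by simp
qed

section \<open>The program\<close>

abbreviation "leq \<equiv> Arith Leq"
abbreviation "plus_e \<equiv> Arith Plus"
abbreviation "minus_e \<equiv> Arith Minus"
abbreviation "times_e \<equiv> Arith Times"
text \<open>\<open>Leq\<close> is the only comparison of the language.\<close>

abbreviation "eq_e e f \<equiv> Arith Times (Arith Leq e f) (Arith Leq f e)"
abbreviation "snd_e e \<equiv> LeftOf (RightOf e)"

text \<open>A called number is the position in \<open>program\<close>; the comments name the arguments in order.\<close>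

definition dot_body :: expr where \<comment> \<open>row, vector\<close>
  "dot_body = Cond (IsNode (Var 0))
     (plus_e (times_e (LeftOf (Var 0)) (LeftOf (Var 1))) (Call 1 [RightOf (Var 0), RightOf (Var 1)]))
     (Const 0)"

definition axpy_body :: expr where \<comment> \<open>factor, row, vector\<close>
  "axpy_body = Cond (IsNode (Var 1))
     (MkNode (plus_e (LeftOf (Var 2)) (times_e (Var 0) (LeftOf (Var 1))))
        (Call 2 [Var 0, RightOf (Var 1), RightOf (Var 2)]))
     (Const 0)"

definition correct_body :: expr where \<comment> \<open>constraints, vector, scale, slack\<close>
  "correct_body = Cond (IsNode (Var 0))
     (Bind (Call 1 [LeftOf (LeftOf (Var 0)), Var 1])
       (Cond (leq (Var 0) (plus_e (times_e (Var 3) (RightOf (RightOf (LeftOf (Var 1))))) (Var 4)))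
         (Cond (leq (minus_e (times_e (Var 3) (LeftOf (RightOf (LeftOf (Var 1))))) (Var 4)) (Var 0))
           (Call 3 [RightOf (Var 1), Var 2, Var 3, Var 4])
           (MkNode (Const 0) (Call 2 [Const 1, LeftOf (LeftOf (Var 1)), Var 2])))
         (MkNode (Const 0) (Call 2 [Const (- 1), LeftOf (LeftOf (Var 1)), Var 2]))))
     (Const 0)"

definition perceptron_body :: expr where \<comment> \<open>fuel, constraints, vector, scale, slack\<close>
  "perceptron_body = Bind (Call 3 [Var 1, Var 2, Var 3, Var 4])
     (Cond (IsNode (Var 0))
       (Cond (leq (Var 1) (Const 0)) (Const 0)
         (Call 4 [minus_e (Var 1) (Const 1), Var 2, RightOf (Var 0), Var 4, Var 5]))
       (Const 1))"

text \<open>The parameters are passed as one tree: scale, slack, fuel, initial vector, range, threshold.\<close>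

abbreviation "feasible_e L p \<equiv>
  Call 4 [snd_e (RightOf p), L, snd_e (RightOf (RightOf p)), LeftOf p, snd_e p]"
abbreviation "range_e p \<equiv> snd_e (RightOf (RightOf (RightOf p)))"
abbreviation "threshold_e p \<equiv> RightOf (RightOf (RightOf (RightOf (RightOf p))))"

definition values_body :: expr where \<comment> \<open>first value, number of values, row, constraints, parameters\<close>
  "values_body = Cond (leq (Var 1) (Const 0)) (Const 0)
     (Bind (Call 5 [plus_e (Var 0) (Const 1), minus_e (Var 1) (Const 1), Var 2, Var 3, Var 4])
       (Cond (feasible_e (MkNode (MkNode (Var 3) (MkNode (Var 1) (Var 1))) (Var 4)) (Var 5))
         (MkNode (Var 1) (Var 0)) (Var 0)))"

definition length_body :: expr where
  "length_body = Cond (IsNode (Var 0)) (plus_e (Const 1) (Call 6 [RightOf (Var 0)])) (Const 0)"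

definition append_body :: expr where
  "append_body = Cond (IsNode (Var 0))
     (MkNode (LeftOf (Var 0)) (Call 7 [RightOf (Var 0), Var 1])) (Var 1)"

definition solve_body :: expr where \<comment> \<open>constraints, skipped rows, remaining rows, parameters\<close>
  "solve_body = Cond (IsNode (Var 2))
     (Bind (Call 5 [minus_e (Const 0) (range_e (Var 3)),
         plus_e (times_e (Const 2) (range_e (Var 3))) (Const 1), LeftOf (Var 2), Var 0, Var 3])
       (Cond (leq (Call 6 [Var 0]) (threshold_e (Var 4)))
         (Call 9 [Var 0, LeftOf (Var 3), Var 1, Call 7 [Var 2, RightOf (Var 3)], Var 4])
         (Call 8 [Var 1, MkNode (LeftOf (Var 3)) (Var 2), RightOf (Var 3), Var 4])))
     (feasible_e (Var 0) (Var 3))"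

definition branch_body :: expr where \<comment> \<open>values, row, constraints, remaining rows, parameters\<close>
  "branch_body = Cond (IsNode (Var 0))
     (Cond (Call 8 [MkNode (MkNode (Var 1) (MkNode (LeftOf (Var 0)) (LeftOf (Var 0)))) (Var 2),
         Const 0, Var 3, Var 4])
       (Const 1)
       (Call 9 [RightOf (Var 0), Var 1, Var 2, Var 3, Var 4]))
     (Const 0)"

definition cons_all_body :: expr where \<comment> \<open>entry, vectors, vectors to be appended\<close>
  "cons_all_body = Cond (IsNode (Var 1))
     (MkNode (MkNode (Var 0) (LeftOf (Var 1))) (Call 10 [Var 0, RightOf (Var 1), Var 2])) (Var 2)"

definition cons_range_body :: expr where \<comment> \<open>first entry, number of entries, vectors\<close>
  "cons_range_body = Cond (leq (Var 1) (Const 0)) (Const 0)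
     (Call 10 [Var 0, Var 2, Call 11 [plus_e (Var 0) (Const 1), minus_e (Var 1) (Const 1), Var 2]])"

definition vectors_body :: expr where \<comment> \<open>list giving the length, first entry, number of entries\<close>
  "vectors_body = Cond (IsNode (Var 0))
     (Call 11 [Var 1, Var 2, Call 12 [RightOf (Var 0), Var 1, Var 2]])
     (MkNode (Const 0) (Const 0))"

definition power_body :: expr where \<comment> \<open>base, list giving the exponent\<close>
  "power_body = Cond (IsNode (Var 1)) (times_e (Var 0) (Call 13 [Var 0, RightOf (Var 1)])) (Const 1)"

definition edge_body :: expr where \<comment> \<open>left vertex, right vertex, edges\<close>
  "edge_body = Cond (IsNode (Var 2))
     (Cond (times_e (eq_e (LeftOf (LeftOf (Var 2))) (Var 0)) (eq_e (RightOf (LeftOf (Var 2))) (Var 1)))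
       (Const 1) (Call 14 [Var 0, Var 1, RightOf (Var 2)]))
     (Const 0)"

definition touch_body :: expr where \<comment> \<open>left vertex, right vertices, row, edges, entry\<close>
  "touch_body = Cond (IsNode (Var 1))
     (Cond (times_e (eq_e (LeftOf (Var 2)) (Var 4)) (Call 14 [Var 0, LeftOf (Var 1), Var 3]))
       (Const 1) (Call 15 [Var 0, RightOf (Var 1), RightOf (Var 2), Var 3, Var 4]))
     (Const 0)"

definition count_body :: expr where
  \<comment> \<open>colored left vertices, color, right vertices, row, edges, entry, result of touch\<close>
  "count_body = Cond (IsNode (Var 0))
     (plus_e (times_e (eq_e (RightOf (LeftOf (Var 0))) (Var 1))
         (Bind (Call 15 [LeftOf (LeftOf (Var 0)), Var 2, Var 3, Var 4, Var 5]) (eq_e (Var 0) (Var 7))))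
       (Call 16 [RightOf (Var 0), Var 1, Var 2, Var 3, Var 4, Var 5, Var 6]))
     (Const 0)"

definition hi_body :: expr where
  \<comment> \<open>colors, colored left vertices, right vertices, row, edges, number of left vertices\<close>
  "hi_body = Cond (IsNode (Var 0))
     (Bind (Call 16 [Var 1, LeftOf (Var 0), Var 2, Var 3, Var 4, Const 1, Const 1])
       (Bind (Call 17 [RightOf (Var 1), Var 2, Var 3, Var 4, Var 5, Var 6])
         (Cond (leq (Var 0) (Var 1)) (Var 0) (Var 1))))
     (Var 5)"

definition lo_body :: expr where
  \<comment> \<open>colors, colored left vertices, right vertices, row, edges, allowance\<close>
  "lo_body = Cond (IsNode (Var 0))
     (Bind (minus_e (Call 16 [Var 1, LeftOf (Var 0), Var 2, Var 3, Var 4, Const 0, Const 0]) (Var 5))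
       (Bind (Call 18 [RightOf (Var 1), Var 2, Var 3, Var 4, Var 5, Var 6])
         (Cond (leq (Var 0) (Var 1)) (Var 1) (Var 0))))
     (Const 0)"

definition rows_body :: expr where
  \<comment> \<open>rows, colored left vertices, right vertices, edges, colors, fairness, number of left vertices\<close>
  "rows_body = Cond (IsNode (Var 0))
     (MkNode
       (MkNode (LeftOf (Var 0))
         (MkNode (Call 18 [Var 4, Var 1, Var 2, LeftOf (Var 0), Var 3,
                    times_e (Var 5) (Call 1 [LeftOf (Var 0), LeftOf (Var 0)])])
                 (Call 17 [Var 4, Var 1, Var 2, LeftOf (Var 0), Var 3, Var 6])))
       (Call 19 [RightOf (Var 0), Var 1, Var 2, Var 3, Var 4, Var 5, Var 6]))
     (Const 0)"

definition zeros_body :: expr where \<comment> \<open>list giving the length\<close>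
  "zeros_body = Cond (IsNode (Var 0)) (MkNode (Const 0) (Call 20 [RightOf (Var 0)])) (Const 0)"

text \<open>The setup is split into three calls, each of which passes the numbers just computed as
  arguments to the next.\<close>

definition main_body :: expr where
  "main_body = Call 21 [LeftOf (Var 0), snd_e (Var 0), snd_e (RightOf (Var 0)),
     snd_e (RightOf (RightOf (Var 0))), RightOf (RightOf (RightOf (RightOf (Var 0)))),
     Call 6 [LeftOf (Var 0)], plus_e (Call 6 [snd_e (Var 0)]) (Const 1)]"

definition prepare_body :: expr where
  \<comment> \<open>colored left vertices, right vertices, edges, colors, fairness, number of left vertices,
    number of right vertices plus one\<close>
  "prepare_body = Call 22 [Var 0, Var 1, Var 2, Var 3, Cond (leq (Var 4) (Var 5)) (Var 4) (Var 5), Var 5, Var 6,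
     times_e (Const 32) (times_e (times_e (times_e (Var 6) (Var 6)) (times_e (Var 6) (Var 6)))
       (Call 13 [times_e (Const 2) (times_e (Var 6) (Var 6)), Var 1]))]"

definition start_body :: expr where \<comment> \<open>as before, with the scale as last argument\<close>
  "start_body = Call 8 [Call 19 [Call 12 [Var 1, Const 0, Const 2], Var 0, Var 1, Var 2, Var 3, Var 4, Var 5],
     Const 0,
     Call 12 [Var 1, minus_e (Const 0) (Var 6), plus_e (times_e (Const 2) (Var 6)) (Const 1)],
     MkNode (Var 7)
       (MkNode (times_e (Var 6) (times_e (Var 6) (Var 6)))
       (MkNode (times_e (Var 6) (times_e (times_e (Var 7) (Var 7)) (times_e (Var 5) (Var 5))))
       (MkNode (Call 20 [Var 1])
       (MkNode (times_e (times_e (Var 6) (Var 6)) (Var 5))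
         (times_e (Const 4096) (times_e (times_e (Var 6) (times_e (Var 6) (Var 6)))
            (times_e (Var 6) (times_e (Var 6) (Var 6)))))))))]"

definition program :: prog where
  "program = [main_body, dot_body, axpy_body, correct_body, perceptron_body, values_body, length_body,
     append_body, solve_body, branch_body, cons_all_body, cons_range_body, vectors_body, power_body,
     edge_body, touch_body, count_body, hi_body, lo_body, rows_body, zeros_body, prepare_body, start_body]"

lemma length_program [simp]: "length program = 23"
  by (simp add: program_def)

lemma program_nth [simp]:
  "program ! 0 = main_body" "program ! 1 = dot_body" "program ! Suc 0 = dot_body"
  "program ! 2 = axpy_body" "program ! 3 = correct_body"
  "program ! 4 = perceptron_body" "program ! 5 = values_body" "program ! 6 = length_body"
  "program ! 7 = append_body" "program ! 8 = solve_body" "program ! 9 = branch_body"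
  "program ! 10 = cons_all_body" "program ! 11 = cons_range_body" "program ! 12 = vectors_body"
  "program ! 13 = power_body" "program ! 14 = edge_body" "program ! 15 = touch_body"
  "program ! 16 = count_body" "program ! 17 = hi_body" "program ! 18 = lo_body"
  "program ! 19 = rows_body" "program ! 20 = zeros_body" "program ! 21 = prepare_body"
  "program ! 22 = start_body"
  by (simp_all add: program_def)

section \<open>Encodings, and correctness of the subprograms with call counts\<close>

abbreviation enc_vec :: "int list \<Rightarrow> val" where "enc_vec \<equiv> val_of_list Num"

definition enc_constr :: "constr \<Rightarrow> val" where
  "enc_constr C = Node (enc_vec (fst C)) (Node (Num (fst (snd C))) (Num (snd (snd C))))"

lemma enc_constr_simp [simp]: "enc_constr (a, lo, hi) = Node (enc_vec a) (Node (Num lo) (Num hi))"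
  by (simp add: enc_constr_def)

abbreviation enc_constrs :: "constr list \<Rightarrow> val" where "enc_constrs \<equiv> val_of_list enc_constr"
abbreviation enc_vecs :: "int list list \<Rightarrow> val" where "enc_vecs \<equiv> val_of_list enc_vec"
abbreviation enc_bool :: "bool \<Rightarrow> val" where "enc_bool b \<equiv> Num (if b then 1 else 0)"

declare val_size.simps(1) [simp del]

text \<open>The bound leaves room for the largest literal of the program,
  \<open>4096\<close>.\<close>

locale machine =
  fixes Z :: nat
  assumes Z: "Z > 5000"
begin

abbreviation "out \<equiv> outcome Z program"

lemma small [simp]: "\<bar>i\<bar> < int Z \<Longrightarrow> val_size (Num i) \<le> Z"
  by (rule val_size_Num_le)

lemma small_const [simp]: "val_size (Num 0) \<le> Z" "val_size (Num 1) \<le> Z" "val_size (Num 2) \<le> Z"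
  "val_size (Num (- 1)) \<le> Z" "val_size (Num 32) \<le> Z" "val_size (Num 4096) \<le> Z"
  using Z by (auto intro!: val_size_Num_le)

lemma out_dot:
  assumes "length a = length X" "\<And>x. x \<in> set a \<Longrightarrow> \<bar>x\<bar> \<le> A" "\<And>x. x \<in> set X \<Longrightarrow> \<bar>x\<bar> \<le> B"
    and "A \<ge> 0" "B \<ge> 0" "A < int Z" "B < int Z" "(int (length a) + 1) * (A * B) < int Z"
  shows "\<exists>n\<le>length a. out 1 [enc_vec a, enc_vec X] = Some (n, Num (dotp a X))"
  using assms
proof (induction a X rule: list_induct2)
  case Nil
  show ?case by (rule outcome_le) (simp_all add: dot_body_def)
next
  case (Cons a as x xs)
  have AB: "A * B \<ge> 0" "(int (length as) + 1) * (A * B) < int Z" "A * B < int Z"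
  proof -
    show "A * B \<ge> 0" using Cons by simp
    then show "(int (length as) + 1) * (A * B) < int Z" "A * B < int Z"
      using Cons.prems(7) mult_nonneg_nonneg[of "int (length as)" "A * B"] by (auto simp: algebra_simps)
  qed
  have "\<exists>n\<le>length as. out 1 [enc_vec as, enc_vec xs] = Some (n, Num (dotp as xs))"
    by (rule Cons.IH) (use Cons AB in auto)
  then obtain n where n: "n \<le> length as" "out 1 [enc_vec as, enc_vec xs] = Some (n, Num (dotp as xs))" by blast
  have "\<bar>dotp as xs\<bar> \<le> int (length as) * (A * B)" using Cons by (intro abs_dotp_le) auto
  then have d: "\<bar>dotp as xs\<bar> < int Z" using AB by (auto simp: algebra_simps)
  have a: "\<bar>a\<bar> \<le> A" "\<bar>x\<bar> \<le> B" using Cons.prems by auto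
  then have "\<bar>a * x\<bar> \<le> A * B" unfolding abs_mult by (intro mult_mono) auto
  then have s: "\<bar>a\<bar> < int Z" "\<bar>x\<bar> < int Z" "\<bar>a * x\<bar> < int Z"
    using AB Cons.prems a by linarith+
  show ?case
    by (rule outcome_le) (use n d s in \<open>simp_all add: dot_body_def\<close>)
qed

lemma out_axpy:
  assumes "length a = length X" "\<And>x. x \<in> set a \<Longrightarrow> \<bar>x\<bar> < int Z" "\<And>x. x \<in> set X \<Longrightarrow> \<bar>x\<bar> < int Z"
    and "\<bar>c\<bar> \<le> 1"
  shows "\<exists>n\<le>length a. out 2 [Num c, enc_vec a, enc_vec X] = Some (n, enc_vec (axpy c a X))"
  using assms
proof (induction a X rule: list_induct2)
  case Nil
  show ?case by (rule outcome_le) (simp_all add: axpy_body_def)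
next
  case (Cons a as x xs)
  have "\<exists>n\<le>length as. out 2 [Num c, enc_vec as, enc_vec xs] = Some (n, enc_vec (axpy c as xs))"
    by (rule Cons.IH) (use Cons in auto)
  then obtain n where n: "n \<le> length as" "out 2 [Num c, enc_vec as, enc_vec xs] = Some (n, enc_vec (axpy c as xs))" by blast
  have a: "\<bar>a\<bar> < int Z" "\<bar>x\<bar> < int Z" using Cons.prems by auto
  have "\<bar>c * a\<bar> \<le> 1 * \<bar>a\<bar>" unfolding abs_mult using Cons.prems by (intro mult_right_mono) auto
  then have s: "\<bar>c * a\<bar> < int Z" "\<bar>c\<bar> < int Z" using a Z Cons.prems by linarith+
  show ?case
    by (rule outcome_le) (use n a s in \<open>simp_all add: axpy_body_def\<close>)
qed

lemma out_length:
  assumes "length xs < Z"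
  shows "\<exists>n\<le>length xs. out 6 [val_of_list f xs] = Some (n, Num (int (length xs)))"
  using assms
proof (induction xs)
  case Nil
  show ?case by (rule outcome_le) (simp_all add: length_body_def)
next
  case (Cons x xs)
  then obtain n where "n \<le> length xs" "out 6 [val_of_list f xs] = Some (n, Num (int (length xs)))" by auto
  then show ?case
    by (intro outcome_le) (use Cons in \<open>simp_all add: length_body_def\<close>)
qed

lemma out_append:
  "\<exists>n\<le>length xs. out 7 [val_of_list f xs, val_of_list f ys] = Some (n, val_of_list f (xs @ ys))"
proof (induction xs)
  case Nil
  show ?case by (rule outcome_le) (simp_all add: append_body_def)
next
  case (Cons x xs)
  then obtain n where "n \<le> length xs" "out 7 [val_of_list f xs, val_of_list f ys] = Some (n, val_of_list f (xs @ ys))" by auto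
  then show ?case
    by (intro outcome_le) (simp_all add: append_body_def)
qed

end

fun enc_option :: "int list option \<Rightarrow> val" where
  "enc_option None = Num 0"
| "enc_option (Some Y) = Node (Num 0) (enc_vec Y)"

definition bounded_constrs :: "int \<Rightarrow> constr list \<Rightarrow> bool" where
  "bounded_constrs H L \<longleftrightarrow> (\<forall>(a, lo, hi)\<in>set L. \<bar>lo\<bar> \<le> H \<and> \<bar>hi\<bar> \<le> H)"

lemma bounded_constrs_Cons [simp]:
  "bounded_constrs H ((a, lo, hi) # L) \<longleftrightarrow> \<bar>lo\<bar> \<le> H \<and> \<bar>hi\<bar> \<le> H \<and> bounded_constrs H L"
  by (auto simp: bounded_constrs_def)

lemma abs_axpy_le:
  assumes "length a = length X" "y \<in> set (axpy c a X)" "\<And>x. x \<in> set a \<Longrightarrow> \<bar>x\<bar> \<le> A"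
    "\<And>x. x \<in> set X \<Longrightarrow> \<bar>x\<bar> \<le> B" "\<bar>c\<bar> \<le> 1"
  shows "\<bar>y\<bar> \<le> B + A"
  using assms
proof (induction a X rule: list_induct2)
  case (Cons a as x xs)
  have "\<bar>c * a\<bar> \<le> 1 * \<bar>a\<bar>" unfolding abs_mult using Cons.prems by (intro mult_right_mono) auto
  moreover have "\<bar>a\<bar> \<le> A" "\<bar>x\<bar> \<le> B" using Cons.prems by auto
  ultimately have "\<bar>x + c * a\<bar> \<le> B + A" by linarith
  then show ?case using Cons by auto
qed simp

definition enc_params :: "params \<Rightarrow> val" where
  "enc_params p = Node (Num (scale p)) (Node (Num (slack p)) (Node (Num (int (fuel p)))
     (Node (enc_vec (replicate (dim p) 0)) (Node (Num (int (range p))) (Num (int (threshold p)))))))"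

text \<open>\<open>BB\<close> bounds all entries met by the perceptron: they start at
  \<open>0\<close> and each of at most \<open>fuel p\<close> corrections changes them by at most
  \<open>K\<close>. The assumptions on \<open>Z\<close> cover the quantities computed from
  them.\<close>

locale algo = machine +
  fixes k n :: nat and p :: params and K R s H BB :: int
  defines "p \<equiv> algo_params k n" and "K \<equiv> int k + 1" and "R \<equiv> scale p" and "s \<equiv> slack p"
    and "H \<equiv> int (range p)" and "BB \<equiv> (int (fuel p) + 1) * K"
  assumes Z_dot: "(int k + 1) * (K * BB) < int Z" and Z_bound: "R * H + s < int Z"
    and Z_fuel: "int (fuel p) + 1 < int Z" and Z_range: "2 * H + 2 < int Z" and Z_threshold: "int (threshold p) < int Z"
    and Z_scale: "R < int Z"
begin

lemma params: "R \<ge> 0" "s \<ge> 0" "K \<ge> 1" "H \<ge> 0" "dim p = k" "BB \<ge> K"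
proof -
  show "R \<ge> 0" "s \<ge> 0" "K \<ge> 1" "H \<ge> 0" "dim p = k"
    by (simp_all add: R_def s_def K_def H_def p_def algo_params_def Let_def)
  then show "BB \<ge> K" using mult_right_mono[of 1 "int (fuel p) + 1" K] by (simp add: BB_def)
qed

lemma Z_consequences: "BB < int Z" "K < int Z" "s < int Z" "R * H < int Z" "H < int Z"
proof -
  have K: "K \<ge> 1" "BB \<ge> K" "BB \<ge> 1" using params by auto
  have 1: "1 * (1 * BB) \<le> (int k + 1) * (K * BB)" using K by (intro mult_mono) auto
  from order_le_less_trans[OF this Z_dot] have "BB < int Z" by (simp only: mult_1)
  then show "BB < int Z" "K < int Z" using K by linarith+
  show "H < int Z" using Z_range params by linarith
  have RH: "R * H \<ge> 0" using params by simp
  then show "s < int Z" "R * H < int Z" using Z_bound params by linarith+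
qed

lemma dotp_le: "vec_ok k a \<Longrightarrow> length X = k \<Longrightarrow> (\<And>x. x \<in> set X \<Longrightarrow> \<bar>x\<bar> \<le> BB) \<Longrightarrow> \<bar>dotp a X\<bar> < int Z"
proof -
  assume a: "vec_ok k a" "length X = k" "\<And>x. x \<in> set X \<Longrightarrow> \<bar>x\<bar> \<le> BB"
  have "\<bar>dotp a X\<bar> \<le> int (length a) * (K * BB)"
    using a params by (intro abs_dotp_le) (auto simp: vec_ok_def K_def)
  also have "\<dots> \<le> (int k + 1) * (K * BB)" using a params by (intro mult_right_mono) (auto simp: vec_ok_def)
  finally show ?thesis using Z_dot by linarith
qed

lemma out_correct:
  assumes "constrs_ok k L" "bounded_constrs H L" "length X = k" "\<And>x. x \<in> set X \<Longrightarrow> \<bar>x\<bar> \<le> BB"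
  shows "\<exists>n\<le>length L * (k + 2) + k + 1. out 3 [enc_constrs L, enc_vec X, Num R, Num s] =
    Some (n, enc_option (correct R s X L))"
  using assms(1,2)
proof (induction L)
  case Nil
  show ?case by (rule outcome_le) (simp_all add: correct_body_def)
next
  case (Cons C L)
  obtain a lo hi where C: "C = (a, lo, hi)" by (cases C)
  have a: "vec_ok k a" "\<bar>lo\<bar> \<le> H" "\<bar>hi\<bar> \<le> H" using Cons.prems by (auto simp: C)
  have len: "length a = length X" "length a = k" using a assms(3) by (auto simp: vec_ok_def)
  have aK: "\<bar>x\<bar> \<le> K" if "x \<in> set a" for x using a(1) that by (simp add: vec_ok_def K_def)
  obtain n1 where n1: "n1 \<le> length L * (k + 2) + k + 1"
    "out 3 [enc_constrs L, enc_vec X, Num R, Num s] = Some (n1, enc_option (correct R s X L))"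
    using Cons by (auto simp: C)
  have "\<exists>n\<le>length a. out 1 [enc_vec a, enc_vec X] = Some (n, Num (dotp a X))"
    by (rule out_dot[of a X K BB]) (use len aK assms(4) params Z_consequences Z_dot in auto)
  then obtain n2 where n2: "n2 \<le> k" "out 1 [enc_vec a, enc_vec X] = Some (n2, Num (dotp a X))" using len by auto
  have axpy: "\<exists>n\<le>length a. out 2 [Num c, enc_vec a, enc_vec X] = Some (n, enc_vec (axpy c a X))" if "\<bar>c\<bar> \<le> 1" for c
    by (rule out_axpy) (use len aK assms(4) Z_consequences that in \<open>auto intro: le_less_trans\<close>)
  obtain n3 where n3: "n3 \<le> k" "out 2 [Num 1, enc_vec a, enc_vec X] = Some (n3, enc_vec (axpy 1 a X))"
    using axpy[of 1] len by auto
  obtain n4 where n4: "n4 \<le> k" "out 2 [Num (- 1), enc_vec a, enc_vec X] = Some (n4, enc_vec (axpy (- 1) a X))"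
    using axpy[of "- 1"] len by auto
  have d: "\<bar>dotp a X\<bar> < int Z" by (rule dotp_le[OF a(1) assms(3,4)])
  have "\<bar>R * lo\<bar> \<le> R * H" "\<bar>R * hi\<bar> \<le> R * H"
    unfolding abs_mult using a params by (auto intro!: mult_mono)
  then have sz: "\<bar>R * lo\<bar> < int Z" "\<bar>R * hi\<bar> < int Z" "\<bar>R * lo - s\<bar> < int Z" "\<bar>R * hi + s\<bar> < int Z"
    "\<bar>lo\<bar> < int Z" "\<bar>hi\<bar> < int Z" "\<bar>R\<bar> < int Z" "\<bar>s\<bar> < int Z"
    using Z_bound Z_consequences Z_scale params a by linarith+
  show ?case
    by (rule outcome_le) (use n1 n2 n3 n4 d sz in \<open>simp_all add: correct_body_def C\<close>)
qed

text \<open>The entry bound \<open>B\<close> grows by \<open>K\<close> with each correction while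
  the fuel drops by one, so \<open>B + int F * K\<close> does not grow.\<close>

lemma out_perceptron:
  assumes "constrs_ok k L" "bounded_constrs H L" "length X = k" "\<And>x. x \<in> set X \<Longrightarrow> \<bar>x\<bar> \<le> B"
    and "F \<le> fuel p" "B + int F * K \<le> BB" "B \<ge> 0" and c: "c = length L * (k + 2) + k + 3"
  shows "\<exists>n\<le>(F + 1) * c.
    out 4 [Num (int F), enc_constrs L, enc_vec X, Num R, Num s] = Some (n, enc_bool (perceptron R s L F X))"
  using assms(3-7)
proof (induction F arbitrary: X B)
  case 0
  obtain n where n: "n + 2 \<le> c"
    "out 3 [enc_constrs L, enc_vec X, Num R, Num s] = Some (n, enc_option (correct R s X L))"
    using out_correct[OF assms(1,2), of X] 0 c by fastforce
  show ?case
  proof (rule outcome_le)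
    show "wp Z program [Num (int 0), enc_constrs L, enc_vec X, Num R, Num s] (program ! 4)
      (\<lambda>m b. m \<le> (0 + 1) * c \<and> b = enc_bool (perceptron R s L 0 X))"
      using n by (cases "correct R s X L") (simp_all add: perceptron_body_def perceptron.simps[of R s L 0])
  qed simp
next
  case (Suc F)
  have BF: "B + K + int F * K \<le> BB" "B + K \<ge> 0" using Suc.prems params by (auto simp: algebra_simps)
  moreover have "int F * K \<ge> 0" using params by simp
  ultimately have BBB: "B \<le> BB" using params by linarith
  obtain n where n: "n + 2 \<le> c"
    "out 3 [enc_constrs L, enc_vec X, Num R, Num s] = Some (n, enc_option (correct R s X L))"
    using out_correct[OF assms(1,2), of X] Suc.prems(1,2) BBB c by fastforce
  have F: "\<bar>int F\<bar> < int Z" "\<bar>int F + 1\<bar> < int Z" using Suc.prems Z_fuel by auto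
  show ?case
  proof (cases "correct R s X L")
    case None
    show ?thesis
      by (rule outcome_le)
        (use n None in \<open>simp_all add: perceptron_body_def perceptron.simps[of R s L "Suc F"]\<close>)
  next
    case (Some Y)
    from correct_SomeD[OF this] obtain a lo hi f where a: "(a, lo, hi) \<in> set L" "Y = axpy f a X" "\<bar>f\<bar> \<le> 1"
      by fastforce
    have ok: "vec_ok k a" using constrs_okD[OF assms(1) a(1)] .
    have len: "length a = length X" using ok Suc.prems by (simp add: vec_ok_def)
    have aK: "\<And>x. x \<in> set a \<Longrightarrow> \<bar>x\<bar> \<le> K" using ok by (simp add: vec_ok_def K_def)
    have "\<And>y. y \<in> set Y \<Longrightarrow> \<bar>y\<bar> \<le> B + K"
      unfolding a(2) by (rule abs_axpy_le[OF len _ aK Suc.prems(2) a(3)])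
    moreover have "length Y = k" using a(2) len Suc.prems by simp
    ultimately obtain n2 where n2: "n2 \<le> (F + 1) * c"
      "out 4 [Num (int F), enc_constrs L, enc_vec Y, Num R, Num s] = Some (n2, enc_bool (perceptron R s L F Y))"
      using Suc.IH[of Y "B + K"] BF Suc.prems by auto
    show ?thesis
      by (rule outcome_le)
        (use n n2 F Some in \<open>simp_all add: perceptron_body_def perceptron.simps[of R s L "Suc F"]\<close>)
  qed
qed

definition perceptron_cost :: "nat \<Rightarrow> nat" where
  "perceptron_cost N = (fuel p + 1) * (N * (k + 2) + k + 3)"

lemma perceptron_cost_mono: "N \<le> N' \<Longrightarrow> perceptron_cost N \<le> perceptron_cost N'"
  unfolding perceptron_cost_def by (intro mult_le_mono add_mono) auto

lemma out_feasible:
  assumes "constrs_ok k L" "bounded_constrs H L"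
  shows "\<exists>n\<le>perceptron_cost (length L).
    out 4 [Num (int (fuel p)), enc_constrs L, enc_vec (replicate k 0), Num R, Num s] = Some (n, enc_bool (feasible p L))"
proof -
  have "0 + int (fuel p) * K \<le> BB" using params by (simp add: BB_def algebra_simps)
  then show ?thesis
    using out_perceptron[OF assms, of "replicate k 0" 0 "fuel p"] params(5)
    by (auto simp: perceptron_cost_def feasible_def R_def s_def)
qed

abbreviation "enc_p \<equiv> enc_params p"

lemma enc_p: "enc_p = Node (Num R) (Node (Num s) (Node (Num (int (fuel p)))
     (Node (enc_vec (replicate k 0)) (Node (Num H) (Num (int (threshold p)))))))"
  by (simp add: enc_params_def R_def s_def H_def params)

lemma out_values:
  assumes L: "constrs_ok k L" "bounded_constrs H L" and v: "vec_ok k v"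
    and "- H \<le> t" "t + int m \<le> H + 1"
  shows "\<exists>n\<le>m * (perceptron_cost (length L + 1) + 2).
    out 5 [Num t, Num (int m), enc_vec v, enc_constrs L, enc_p] = Some (n, enc_vec (values_from p L v t m))"
  using assms(4,5)
proof (induction m arbitrary: t)
  case 0
  show ?case by (rule outcome_le) (simp_all add: values_body_def values_from_def)
next
  case (Suc m)
  obtain n1 where n1: "n1 \<le> m * (perceptron_cost (length L + 1) + 2)"
    "out 5 [Num (t + 1), Num (int m), enc_vec v, enc_constrs L, enc_p] = Some (n1, enc_vec (values_from p L v (t + 1) m))"
    using Suc.IH[of "t + 1"] Suc.prems by auto
  have tH: "\<bar>t\<bar> \<le> H" using Suc.prems by auto
  obtain n2 where n2: "n2 \<le> perceptron_cost (length L + 1)"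
    "out 4 [Num (int (fuel p)), Node (Node (enc_vec v) (Node (Num t) (Num t))) (enc_constrs L), enc_vec (replicate k 0), Num R, Num s]
      = Some (n2, enc_bool (feasible p ((v, t, t) # L)))"
    using out_feasible[of "(v, t, t) # L"] L v tH by auto
  have up: "values_from p L v t (Suc m) = (if feasible p ((v, t, t) # L) then t # values_from p L v (t + 1) m
      else values_from p L v (t + 1) m)"
    unfolding values_from_def by (subst upto_rec1) (auto simp: algebra_simps)
  have sz: "\<bar>t\<bar> < int Z" "\<bar>int m\<bar> < int Z" "\<bar>int m + 1\<bar> < int Z"
    using tH Suc.prems Z_range Z_consequences by linarith+
  show ?case
    by (rule outcome_le) (use n1 n2 sz in \<open>simp_all add: values_body_def enc_p up\<close>)
qed

lemma out_branch:
  assumes "\<And>t. t \<in> set T \<Longrightarrow> \<exists>n\<le>S. out 8 [enc_constrs ((v, t, t) # L), Num 0, enc_vecs todo, enc_p] = Some (n, enc_bool (g t))"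
  shows "\<exists>n\<le>length T * (S + 2). out 9 [enc_vec T, enc_vec v, enc_constrs L, enc_vecs todo, enc_p]
    = Some (n, enc_bool (list_ex g T))"
  using assms
proof (induction T)
  case Nil
  show ?case by (rule outcome_le) (simp_all add: branch_body_def)
next
  case (Cons t T)
  obtain n1 where n1: "n1 \<le> length T * (S + 2)" "out 9 [enc_vec T, enc_vec v, enc_constrs L, enc_vecs todo, enc_p]
    = Some (n1, enc_bool (list_ex g T))" using Cons by auto
  obtain n2 where n2: "n2 \<le> S" "out 8 [Node (Node (enc_vec v) (Node (Num t) (Num t))) (enc_constrs L), Num 0, enc_vecs todo, enc_p]
    = Some (n2, enc_bool (g t))" using Cons.prems[of t] by auto
  show ?case
    by (rule outcome_le) (use n1 n2 in \<open>simp_all add: branch_body_def\<close>)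
qed

end

context algo
begin

text \<open>Calls at one node of the search apart from those of its subtrees: the probes of all
  values, then the length, append and branch routines.\<close>

definition node_cost :: "nat \<Rightarrow> nat" where
  "node_cost N = (2 * range p + 1) * (perceptron_cost N + 2) + 2 * range p + N + 2 * threshold p + 10"

text \<open>The list \<open>vb\<close> collects the rows that branched into at least two values; there is no small
  relation among them, so there are at most \<open>k\<close> of them on every path.\<close>

lemma out_solve:
  assumes "constrs_ok k L" "bounded_constrs H L" "\<forall>v\<in>set sk \<union> set todo. vec_ok k v"
    and "no_small_relation (relation_bound k) k vb"
    and "\<forall>u\<in>set vb. vec_ok k u \<and> (\<exists>t. (u, t, t) \<in> set L)" "length vb + b = k"
    and "length L + length sk + length todo \<le> N"
  shows "\<exists>m\<le>node_cost N * (threshold p + 1) ^ b * ((length sk + length todo)\<^sup>2 + length todo + 1).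
    out 8 [enc_constrs L, enc_vecs sk, enc_vecs todo, enc_p] = Some (m, enc_bool (solve p L sk todo))"
  using assms
proof (induction "(length sk + length todo)\<^sup>2 + length todo" arbitrary: L sk todo vb b rule: less_induct)
  case less
  let ?W = "threshold p" and ?c = "node_cost N"
  have X1: "?c \<le> ?c * (?W + 1) ^ b" by simp
  show ?case
  proof (cases todo)
    case Nil
    obtain n where n: "n \<le> perceptron_cost (length L)"
      "out 4 [Num (int (fuel p)), enc_constrs L, enc_vec (replicate k 0), Num R, Num s] = Some (n, enc_bool (feasible p L))"
      using out_feasible[OF less(2,3)] by blast
    have "n + 1 \<le> ?c" using n(1) perceptron_cost_mono[of "length L" N] less(8) by (simp add: node_cost_def)
    also have "\<dots> \<le> ?c * (?W + 1) ^ b * 1" using X1 by simp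
    also have "\<dots> \<le> ?c * (?W + 1) ^ b * ((length sk + length todo)\<^sup>2 + length todo + 1)"
      by (rule mult_le_mono2) simp
    finally have m: "n + 1 \<le> \<dots>" .
    show ?thesis
      by (rule outcome_le) (use n(2) m in \<open>simp_all add: solve_body_def enc_p Nil del: mult_Suc mult_Suc_right\<close>)
  next
    case (Cons v rest)
    define T where "T = possible_values p L v"
    define j where "j = length todo"
    define m where "m = length sk + length todo"
    have v: "vec_ok k v" "\<forall>u\<in>set rest. vec_ok k u" using less(4) by (auto simp: Cons)
    have j: "j = Suc (length rest)" "m = Suc (length (sk @ rest))" by (simp_all add: j_def m_def Cons)
    have lenT: "length T \<le> 2 * range p + 1"
      unfolding T_def possible_values_def values_from_def by (rule order_trans[OF length_filter_le]) simp
    have vals: "\<exists>n\<le>(2 * range p + 1) * (perceptron_cost (length L + 1) + 2).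
      out 5 [Num (- H), Num (int (2 * range p + 1)), enc_vec v, enc_constrs L, enc_p] =
        Some (n, enc_vec (values_from p L v (- H) (2 * range p + 1)))"
      by (rule out_values[OF less(2,3) v(1)]) (use params in \<open>auto simp: H_def\<close>)
    have eqs: "int (2 * range p + 1) = 2 * H + 1" "values_from p L v (- H) (2 * range p + 1) = T"
      by (simp_all add: H_def T_def possible_values_def)
    obtain n1 where n1: "n1 \<le> (2 * range p + 1) * (perceptron_cost (length L + 1) + 2)"
      "out 5 [Num (- H), Num (2 * H + 1), enc_vec v, enc_constrs L, enc_p] = Some (n1, enc_vec T)"
      using vals[unfolded eqs] by blast
    have LN: "length L + 1 \<le> N" using less(8) by (simp add: Cons)
    have n1': "n1 \<le> (2 * range p + 1) * (perceptron_cost N + 2)"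
      using n1(1) perceptron_cost_mono[OF LN] by (meson add_le_mono1 le_trans mult_le_mono2)
    have TZ: "length T < Z" using lenT Z_range by (simp add: H_def)
    obtain n2 where n2: "n2 \<le> length T" "out 6 [enc_vec T] = Some (n2, Num (int (length T)))"
      using out_length[OF TZ] by blast
    obtain n3 where n3: "n3 \<le> length sk" "out 7 [enc_vecs sk, enc_vecs rest] = Some (n3, enc_vecs (sk @ rest))"
      using out_append by blast
    have skN: "length sk \<le> N" using less(8) by simp
    have sz: "\<bar>H\<bar> < int Z" "\<bar>2 * H\<bar> < int Z" "\<bar>2 * H + 1\<bar> < int Z" "\<bar>int (length T)\<bar> < int Z" "\<bar>int ?W\<bar> < int Z"
      using Z_range Z_threshold TZ params by auto
    show ?thesis
    proof (cases "length T \<le> ?W")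
      case True
      have decr: "(length ([] :: int list list) + length (sk @ rest))\<^sup>2 + length (sk @ rest)
          < (length sk + length todo)\<^sup>2 + length todo"
        by (simp add: Cons power2_eq_square)
      define A where "A = (length (sk @ rest))\<^sup>2 + length (sk @ rest) + 1"
      have "\<exists>S. length T * S \<le> ?c * (?W + 1) ^ b * A \<and> (\<forall>t\<in>set T.
          \<exists>n\<le>S. out 8 [enc_constrs ((v, t, t) # L), Num 0, enc_vecs (sk @ rest), enc_p]
            = Some (n, enc_bool (solve p ((v, t, t) # L) [] (sk @ rest))))"
      \<comment> \<open>With at most one value there is no real branching and the budget
        \<open>b\<close> stays. With two or more, \<open>v\<close> joins the independent rows,
        \<open>b\<close> drops by one, and the factor \<open>threshold p + 1\<close> set free pays
        for the branches.\<close>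
      proof (cases "length T \<le> 1")
        case True
        define S where "S = ?c * (?W + 1) ^ b * A"
        have "\<exists>n\<le>S. out 8 [enc_constrs ((v, t, t) # L), Num 0, enc_vecs (sk @ rest), enc_p]
            = Some (n, enc_bool (solve p ((v, t, t) # L) [] (sk @ rest)))" if t: "t \<in> set T" for t
        proof -
          have "\<bar>t\<bar> \<le> H" using t by (auto simp: T_def possible_values_def values_from_def H_def)
          then have "bounded_constrs H ((v, t, t) # L)" using less(3) by simp
          moreover have "\<forall>u\<in>set (vb). vec_ok k u \<and> (\<exists>t'. (u, t', t') \<in> set ((v, t, t) # L))"
            using less(6) v(1) by fastforce
          moreover have "constrs_ok k ((v, t, t) # L)" using less(2) v(1) by simp
          moreover have "\<forall>u\<in>set [] \<union> set (sk @ rest). vec_ok k u" using less(4) by (simp add: Cons)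
          ultimately have "\<exists>n\<le>?c * (?W + 1) ^ b * ((length ([] :: int list list) + length (sk @ rest))\<^sup>2 + length (sk @ rest) + 1).
            out 8 [enc_constrs ((v, t, t) # L), enc_vecs [], enc_vecs (sk @ rest), enc_p]
              = Some (n, enc_bool (solve p ((v, t, t) # L) [] (sk @ rest)))"
            by (intro less(1)[OF decr _ _ _ less(5) _ less(7)]) (use less(8) in \<open>simp_all add: Cons\<close>)
          then show ?thesis unfolding S_def A_def by (simp only: val_of_list_simps list.size add_0)
        qed
        moreover have "length T * S \<le> 1 * S" using True by (intro mult_le_mono1) simp
        then have "length T * S \<le> ?c * (?W + 1) ^ b * A" by (simp add: S_def)
        ultimately show ?thesis by blast
      next
        case False
        then have ind: "no_small_relation (relation_bound k) k (vb @ [v])"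
          using no_small_relation_snoc[OF less(5,6,2) v(1), of n] by (simp add: T_def p_def)
        then have "length (vb @ [v]) \<le> k" using less(6) v(1) by (intro no_small_relation_length) auto
        then obtain b' where b: "b = Suc b'" using less(7) by (cases b) auto
        have len_b: "length (vb @ [v]) + b' = k" using less(7) b by simp
        define S where "S = ?c * (?W + 1) ^ b' * A"
        have "\<exists>n\<le>S. out 8 [enc_constrs ((v, t, t) # L), Num 0, enc_vecs (sk @ rest), enc_p]
            = Some (n, enc_bool (solve p ((v, t, t) # L) [] (sk @ rest)))" if t: "t \<in> set T" for t
        proof -
          have "\<bar>t\<bar> \<le> H" using t by (auto simp: T_def possible_values_def values_from_def H_def)
          then have "bounded_constrs H ((v, t, t) # L)" using less(3) by simp
          moreover have "\<forall>u\<in>set (vb @ [v]). vec_ok k u \<and> (\<exists>t'. (u, t', t') \<in> set ((v, t, t) # L))"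
            using less(6) v(1) by fastforce
          moreover have "constrs_ok k ((v, t, t) # L)" using less(2) v(1) by simp
          moreover have "\<forall>u\<in>set [] \<union> set (sk @ rest). vec_ok k u" using less(4) by (simp add: Cons)
          ultimately have "\<exists>n\<le>?c * (?W + 1) ^ b' * ((length ([] :: int list list) + length (sk @ rest))\<^sup>2 + length (sk @ rest) + 1).
            out 8 [enc_constrs ((v, t, t) # L), enc_vecs [], enc_vecs (sk @ rest), enc_p]
              = Some (n, enc_bool (solve p ((v, t, t) # L) [] (sk @ rest)))"
            by (intro less(1)[OF decr _ _ _ ind _ len_b]) (use less(8) in \<open>simp_all add: Cons\<close>)
          then show ?thesis unfolding S_def A_def by (simp only: val_of_list_simps list.size add_0)
        qed
        moreover have "length T * S \<le> (?W + 1) * S" using True by (intro mult_le_mono1) simp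
        then have "length T * S \<le> ?c * (?W + 1) ^ b * A" 
          unfolding S_def b by (simp only: power_Suc mult_ac)
        ultimately show ?thesis by blast
      qed
      then obtain S where S: "length T * S \<le> ?c * (?W + 1) ^ b * A"
        "\<And>t. t \<in> set T \<Longrightarrow> \<exists>n\<le>S. out 8 [enc_constrs ((v, t, t) # L), Num 0, enc_vecs (sk @ rest), enc_p]
            = Some (n, enc_bool (solve p ((v, t, t) # L) [] (sk @ rest)))" by blast
      obtain n4 where n4: "n4 \<le> length T * (S + 2)"
        "out 9 [enc_vec T, enc_vec v, enc_constrs L, enc_vecs (sk @ rest), enc_p] =
          Some (n4, enc_bool (list_ex (\<lambda>t. solve p ((v, t, t) # L) [] (sk @ rest)) T))"
        using out_branch[OF S(2)] by blast
      have "n1 + n2 + n3 + n4 + 4 \<le> ?c + ?c * (?W + 1) ^ b * A"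
      proof -
        have "n4 \<le> ?c * (?W + 1) ^ b * A + 2 * ?W" using n4(1) S(1) True by (simp add: distrib_left)
        then show ?thesis using n1' n2(1) n3(1) lenT skN by (simp add: node_cost_def)
      qed
      also have "\<dots> \<le> ?c * (?W + 1) ^ b * (A + 1)" using X1 by (simp add: distrib_left)
      also have "\<dots> \<le> ?c * (?W + 1) ^ b * (m\<^sup>2 + j + 1)"
        by (rule mult_le_mono2) (simp add: A_def j power2_eq_square)
      finally have cost: "n1 + n2 + n3 + n4 + 4 \<le> \<dots>" .
      have sol: "solve p L sk todo = list_ex (\<lambda>t. solve p ((v, t, t) # L) [] (sk @ rest)) T"
        using True by (simp add: Cons T_def)
      have "wp Z program [enc_constrs L, enc_vecs sk, enc_vecs todo, enc_p] (program ! 8)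
        (\<lambda>n a. n \<le> ?c * (?W + 1) ^ b * (m\<^sup>2 + j + 1) \<and> a = enc_bool (solve p L sk todo))"
        unfolding sol using n1(2) n2(2) n3(2) n4(2) cost sz True
        by (simp add: solve_body_def enc_p Cons del: mult_Suc mult_Suc_right)
      from outcome_le[OF this] show ?thesis by (simp add: j_def m_def)
    next
      case False
      have "\<exists>n\<le>?c * (?W + 1) ^ b * ((length (v # sk) + length rest)\<^sup>2 + length rest + 1).
          out 8 [enc_constrs L, enc_vecs (v # sk), enc_vecs rest, enc_p] = Some (n, enc_bool (solve p L (v # sk) rest))"
        by (rule less(1)) (use less(2-8) v in \<open>auto simp: Cons\<close>)
      moreover have "length (v # sk) + length rest = m" by (simp add: m_def Cons)
      ultimately obtain n4 where n4: "n4 \<le> ?c * (?W + 1) ^ b * (m\<^sup>2 + length rest + 1)"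
        "out 8 [enc_constrs L, Node (enc_vec v) (enc_vecs sk), enc_vecs rest, enc_p] = Some (n4, enc_bool (solve p L (v # sk) rest))"
        by auto
      have "n1 + n2 + n4 + 3 \<le> ?c + ?c * (?W + 1) ^ b * (m\<^sup>2 + length rest + 1)"
        using n1' n2(1) lenT n4(1) by (simp add: node_cost_def)
      also have "\<dots> \<le> ?c * (?W + 1) ^ b * (m\<^sup>2 + j + 1)" using X1 by (simp add: distrib_left j)
      finally have cost: "n1 + n2 + n4 + 3 \<le> \<dots>" .
      have sol: "solve p L sk todo = solve p L (v # sk) rest" using False by (simp add: Cons T_def)
      have "wp Z program [enc_constrs L, enc_vecs sk, enc_vecs todo, enc_p] (program ! 8)
        (\<lambda>n a. n \<le> ?c * (?W + 1) ^ b * (m\<^sup>2 + j + 1) \<and> a = enc_bool (solve p L sk todo))"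
        unfolding sol using n1(2) n2(2) n4(2) cost sz False
        by (simp add: solve_body_def enc_p Cons del: mult_Suc mult_Suc_right)
      from outcome_le[OF this] show ?thesis by (simp add: j_def m_def)
    qed
  qed
qed

end

section \<open>Enumeration of vectors and computation of the rows\<close>

fun cons_range :: "int \<Rightarrow> nat \<Rightarrow> int list list \<Rightarrow> int list list" where
  "cons_range c 0 vs = []"
| "cons_range c (Suc m) vs = map ((#) c) vs @ cons_range (c + 1) m vs"

fun all_vectors :: "nat \<Rightarrow> int \<Rightarrow> nat \<Rightarrow> int list list" where
  "all_vectors 0 lo m = [[]]"
| "all_vectors (Suc d) lo m = cons_range lo m (all_vectors d lo m)"

lemma length_cons_range: "length (cons_range c m vs) = m * length vs"
  by (induction c m vs rule: cons_range.induct) auto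

lemma length_all_vectors: "length (all_vectors d lo m) = m ^ d"
  by (induction d) (auto simp: length_cons_range)

lemma set_cons_range: "set (cons_range c m vs) = {x # v |x v. c \<le> x \<and> x < c + int m \<and> v \<in> set vs}"
proof (induction c m vs rule: cons_range.induct)
  case (2 c m vs)
  have "c \<le> x \<and> x < c + int (Suc m) \<longleftrightarrow> x = c \<or> c + 1 \<le> x \<and> x < c + 1 + int m" for x by auto
  then show ?case unfolding cons_range.simps set_append 2 by auto
qed auto

lemma set_all_vectors: "set (all_vectors d lo m) = {v. length v = d \<and> (\<forall>x\<in>set v. lo \<le> x \<and> x < lo + int m)}"
  by (induction d) (auto simp: set_cons_range length_Suc_conv)

text \<open>One test serves both bounds: for \<open>b = 1\<close> it says that \<open>u\<close> has
  a neighbor in the set given by the row, and its failure for \<open>b = 0\<close> says that all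
  neighbors lie in that set.\<close>

definition touches :: "(nat \<times> nat) list \<Rightarrow> nat \<Rightarrow> nat list \<Rightarrow> int list \<Rightarrow> int \<Rightarrow> bool" where
  "touches es u vs rw b = list_ex (\<lambda>(v, x). x = b \<and> (u, v) \<in> set es) (zip vs rw)"

definition color_count ::
  "(nat \<times> nat) list \<Rightarrow> (nat \<Rightarrow> nat) \<Rightarrow> nat list \<Rightarrow> nat \<Rightarrow> nat list \<Rightarrow> int list \<Rightarrow> int \<Rightarrow> bool \<Rightarrow> int" where
  "color_count es g us c vs rw b r = int (length (filter (\<lambda>u. g u = c \<and> touches es u vs rw b = r) us))"

definition hi_value ::
  "(nat \<times> nat) list \<Rightarrow> (nat \<Rightarrow> nat) \<Rightarrow> nat list \<Rightarrow> nat list \<Rightarrow> nat list \<Rightarrow> int list \<Rightarrow> int" where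
  "hi_value es g us vs cs rw = foldr (\<lambda>c. min (color_count es g us c vs rw 1 True)) cs (int (length us))"

definition lo_value ::
  "(nat \<times> nat) list \<Rightarrow> (nat \<Rightarrow> nat) \<Rightarrow> nat list \<Rightarrow> nat list \<Rightarrow> nat list \<Rightarrow> int \<Rightarrow> int list \<Rightarrow> int" where
  "lo_value es g us vs cs w rw = foldr (\<lambda>c. max (color_count es g us c vs rw 0 False - w)) cs 0"

lemma color_count_bounds: "0 \<le> color_count es g us c vs rw b r" "color_count es g us c vs rw b r \<le> int (length us)"
  by (simp_all add: color_count_def)

lemma hi_value_bounds: "0 \<le> hi_value es g us vs cs rw \<and> hi_value es g us vs cs rw \<le> int (length us)"
  by (induction cs) (auto simp: hi_value_def color_count_bounds min_le_iff_disj)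

lemma lo_value_bounds: "w \<ge> 0 \<Longrightarrow> 0 \<le> lo_value es g us vs cs w rw \<and> lo_value es g us vs cs w rw \<le> int (length us)"
proof (induction cs)
  case (Cons c cs)
  then show ?case using color_count_bounds(2)[of es g us c vs rw 0 False]
    by (auto simp: lo_value_def le_max_iff_disj)
qed (simp add: lo_value_def)

text \<open>For a 0/1 row, \<open>dotp rw rw\<close> is the size of the set, so the dot product
  routine also counts.\<close>

definition make_rows ::
  "(nat \<times> nat) list \<Rightarrow> (nat \<Rightarrow> nat) \<Rightarrow> nat list \<Rightarrow> nat list \<Rightarrow> nat list \<Rightarrow> int \<Rightarrow> int list list \<Rightarrow> constr list" where
  "make_rows es g us vs cs l = map (\<lambda>rw. (rw, lo_value es g us vs cs (l * dotp rw rw) rw, hi_value es g us vs cs rw))"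

definition count_cost :: "nat \<Rightarrow> nat \<Rightarrow> nat \<Rightarrow> nat" where
  "count_cost U V E = U * (V * (E + 2) + 2)"

lemma val_of_pair_simp [simp]: "val_of_pair (a, b) = Node (Num (int a)) (Num (int b))"
  by (simp add: val_of_pair_def val_of_nat_def)

lemma if_times_if: "(if P then 1 else 0) * (if Q then 1 else 0) = (if P \<and> Q then 1 else (0::int))"
  by simp

lemma le_and_ge_iff: "a \<le> b \<and> b \<le> a \<longleftrightarrow> a = (b::'a::order)"
  by auto

lemmas test_simps = if_times_if le_and_ge_iff

context machine
begin

lemma out_cons_all:
  "\<exists>n\<le>length vs. out 10 [Num c, enc_vecs vs, enc_vecs acc] = Some (n, enc_vecs (map ((#) c) vs @ acc))"
proof (induction vs)
  case Nil
  show ?case by (rule outcome_le) (simp_all add: cons_all_body_def)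
next
  case (Cons v vs)
  then obtain n where "n \<le> length vs" "out 10 [Num c, enc_vecs vs, enc_vecs acc] = Some (n, enc_vecs (map ((#) c) vs @ acc))"
    by blast
  then show ?case by (intro outcome_le) (simp_all add: cons_all_body_def)
qed

lemma out_cons_range:
  assumes "\<bar>c\<bar> + int m < int Z"
  shows "\<exists>n\<le>m * (length vs + 2). out 11 [Num c, Num (int m), enc_vecs vs] = Some (n, enc_vecs (cons_range c m vs))"
  using assms
proof (induction m arbitrary: c)
  case 0
  show ?case by (rule outcome_le) (simp_all add: cons_range_body_def)
next
  case (Suc m)
  then obtain n where n: "n \<le> m * (length vs + 2)"
    "out 11 [Num (c + 1), Num (int m), enc_vecs vs] = Some (n, enc_vecs (cons_range (c + 1) m vs))"
    using Suc.IH[of "c + 1"] Suc.prems by fastforce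
  obtain n2 where n2: "n2 \<le> length vs" "out 10 [Num c, enc_vecs vs, enc_vecs (cons_range (c + 1) m vs)] =
      Some (n2, enc_vecs (map ((#) c) vs @ cons_range (c + 1) m vs))" using out_cons_all by blast
  have "\<bar>c\<bar> < int Z" "\<bar>int m\<bar> < int Z" "\<bar>int m + 1\<bar> < int Z" using Suc.prems by auto
  then show ?case
    by (intro outcome_le) (use n n2 in \<open>simp_all add: cons_range_body_def\<close>)
qed

lemma out_vectors:
  assumes "\<bar>lo\<bar> + int m < int Z" "m \<ge> 1"
  shows "\<exists>n\<le>length xs * (m * (m ^ length xs + 2) + 2).
    out 12 [val_of_list f xs, Num lo, Num (int m)] = Some (n, enc_vecs (all_vectors (length xs) lo m))"
proof (induction xs)
  case Nil
  show ?case by (rule outcome_le) (simp_all add: vectors_body_def)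
next
  case (Cons x xs)
  define c where "c l = m * (m ^ l + 2) + 2" for l
  have c: "c (length xs) \<le> c (length (x # xs))"
    unfolding c_def using assms(2) by (intro add_mono mult_le_mono power_increasing) auto
  obtain n where n: "n \<le> length xs * c (length xs)"
    "out 12 [val_of_list f xs, Num lo, Num (int m)] = Some (n, enc_vecs (all_vectors (length xs) lo m))"
    using Cons by (auto simp: c_def)
  obtain n2 where n2: "n2 \<le> m * (m ^ length xs + 2)"
    "out 11 [Num lo, Num (int m), enc_vecs (all_vectors (length xs) lo m)]
      = Some (n2, enc_vecs (cons_range lo m (all_vectors (length xs) lo m)))"
    using out_cons_range[OF assms(1), of "all_vectors (length xs) lo m"] by (auto simp: length_all_vectors)
  have "n + n2 + 2 \<le> length xs * c (length xs) + c (length xs)" using n(1) n2(1) by (simp add: c_def)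
  also have "\<dots> \<le> length xs * c (length (x # xs)) + c (length (x # xs))" using c by (intro add_mono mult_le_mono2)
  also have "\<dots> = length (x # xs) * c (length (x # xs))" by simp
  finally have cost: "n + n2 + 2 \<le> \<dots>" .
  have "wp Z program [val_of_list f (x # xs), Num lo, Num (int m)] (program ! 12)
    (\<lambda>n a. n \<le> length (x # xs) * c (length (x # xs)) \<and> a = enc_vecs (all_vectors (length (x # xs)) lo m))"
    using n(2) n2(2) cost by (simp add: vectors_body_def del: mult_Suc mult_Suc_right)
  from outcome_le[OF this] show ?case by (simp add: c_def)
qed

lemma out_power:
  assumes "1 \<le> b" "b ^ length xs < int Z"
  shows "\<exists>n\<le>length xs. out 13 [Num b, val_of_list f xs] = Some (n, Num (b ^ length xs))"
  using assms(2)
proof (induction xs)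
  case Nil
  show ?case by (rule outcome_le) (simp_all add: power_body_def)
next
  case (Cons x xs)
  have p: "1 \<le> b ^ length xs" using assms(1) by simp
  have "b \<le> b * b ^ length xs" "b ^ length xs \<le> b * b ^ length xs"
    using mult_left_mono[OF p, of b] mult_right_mono[OF assms(1), of "b ^ length xs"] assms(1) p by simp_all
  moreover have "b * b ^ length xs < int Z" using Cons.prems by simp
  ultimately have "b < int Z" "b ^ length xs < int Z" by (auto intro: order_le_less_trans)
  then have s: "\<bar>b\<bar> < int Z" "\<bar>b ^ length xs\<bar> < int Z" using assms(1) p by simp_all
  obtain n where n: "n \<le> length xs" "out 13 [Num b, val_of_list f xs] = Some (n, Num (b ^ length xs))"
    using Cons.IH[OF \<open>b ^ length xs < int Z\<close>] by blast
  have s': "val_size (Num b) \<le> Z" "val_size (Num (b ^ length xs)) \<le> Z" using s by auto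
  show ?case
    by (intro outcome_le) (use n s' in \<open>simp_all add: power_body_def\<close>)
qed

lemma out_zeros:
  "\<exists>n\<le>length xs. out 20 [val_of_list f xs] = Some (n, enc_vec (replicate (length xs) 0))"
proof (induction xs)
  case Nil
  show ?case by (rule outcome_le) (simp_all add: zeros_body_def)
next
  case (Cons x xs)
  then obtain n where "n \<le> length xs" "out 20 [val_of_list f xs] = Some (n, enc_vec (replicate (length xs) 0))" by blast
  then show ?case by (intro outcome_le) (simp_all add: zeros_body_def)
qed

lemma small_if [simp]: "val_size (Num (if P then 1 else 0)) \<le> Z"
  by simp

text \<open>Names of vertices and colors may be large numbers that are short in bits. They are only
  compared, so bounding their size instead of their value is enough.\<close>

definition fits :: "nat \<Rightarrow> bool" where
  "fits v \<longleftrightarrow> val_size (Num (int v)) \<le> Z"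

lemma out_edge:
  assumes "fits u" "fits v" "\<forall>(a, b)\<in>set es. fits a \<and> fits b"
  shows "\<exists>n\<le>length es. out 14 [Num (int u), Num (int v), val_of_list val_of_pair es] = Some (n, enc_bool ((u, v) \<in> set es))"
  using assms(3)
proof (induction es)
  case Nil
  show ?case by (rule outcome_le) (simp_all add: edge_body_def)
next
  case (Cons e es)
  obtain a b where e: "e = (a, b)" by (cases e)
  obtain n where n: "n \<le> length es"
    "out 14 [Num (int u), Num (int v), val_of_list val_of_pair es] = Some (n, enc_bool ((u, v) \<in> set es))"
    using Cons by auto
  have f: "val_size (Num (int a)) \<le> Z" "val_size (Num (int b)) \<le> Z"
    "val_size (Num (int u)) \<le> Z" "val_size (Num (int v)) \<le> Z"
    using Cons.prems assms by (auto simp: e fits_def)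
  show ?case
    by (rule outcome_le) (use n f in \<open>simp add: edge_body_def e test_simps, auto\<close>)
qed

lemma out_touch:
  assumes "fits u" "\<forall>v\<in>set vs. fits v" "\<forall>(a, b)\<in>set es. fits a \<and> fits b"
    and "length vs = length rw" "\<And>x. x \<in> set rw \<Longrightarrow> \<bar>x\<bar> \<le> 1" "\<bar>b\<bar> \<le> 1"
  shows "\<exists>n\<le>length vs * (length es + 2).
    out 15 [Num (int u), val_of_list val_of_nat vs, enc_vec rw, val_of_list val_of_pair es, Num b]
      = Some (n, enc_bool (touches es u vs rw b))"
  using assms(4,2,5)
proof (induction vs rw rule: list_induct2)
  case Nil
  show ?case by (rule outcome_le) (simp_all add: touch_body_def touches_def)
next
  case (Cons v vs x rw)
  obtain n where n: "n \<le> length vs * (length es + 2)"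
    "out 15 [Num (int u), val_of_list val_of_nat vs, enc_vec rw, val_of_list val_of_pair es, Num b]
      = Some (n, enc_bool (touches es u vs rw b))" using Cons by auto
  obtain n2 where n2: "n2 \<le> length es"
    "out 14 [Num (int u), Num (int v), val_of_list val_of_pair es] = Some (n2, enc_bool ((u, v) \<in> set es))"
    using out_edge[of u v es] assms Cons.prems by auto
  have "\<bar>x\<bar> \<le> 1" using Cons.prems by auto
  then have "\<bar>x\<bar> < int Z" "\<bar>b\<bar> < int Z" using assms(6) Z by linarith+
  then have f: "val_size (Num x) \<le> Z" "val_size (Num b) \<le> Z" by auto
  show ?case
    by (rule outcome_le) (use n n2 f in \<open>simp add: touch_body_def touches_def val_of_nat_def[of v] test_simps, auto\<close>)
qed

lemma out_count:
  assumes "\<forall>u\<in>set us. fits u \<and> fits (g u)" "\<forall>v\<in>set vs. fits v" "\<forall>(a, b)\<in>set es. fits a \<and> fits b"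
    and "length vs = length rw" "\<And>x. x \<in> set rw \<Longrightarrow> \<bar>x\<bar> \<le> 1" "\<bar>b\<bar> \<le> 1" "fits c" "length us < Z"
  shows "\<exists>n\<le>count_cost (length us) (length vs) (length es).
    out 16 [val_of_list (\<lambda>u. val_of_pair (u, g u)) us, Num (int c), val_of_list val_of_nat vs, enc_vec rw,
      val_of_list val_of_pair es, Num b, enc_bool r] = Some (n, Num (color_count es g us c vs rw b r))"
  using assms(1,8)
proof (induction us)
  case Nil
  show ?case by (rule outcome_le) (simp_all add: count_body_def color_count_def)
next
  case (Cons u us)
  obtain n where n: "n \<le> count_cost (length us) (length vs) (length es)"
    "out 16 [val_of_list (\<lambda>u. val_of_pair (u, g u)) us, Num (int c), val_of_list val_of_nat vs, enc_vec rw,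
      val_of_list val_of_pair es, Num b, enc_bool r] = Some (n, Num (color_count es g us c vs rw b r))"
    using Cons by auto
  obtain n2 where n2: "n2 \<le> length vs * (length es + 2)"
    "out 15 [Num (int u), val_of_list val_of_nat vs, enc_vec rw, val_of_list val_of_pair es, Num b]
      = Some (n2, enc_bool (touches es u vs rw b))"
    using out_touch[of u vs es rw b] assms Cons.prems by auto
  have cost: "n + n2 + 2 \<le> count_cost (length (u # us)) (length vs) (length es)"
    using n(1) n2(1) by (simp add: count_cost_def)
  have f: "val_size (Num (int u)) \<le> Z" "val_size (Num (int (g u))) \<le> Z" "val_size (Num (int c)) \<le> Z"
    using Cons.prems assms(7) by (auto simp: fits_def)
  have "\<bar>color_count es g us c vs rw b r\<bar> < int Z"
    using color_count_bounds[of es g us c vs rw b r] Cons.prems(2) by simp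
  then have f2: "val_size (Num (color_count es g us c vs rw b r)) \<le> Z" by simp
  have cc: "color_count es g (u # us) c vs rw b r =
      (if g u = c \<and> touches es u vs rw b = r then 1 else 0) + color_count es g us c vs rw b r"
    by (simp add: color_count_def)
  show ?case
    by (rule outcome_le) (use n(2) n2(2) cost f f2 in \<open>simp add: count_body_def cc test_simps, auto\<close>)
qed

lemma out_hi:
  assumes "\<forall>u\<in>set us. fits u \<and> fits (g u)" "\<forall>v\<in>set vs. fits v" "\<forall>(a, b)\<in>set es. fits a \<and> fits b"
    and "length vs = length rw" "\<And>x. x \<in> set rw \<Longrightarrow> \<bar>x\<bar> \<le> 1" "\<forall>c\<in>set cs. fits c" "length us < Z"
  shows "\<exists>n\<le>length cs * (count_cost (length us) (length vs) (length es) + 2).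
    out 17 [val_of_list val_of_nat cs, val_of_list (\<lambda>u. val_of_pair (u, g u)) us, val_of_list val_of_nat vs,
      enc_vec rw, val_of_list val_of_pair es, Num (int (length us))] = Some (n, Num (hi_value es g us vs cs rw))"
  using assms(6)
proof (induction cs)
  case Nil
  show ?case by (rule outcome_le) (simp_all add: hi_body_def hi_value_def)
next
  case (Cons c cs)
  obtain n where n: "n \<le> length cs * (count_cost (length us) (length vs) (length es) + 2)"
    "out 17 [val_of_list val_of_nat cs, val_of_list (\<lambda>u. val_of_pair (u, g u)) us, val_of_list val_of_nat vs,
      enc_vec rw, val_of_list val_of_pair es, Num (int (length us))] = Some (n, Num (hi_value es g us vs cs rw))"
    using Cons by auto
  obtain n2 where n2: "n2 \<le> count_cost (length us) (length vs) (length es)"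
    "out 16 [val_of_list (\<lambda>u. val_of_pair (u, g u)) us, Num (int c), val_of_list val_of_nat vs, enc_vec rw,
      val_of_list val_of_pair es, Num 1, Num 1] = Some (n2, Num (color_count es g us c vs rw 1 True))"
    using out_count[of us g vs es rw 1 c True] assms Cons.prems by auto
  have "\<bar>color_count es g us c vs rw 1 True\<bar> < int Z" "\<bar>hi_value es g us vs cs rw\<bar> < int Z"
    using color_count_bounds[of es g us c vs rw 1 True] hi_value_bounds[of es g us vs cs rw] assms(7) by auto
  then have f: "val_size (Num (color_count es g us c vs rw 1 True)) \<le> Z" "val_size (Num (hi_value es g us vs cs rw)) \<le> Z"
    by auto
  have hi: "hi_value es g us vs (c # cs) rw = min (color_count es g us c vs rw 1 True) (hi_value es g us vs cs rw)"
    by (simp add: hi_value_def)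
  show ?case
    by (rule outcome_le) (use n n2 f in \<open>simp_all add: hi_body_def val_of_nat_def[of c] hi min_def\<close>)
qed

lemma out_lo:
  assumes "\<forall>u\<in>set us. fits u \<and> fits (g u)" "\<forall>v\<in>set vs. fits v" "\<forall>(a, b)\<in>set es. fits a \<and> fits b"
    and "length vs = length rw" "\<And>x. x \<in> set rw \<Longrightarrow> \<bar>x\<bar> \<le> 1" "\<forall>c\<in>set cs. fits c"
    and "0 \<le> w" "int (length us) + w < int Z"
  shows "\<exists>n\<le>length cs * (count_cost (length us) (length vs) (length es) + 2).
    out 18 [val_of_list val_of_nat cs, val_of_list (\<lambda>u. val_of_pair (u, g u)) us, val_of_list val_of_nat vs,
      enc_vec rw, val_of_list val_of_pair es, Num w] = Some (n, Num (lo_value es g us vs cs w rw))"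
  using assms(6)
proof (induction cs)
  case Nil
  show ?case by (rule outcome_le) (simp_all add: lo_body_def lo_value_def)
next
  case (Cons c cs)
  obtain n where n: "n \<le> length cs * (count_cost (length us) (length vs) (length es) + 2)"
    "out 18 [val_of_list val_of_nat cs, val_of_list (\<lambda>u. val_of_pair (u, g u)) us, val_of_list val_of_nat vs,
      enc_vec rw, val_of_list val_of_pair es, Num w] = Some (n, Num (lo_value es g us vs cs w rw))"
    using Cons by auto
  obtain n2 where n2: "n2 \<le> count_cost (length us) (length vs) (length es)"
    "out 16 [val_of_list (\<lambda>u. val_of_pair (u, g u)) us, Num (int c), val_of_list val_of_nat vs, enc_vec rw,
      val_of_list val_of_pair es, Num 0, Num 0] = Some (n2, Num (color_count es g us c vs rw 0 False))"
    using out_count[of us g vs es rw 0 c False] assms Cons.prems by auto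
  have "\<bar>color_count es g us c vs rw 0 False\<bar> < int Z" "\<bar>lo_value es g us vs cs w rw\<bar> < int Z" "\<bar>w\<bar> < int Z"
    "\<bar>color_count es g us c vs rw 0 False - w\<bar> < int Z"
    using color_count_bounds[of es g us c vs rw 0 False] lo_value_bounds[OF assms(7), of es g us vs cs rw] assms(7,8)
    by auto
  then have f: "val_size (Num (color_count es g us c vs rw 0 False)) \<le> Z" "val_size (Num (lo_value es g us vs cs w rw)) \<le> Z"
     "val_size (Num w) \<le> Z" "val_size (Num (color_count es g us c vs rw 0 False - w)) \<le> Z"
    by auto
  have lo: "lo_value es g us vs (c # cs) w rw = max (color_count es g us c vs rw 0 False - w) (lo_value es g us vs cs w rw)"
    by (simp add: lo_value_def)
  show ?case
    by (rule outcome_le) (use n n2 f in \<open>simp_all add: lo_body_def val_of_nat_def[of c] lo max_def\<close>)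
qed

lemma out_rows:
  assumes "\<forall>u\<in>set us. fits u \<and> fits (g u)" "\<forall>v\<in>set vs. fits v" "\<forall>(a, b)\<in>set es. fits a \<and> fits b"
    and "\<forall>c\<in>set cs. fits c" "0 \<le> l" "l \<le> int (length us)" "int (length us) * (int (length vs) + 2) < int Z" "int (length vs) + 1 < int Z"
    and "\<forall>rw\<in>set rws. length rw = length vs \<and> (\<forall>x\<in>set rw. \<bar>x\<bar> \<le> 1)"
  shows "\<exists>n\<le>length rws * (2 * (length cs * (count_cost (length us) (length vs) (length es) + 2)) + length vs + 4).
    out 19 [enc_vecs rws, val_of_list (\<lambda>u. val_of_pair (u, g u)) us, val_of_list val_of_nat vs,
      val_of_list val_of_pair es, val_of_list val_of_nat cs, Num l, Num (int (length us))]
      = Some (n, enc_constrs (make_rows es g us vs cs l rws))"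
  using assms(9)
proof (induction rws)
  case Nil
  show ?case by (rule outcome_le) (simp_all add: rows_body_def make_rows_def)
next
  case (Cons rw rws)
  define c where "c = length cs * (count_cost (length us) (length vs) (length es) + 2)"
  have rw: "length vs = length rw" "\<And>x. x \<in> set rw \<Longrightarrow> \<bar>x\<bar> \<le> 1" using Cons.prems by auto
  have usZ: "int (length us) < int Z"
  proof -
    have "int (length us) * 1 \<le> int (length us) * (int (length vs) + 2)" by (intro mult_left_mono) auto
    from order_le_less_trans[OF this assms(7)] show ?thesis by simp
  qed
  have dd: "0 \<le> dotp rw rw" "dotp rw rw \<le> int (length vs)"
  proof -
    show "0 \<le> dotp rw rw" by (rule dotp_self_nonneg)
    have "\<bar>dotp rw rw\<bar> \<le> int (length rw) * (1 * 1)" using rw(2) by (intro abs_dotp_le) auto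
    then show "dotp rw rw \<le> int (length vs)" using rw(1) by simp
  qed
  have w: "0 \<le> l * dotp rw rw" using assms(5) dd by simp
  have "l * dotp rw rw \<le> int (length us) * int (length vs)" using assms(5,6) dd by (intro mult_mono) auto
  then have w2: "int (length us) + l * dotp rw rw < int Z" using assms(7) by (simp add: algebra_simps)
  obtain n where n: "n \<le> length rws * (2 * c + length vs + 4)"
    "out 19 [enc_vecs rws, val_of_list (\<lambda>u. val_of_pair (u, g u)) us, val_of_list val_of_nat vs,
      val_of_list val_of_pair es, val_of_list val_of_nat cs, Num l, Num (int (length us))]
      = Some (n, enc_constrs (make_rows es g us vs cs l rws))"
    using Cons by (auto simp: c_def)
  have "\<exists>n\<le>length rw. out 1 [enc_vec rw, enc_vec rw] = Some (n, Num (dotp rw rw))"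
    by (rule out_dot[of rw rw 1 1]) (use rw Z assms(8) in auto)
  then obtain n2 where n2: "n2 \<le> length vs" "out 1 [enc_vec rw, enc_vec rw] = Some (n2, Num (dotp rw rw))"
    using rw(1) by auto
  obtain n3 where n3: "n3 \<le> c" "out 17 [val_of_list val_of_nat cs, val_of_list (\<lambda>u. val_of_pair (u, g u)) us, val_of_list val_of_nat vs,
      enc_vec rw, val_of_list val_of_pair es, Num (int (length us))] = Some (n3, Num (hi_value es g us vs cs rw))"
    using out_hi[OF assms(1-3) rw assms(4)] usZ by (auto simp: c_def)
  obtain n4 where n4: "n4 \<le> c" "out 18 [val_of_list val_of_nat cs, val_of_list (\<lambda>u. val_of_pair (u, g u)) us, val_of_list val_of_nat vs,
      enc_vec rw, val_of_list val_of_pair es, Num (l * dotp rw rw)] = Some (n4, Num (lo_value es g us vs cs (l * dotp rw rw) rw))"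
    using out_lo[OF assms(1-3) rw assms(4) w w2] by (auto simp: c_def)
  have cost: "n + n2 + n3 + n4 + 4 \<le> length (rw # rws) * (2 * c + length vs + 4)"
    using n(1) n2(1) n3(1) n4(1) by simp
  have "\<bar>l\<bar> < int Z" "\<bar>dotp rw rw\<bar> < int Z" using assms(5,6,8) usZ dd by auto
  then have f: "val_size (Num l) \<le> Z" "val_size (Num (dotp rw rw)) \<le> Z" by auto
  have "wp Z program [enc_vecs (rw # rws), val_of_list (\<lambda>u. val_of_pair (u, g u)) us, val_of_list val_of_nat vs,
      val_of_list val_of_pair es, val_of_list val_of_nat cs, Num l, Num (int (length us))] (program ! 19)
      (\<lambda>n a. n \<le> length (rw # rws) * (2 * c + length vs + 4) \<and> a = enc_constrs (make_rows es g us vs cs l (rw # rws)))"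
    using n(2) n2(2) n3(2) n4(2) cost f by (simp add: rows_body_def make_rows_def del: mult_Suc mult_Suc_right)
  from outcome_le[OF this] show ?case by (simp add: c_def)
qed

end

section \<open>The rows of an encoded instance\<close>

lemma all_vectors_01D:
  assumes "rw \<in> set (all_vectors d 0 2)"
  shows "length rw = d" "set rw \<subseteq> {0, 1}"
proof -
  have *: "length rw = d" "\<forall>x\<in>set rw. 0 \<le> x \<and> x < 2" using assms by (auto simp: set_all_vectors)
  then show "length rw = d" by simp
  show "set rw \<subseteq> {0, 1}" using *(2) by fastforce
qed

definition support :: "nat list \<Rightarrow> int list \<Rightarrow> nat set" where
  "support vs rw = (\<lambda>i. vs ! i) ` {i. i < length vs \<and> rw ! i = 1}"

lemma support_subset: "support vs rw \<subseteq> set vs"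
  by (auto simp: support_def)

lemma touches_iff:
  "length rw = length vs \<Longrightarrow> touches es u vs rw b \<longleftrightarrow> (\<exists>i<length vs. rw ! i = b \<and> (u, vs ! i) \<in> set es)"
  by (auto simp: touches_def list_ex_iff set_zip)

lemma sum_support:
  assumes "distinct vs" "length rw = length vs" "set rw \<subseteq> {0, 1}"
  shows "sum a (support vs rw) = (\<Sum>i<length vs. rw ! i * a (vs ! i))"
proof -
  let ?J = "{i. i < length vs \<and> rw ! i = 1}"
  have "sum a (support vs rw) = (\<Sum>i\<in>?J. a (vs ! i))"
    unfolding support_def using assms(1) by (subst sum.reindex) (auto intro: inj_on_nth)
  also have "\<dots> = (\<Sum>i<length vs. if rw ! i = 1 then a (vs ! i) else 0)"
    by (subst sum.inter_filter[symmetric]) (auto intro: sum.cong)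
  also have "\<dots> = (\<Sum>i<length vs. rw ! i * a (vs ! i))"
  proof (rule sum.cong[OF refl])
    fix i assume "i \<in> {..<length vs}"
    then have "rw ! i \<in> set rw" using assms(2) by simp
    then show "(if rw ! i = 1 then a (vs ! i) else 0) = rw ! i * a (vs ! i)" using assms(3) by auto
  qed
  finally show ?thesis .
qed

lemma dotp_map: "length rw = length vs \<Longrightarrow> dotp rw (map a vs) = (\<Sum>i<length vs. rw ! i * a (vs ! i))"
  by (simp add: dotp_nth)

lemma dotp_self_support:
  assumes "distinct vs" "length rw = length vs" "set rw \<subseteq> {0, 1}"
  shows "dotp rw rw = int (card (support vs rw))"
proof -
  have "int (card (support vs rw)) = sum (\<lambda>_. 1) (support vs rw)" by simp
  also have "\<dots> = (\<Sum>i<length vs. rw ! i * 1)" by (rule sum_support[OF assms])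
  also have "\<dots> = dotp rw rw"
    unfolding dotp_nth[OF refl] assms(2)
  proof (rule sum.cong[OF refl])
    fix i assume "i \<in> {..<length vs}"
    then have "rw ! i \<in> set rw" using assms(2) by simp
    then show "rw ! i * 1 = rw ! i * rw ! i" using assms(3) by auto
  qed
  finally show ?thesis ..
qed

lemma indicator_row:
  assumes "S \<subseteq> set vs"
  shows "map (\<lambda>v. if v \<in> S then 1 else 0) vs \<in> set (all_vectors (length vs) 0 2)"
    and "support vs (map (\<lambda>v. if v \<in> S then 1 else 0) vs) = S"
  using assms by (auto simp: set_all_vectors support_def in_set_conv_nth subset_eq split: if_splits)

lemma Min_insert_foldr: "Min (insert (n::int) (f ` set cs)) = foldr (\<lambda>c. min (f c)) cs n"
proof (induction cs)
  case (Cons c cs)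
  have "Min (insert n (f ` set (c # cs))) = Min (insert (f c) (insert n (f ` set cs)))"
    by (simp add: insert_commute)
  also have "\<dots> = min (f c) (Min (insert n (f ` set cs)))" by (subst Min_insert) auto
  finally show ?case by (simp add: Cons)
qed simp

lemma Max_insert_foldr: "Max (insert (n::int) (f ` set cs)) = foldr (\<lambda>c. max (f c)) cs n"
proof (induction cs)
  case (Cons c cs)
  have "Max (insert n (f ` set (c # cs))) = Max (insert (f c) (insert n (f ` set cs)))"
    by (simp add: insert_commute)
  also have "\<dots> = max (f c) (Max (insert n (f ` set cs)))" by (subst Max_insert) auto
  finally show ?case by (simp add: Cons)
qed simp

locale encoded_instance =
  fixes I :: "(nat, nat) mmfm" and us vs cs :: "nat list" and es :: "(nat \<times> nat) list"
  assumes inst: "mmfm_instance I"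
    and us: "distinct us" "set us = left I" and vs: "distinct vs" "set vs = right I"
    and es: "distinct es" "set es = {(u, v). u \<in> left I \<and> v \<in> right I \<and> {u, v} \<in> edges I}"
    and cs: "distinct cs" "set cs = colors I"
begin

abbreviation "k \<equiv> length vs"
abbreviation "n \<equiv> length us"

definition allowance :: int where
  "allowance = int (min (fairness I) n)"

definition base_rows :: "constr list" where
  "base_rows = make_rows es (coloring I) us vs cs allowance (all_vectors k 0 2)"

definition candidates :: "int list list" where
  "candidates = all_vectors k (- int (k + 1)) (2 * (k + 1) + 1)"

lemma card_left: "card (left I) = n"
  using us distinct_card by metis

lemma hi_value_eq:
  assumes "rw \<in> set (all_vectors k 0 2)"
  shows "hi_value es (coloring I) us vs cs rw = hi_bound I (support vs rw)"
proof -
  have rw: "length rw = k" using assms by (simp add: set_all_vectors)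
  have "touches es u vs rw 1 \<longleftrightarrow> nbrs I u \<inter> support vs rw \<noteq> {}" if "u \<in> left I" for u
    using that vs(2) nth_mem[of _ vs] by (fastforce simp: touches_iff[OF rw] nbrs_def support_def es(2))
  then have "color_count es (coloring I) us c vs rw 1 True
      = int (card {u \<in> left I. coloring I u = c \<and> nbrs I u \<inter> support vs rw \<noteq> {}})" for c
    unfolding color_count_def using us
    by (subst distinct_length_filter) (auto intro!: arg_cong[where f = card])
  then show ?thesis
    unfolding hi_bound_def hi_value_def card_left cs(2)[symmetric] Min_insert_foldr by simp
qed

lemma lo_value_eq:
  assumes "rw \<in> set (all_vectors k 0 2)"
  shows "lo_value es (coloring I) us vs cs (allowance * dotp rw rw) rw = lo_bound I (support vs rw)"
proof -
  note rw = all_vectors_01D[OF assms]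
  have "\<not> touches es u vs rw 0 \<longleftrightarrow> nbrs I u \<subseteq> support vs rw" if u: "u \<in> left I" for u
  proof -
    have "\<not> touches es u vs rw 0 \<longleftrightarrow> (\<forall>i<k. (u, vs ! i) \<in> set es \<longrightarrow> rw ! i = 1)"
    proof -
      have "rw ! i \<noteq> 0 \<longleftrightarrow> rw ! i = 1" if "i < k" for i
      proof -
        have "rw ! i \<in> {0, 1}" using subsetD[OF rw(2) nth_mem[of i rw]] rw(1) that by simp
        then show ?thesis by auto
      qed
      then show ?thesis by (auto simp: touches_iff[OF rw(1)])
    qed
    also have "\<dots> \<longleftrightarrow> (\<forall>v\<in>set vs. (u, v) \<in> set es \<longrightarrow> v \<in> support vs rw)"
    proof -
      have "vs ! i \<in> support vs rw \<longleftrightarrow> rw ! i = 1" if "i < k" for i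
        using that vs(1) by (auto simp: support_def nth_eq_iff_index_eq)
      then show ?thesis by (metis in_set_conv_nth)
    qed
    also have "\<dots> \<longleftrightarrow> nbrs I u \<subseteq> support vs rw" using u vs(2) by (auto simp: nbrs_def es(2))
    finally show ?thesis .
  qed
  then have "color_count es (coloring I) us c vs rw 0 False
      = int (card {u \<in> left I. coloring I u = c \<and> nbrs I u \<subseteq> support vs rw})" for c
    unfolding color_count_def using us
    by (subst distinct_length_filter) (auto intro!: arg_cong[where f = card])
  then show ?thesis
    unfolding lo_bound_def lo_value_def card_left cs(2)[symmetric] Max_insert_foldr
      dotp_self_support[OF vs(1) rw] allowance_def by simp
qed

lemma base_rows_iff:
  "C \<in> set base_rows \<longleftrightarrow> (\<exists>rw\<in>set (all_vectors k 0 2).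
     C = (rw, lo_bound I (support vs rw), hi_bound I (support vs rw)))"
  by (auto simp: base_rows_def make_rows_def lo_value_eq hi_value_eq)

lemma base_rows_ok: "constrs_ok k base_rows"
proof -
  have "vec_ok k rw" if "rw \<in> set (all_vectors k 0 2)" for rw
    using that by (force simp: set_all_vectors vec_ok_def)
  then show ?thesis unfolding constrs_ok_def using base_rows_iff by auto
qed

lemma candidates_iff: "v \<in> set candidates \<longleftrightarrow> vec_ok k v"
  unfolding candidates_def set_all_vectors vec_ok_def by (auto simp: abs_le_iff)

text \<open>The 0/1 rows run through all sets of right vertices, singletons giving the unit rows.
  All admissible directions are candidates at the start, which establishes the invariant of
  \<open>solve_sound\<close>.\<close>

lemma solve_correct: "solve (algo_params k n) base_rows [] candidates \<longleftrightarrow> mmfm_yes I"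
proof
  assume yes: "mmfm_yes I"
  then obtain a where a: "\<And>S. S \<subseteq> right I \<Longrightarrow> lo_bound I S \<le> sum a S \<and> sum a S \<le> hi_bound I S"
    unfolding yes_iff_integer_point[OF inst] by blast
  have finC: "finite (colors I)" using inst by (simp add: mmfm_instance_def)
  \<comment> \<open>The rows of singletons confine every unknown to the box for which the fuel of
    the perceptron is calculated.\<close>
  have a_range: "0 \<le> a v \<and> a v \<le> int n" if "v \<in> set vs" for v
  proof -
    have "lo_bound I {v} \<ge> 0" unfolding lo_bound_def using finC by (intro Max_ge) auto
    moreover have "hi_bound I {v} \<le> int n"
      unfolding hi_bound_def card_left using finC by (intro Min_le) auto
    ultimately show ?thesis using a[of "{v}"] that vs(2) by auto
  qed
  show "solve (algo_params k n) base_rows [] candidates"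
  proof (rule solve_complete[OF refl base_rows_ok, where z = "map a vs"])
    show "sat (map a vs) C" if C: "C \<in> set base_rows" for C
    proof -
      obtain rw where rw: "rw \<in> set (all_vectors k 0 2)"
        "C = (rw, lo_bound I (support vs rw), hi_bound I (support vs rw))"
        using iffD1[OF base_rows_iff C] by (rule bexE)
      note len = all_vectors_01D[OF rw(1)]
      have "support vs rw \<subseteq> right I" using support_subset[of vs rw] vs(2) by simp
      moreover have "dotp rw (map a vs) = sum a (support vs rw)"
        unfolding dotp_map[OF len(1)] by (rule sum_support[OF vs(1) len, symmetric])
      ultimately show ?thesis using a by (simp add: rw(2) sat_def)
    qed
    show "\<forall>v\<in>set [] \<union> set candidates. vec_ok k v" using candidates_iff by simp
    show "0 \<le> x \<and> x \<le> int n" if "x \<in> set (map a vs)" for x using that a_range by auto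
  qed simp
next
  assume "solve (algo_params k n) base_rows [] candidates"
  then have "\<exists>z. length z = k \<and> (\<forall>C\<in>set base_rows. sat z C)"
  proof (rule solve_sound[OF refl base_rows_ok subset_refl, rotated -1])
    show "\<bar>x\<bar> \<le> 1" if "(a, lo, hi) \<in> set base_rows" "x \<in> set a" for a lo hi x
      using that unfolding base_rows_iff by (force simp: set_all_vectors)
    show "\<exists>lo hi. (map (\<lambda>j. if j = c then 1 else 0) [0..<k], lo, hi) \<in> set base_rows" if "c < k" for c
      unfolding base_rows_iff by (auto simp: set_all_vectors)
    show "\<forall>v\<in>set [] \<union> set candidates. vec_ok k v" using candidates_iff by simp
    show "(\<exists>t. (v, t, t) \<in> set base_rows) \<or> v \<in> set [] \<and>
        length (possible_values (algo_params k n) base_rows v) > threshold (algo_params k n) \<or> v \<in> set candidates"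
      if "vec_ok k v" for v using that candidates_iff by blast
  qed
  then obtain z where z: "length z = k" "\<And>C. C \<in> set base_rows \<Longrightarrow> sat z C" by blast
  define a where "a v = z ! (THE i. i < k \<and> vs ! i = v)" for v
  have "a (vs ! i) = z ! i" if "i < k" for i
  proof -
    have "(THE j. j < k \<and> vs ! j = vs ! i) = i"
      using that vs(1) by (intro the_equality) (auto simp: nth_eq_iff_index_eq)
    then show ?thesis by (simp add: a_def)
  qed
  then have az: "map a vs = z" using z(1) by (intro nth_equalityI) auto
  have "lo_bound I S \<le> sum a S \<and> sum a S \<le> hi_bound I S" if S: "S \<subseteq> right I" for S
  proof -
    define rw where "rw = map (\<lambda>v. if v \<in> S then 1 else (0::int)) vs"
    have rw: "rw \<in> set (all_vectors k 0 2)" "support vs rw = S"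
      unfolding rw_def using indicator_row[of S vs] S vs(2) by auto
    note len = all_vectors_01D[OF rw(1)]
    have "sat z (rw, lo_bound I S, hi_bound I S)"
      by (rule z(2), rule iffD2[OF base_rows_iff], rule bexI[OF _ rw(1)]) (simp add: rw(2))
    moreover have "dotp rw z = sum a S"
      unfolding az[symmetric] dotp_map[OF len(1)] sum_support[OF vs(1) len, symmetric] rw(2) ..
    ultimately show ?thesis by (simp add: sat_def)
  qed
  then show "mmfm_yes I" unfolding yes_iff_integer_point[OF inst] by blast
qed

end

section \<open>Total cost\<close>


definition row_cost :: "nat \<Rightarrow> nat \<Rightarrow> nat" where
  "row_cost k N = 2 * (N * (count_cost N k N + 2)) + k + 4"

definition vectors_cost :: "nat \<Rightarrow> nat \<Rightarrow> nat" where
  "vectors_cost k m = k * (m * (m ^ k + 2) + 2)"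

definition call_cost :: "nat \<Rightarrow> nat \<Rightarrow> nat \<Rightarrow> nat" where
  "call_cost solve_cost k N = vectors_cost k 2 + 2 ^ k * row_cost k N + vectors_cost k (2 * k + 3) +
     solve_cost + N + 3 * k + 15"

context algo
begin

text \<open>Base rows and candidates together bound the constraints and pending rows of every node,
  since a branch turns a pending row into a constraint.\<close>

definition solve_cost :: nat where
  "solve_cost = (let c = (2 * k + 3) ^ k in
     node_cost (2 ^ k + c) * (threshold p + 1) ^ k * (c\<^sup>2 + c + 1))"

text \<open>The conditions \<open>ZN\<close> cover the intermediate products of the setup, written
  in the order in which the program multiplies.\<close>

lemma out_main:
  assumes "encoded_instance I us vs cs es" and len: "length vs = k" "length us = n"
    and fits: "\<forall>u\<in>set us. fits u \<and> fits (coloring I u)" "\<forall>v\<in>set vs. fits v"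
      "\<forall>(a, b)\<in>set es. fits a \<and> fits b" "\<forall>c\<in>set cs. fits c" "fits (fairness I)"
    and N: "n \<le> N" "length es \<le> N" "length cs \<le> N"
    and ZN: "int n * (int k + 2) < int Z" "int n < int Z" "3 * K + 2 < int Z" "K * K * (K * K) < int Z"
      "K * (K * K) * (K * (K * K)) < int Z" "int n * int n < int Z" "R * R < int Z" "R * R * (int n * int n) < int Z"
      "(2 * (K * K)) ^ k < int Z" "K * K * (K * K) * (2 * (K * K)) ^ k < int Z"
  shows "\<exists>m\<le>call_cost solve_cost k N.
    out 0 [Node (val_of_list (\<lambda>u. val_of_pair (u, coloring I u)) us)
           (Node (val_of_list val_of_nat vs)
           (Node (val_of_list val_of_pair es)
           (Node (val_of_list val_of_nat cs)
                 (val_of_nat (fairness I)))))] = Some (m, enc_bool (mmfm_yes I))"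
proof -
  interpret e: encoded_instance I us vs cs es by fact
  let ?us = "val_of_list (\<lambda>u. val_of_pair (u, coloring I u)) us" and ?vs = "val_of_list val_of_nat vs"
  let ?es = "val_of_list val_of_pair es" and ?cs = "val_of_list val_of_nat cs"
  have K: "K \<ge> 1" "K = int (k + 1)" "2 * K + 1 = int (2 * k + 3)" by (auto simp: K_def)
  have KK: "K * K \<ge> 1" "K \<le> K * K" "K * K \<le> K * (K * K)"
  proof -
    show "K \<le> K * K" using mult_left_mono[OF K(1), of K] K(1) by simp
    then show "K * K \<ge> 1" using K(1) by linarith
    show "K * K \<le> K * (K * K)" using mult_right_mono[OF K(1), of "K * K"] K(1) by simp
  qed
  have nn: "int n * int n \<ge> 0" "R * R \<ge> 0" "R * R * (int n * int n) \<ge> 0" using params by simp_all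
  have K3: "K * (K * K) \<ge> 1" "K * (K * K) \<le> K * (K * K) * (K * (K * K))" "K * K \<le> K * K * (K * K)"
  proof -
    show *: "K * (K * K) \<ge> 1" using KK by linarith
    show "K * (K * K) \<le> K * (K * K) * (K * (K * K))"
      using mult_left_mono[OF *, of "K * (K * K)"] * by simp
    show "K * K \<le> K * K * (K * K)" using mult_left_mono[OF KK(1), of "K * K"] KK(1) by simp
  qed
  define pw where "pw = (2 * (K * K)) ^ k"
  have pw: "pw \<ge> 1" unfolding pw_def using KK(1) by (intro one_le_power) simp
  have R_eq: "R = 32 * (K * K * (K * K) * pw)"
    by (simp add: R_def p_def algo_params_def Let_def relation_bound_def K_def pw_def power_numeral_reduce algebra_simps)
  have s_eq: "s = K * (K * K)"
    by (simp add: s_def p_def algo_params_def Let_def K_def power3_eq_cube algebra_simps)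
  have F_eq: "int (fuel p) = K * (R * R * (int n * int n))"
    by (simp add: R_def p_def algo_params_def Let_def K_def power2_eq_square algebra_simps)
  have H_eq: "H = K * K * int n"
    by (simp add: H_def p_def algo_params_def Let_def K_def power2_eq_square algebra_simps)
  have W_eq: "int (threshold p) = 4096 * (K * (K * K) * (K * (K * K)))"
    by (simp add: p_def algo_params_def Let_def K_def power_numeral_reduce algebra_simps)
  \<comment> \<open>The parameters in exactly the shape of the products that
    \<open>start_body\<close> computes, so that the simplifier recognizes its argument.\<close>
  have enc: "enc_p = Node (Num R) (Node (Num (K * (K * K))) (Node (Num (K * (R * R * (int n * int n))))
     (Node (enc_vec (replicate k 0)) (Node (Num (K * K * int n)) (Num (4096 * (K * (K * K) * (K * (K * K)))))))))"
    unfolding enc_p s_eq F_eq H_eq W_eq ..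
  have sz: "\<bar>K\<bar> < int Z" "\<bar>K * K\<bar> < int Z" "\<bar>K * (K * K)\<bar> < int Z" "\<bar>K * (K * K) * (K * (K * K))\<bar> < int Z"
    "\<bar>int n\<bar> < int Z" "\<bar>int n * int n\<bar> < int Z" "\<bar>R\<bar> < int Z" "\<bar>R * R\<bar> < int Z" "\<bar>R * R * (int n * int n)\<bar> < int Z"
    "\<bar>K * K * (K * K)\<bar> < int Z" "\<bar>pw\<bar> < int Z" "\<bar>2 * K\<bar> < int Z" "\<bar>int k\<bar> < int Z"
    "\<bar>K * K * (K * K) * pw\<bar> < int Z"
  proof -
    show "\<bar>K\<bar> < int Z" "\<bar>2 * K\<bar> < int Z" using ZN(3) K(1) by linarith+
    show "\<bar>int k\<bar> < int Z" using ZN(3) K(2) by linarith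
    show "\<bar>K * K\<bar> < int Z" "\<bar>K * K * (K * K)\<bar> < int Z" using ZN(4) KK K3 by linarith+
    show "\<bar>K * (K * K)\<bar> < int Z" "\<bar>K * (K * K) * (K * (K * K))\<bar> < int Z" using ZN(5) KK K3 by linarith+
    show "\<bar>int n\<bar> < int Z" "\<bar>int n * int n\<bar> < int Z" using ZN(2,6) nn by linarith+
    show "\<bar>R\<bar> < int Z" using Z_scale params(1) by linarith
    show "\<bar>R * R\<bar> < int Z" "\<bar>R * R * (int n * int n)\<bar> < int Z" using ZN(7,8) nn by linarith+
    show "\<bar>pw\<bar> < int Z" using ZN(9) pw unfolding pw_def by linarith
    have "K * K * (K * K) * pw \<ge> 0" using KK pw by simp
    then show "\<bar>K * K * (K * K) * pw\<bar> < int Z" using ZN(10) unfolding pw_def by linarith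
  qed
  obtain m1 where m1: "m1 \<le> vectors_cost k 2" "out 12 [?vs, Num 0, Num 2] = Some (m1, enc_vecs (all_vectors k 0 2))"
    using out_vectors[of 0 2 vs val_of_nat] Z len by (auto simp: vectors_cost_def)
  have "\<exists>m\<le>length (all_vectors k 0 2) * (2 * (length cs * (count_cost (length us) (length vs) (length es) + 2)) + length vs + 4).
    out 19 [enc_vecs (all_vectors k 0 2), ?us, ?vs, ?es, ?cs, Num e.allowance, Num (int (length us))]
      = Some (m, enc_constrs (make_rows es (coloring I) us vs cs e.allowance (all_vectors k 0 2)))"
  proof (rule out_rows[OF fits(1-4)])
    show "0 \<le> e.allowance" "e.allowance \<le> int (length us)" by (auto simp: e.allowance_def)
    show "int (length us) * (int (length vs) + 2) < int Z" using ZN(1) len by simp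
    show "int (length vs) + 1 < int Z" using ZN(3) K(2) len by simp
    show "\<forall>rw\<in>set (all_vectors k 0 2). length rw = length vs \<and> (\<forall>x\<in>set rw. \<bar>x\<bar> \<le> 1)"
      using len by (auto simp: set_all_vectors)
  qed
  moreover have "length (all_vectors k 0 2) * (2 * (length cs * (count_cost (length us) (length vs) (length es) + 2)) + length vs + 4)
      \<le> 2 ^ k * row_cost k N"
    unfolding length_all_vectors row_cost_def count_cost_def len
    by (intro mult_le_mono add_mono order_refl N)
  ultimately obtain m2 where m2: "m2 \<le> 2 ^ k * row_cost k N"
    "out 19 [enc_vecs (all_vectors k 0 2), ?us, ?vs, ?es, ?cs, Num e.allowance, Num (int n)] = Some (m2, enc_constrs e.base_rows)"
    unfolding e.base_rows_def len by (meson le_trans)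
  have lo: "\<bar>- K\<bar> + int (2 * k + 3) < int Z" using ZN(3) K by linarith
  have "\<exists>m\<le>k * ((2 * k + 3) * ((2 * k + 3) ^ k + 2) + 2).
     out 12 [?vs, Num (- K), Num (int (2 * k + 3))] = Some (m, enc_vecs (all_vectors k (- K) (2 * k + 3)))"
    by (rule out_vectors[OF lo, of vs val_of_nat, unfolded len]) simp
  moreover have cand: "e.candidates = all_vectors k (- K) (2 * k + 3)"
  proof -
    have "2 * (k + 1) + 1 = 2 * k + 3" by simp
    then show ?thesis unfolding e.candidates_def len K(2) by (simp only:)
  qed
  ultimately obtain m3 where m3: "m3 \<le> vectors_cost k (2 * k + 3)"
    "out 12 [?vs, Num (- K), Num (2 * K + 1)] = Some (m3, enc_vecs e.candidates)"
    unfolding vectors_cost_def K(3) by auto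
  obtain m4 where m4: "m4 \<le> k" "out 20 [?vs] = Some (m4, enc_vec (replicate k 0))"
    using out_zeros[of vs val_of_nat] len by auto
  have len_rows: "length e.base_rows = 2 ^ k" by (simp add: e.base_rows_def make_rows_def length_all_vectors len)
  have len_cand: "length e.candidates = (2 * k + 3) ^ k" by (simp only: cand length_all_vectors)
  have bounded: "bounded_constrs H e.base_rows"
  proof -
    have nH: "int n \<le> H" unfolding H_eq using mult_right_mono[OF KK(1), of "int n"] by simp
    have "0 \<le> lo \<and> lo \<le> int n \<and> 0 \<le> hi \<and> hi \<le> int n" if "(a, lo, hi) \<in> set e.base_rows" for a lo hi
    proof -
      have "0 \<le> e.allowance * dotp a a" by (simp add: e.allowance_def dotp_self_nonneg)
      then show ?thesis
        using that lo_value_bounds[of "e.allowance * dotp a a" es "coloring I" us vs cs a]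
          hi_value_bounds[of es "coloring I" us vs cs a] len
        by (auto simp: e.base_rows_def make_rows_def)
    qed
    then show ?thesis unfolding bounded_constrs_def using nH by fastforce
  qed
  have "\<exists>m\<le>node_cost (2 ^ k + (2 * k + 3) ^ k) * (threshold p + 1) ^ k *
      ((length ([] :: int list list) + length e.candidates)\<^sup>2 + length e.candidates + 1).
    out 8 [enc_constrs e.base_rows, enc_vecs [], enc_vecs e.candidates, enc_p]
      = Some (m, enc_bool (solve p e.base_rows [] e.candidates))"
  proof (rule out_solve[where vb = "[]"])
    show "constrs_ok k e.base_rows" using e.base_rows_ok len by simp
    show "\<forall>v\<in>set [] \<union> set e.candidates. vec_ok k v" using e.candidates_iff len by simp
    show "no_small_relation (relation_bound k) k []" by (simp add: no_small_relation_def)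
  qed (use bounded len_rows len_cand in auto)
  then have solve: "\<exists>m\<le>solve_cost. out 8 [enc_constrs e.base_rows, Num 0, enc_vecs e.candidates, enc_p]
      = Some (m, enc_bool (solve p e.base_rows [] e.candidates))"
    unfolding len_cand solve_cost_def Let_def by (simp only: list.size add_0 val_of_list_simps)
  have yes: "solve p e.base_rows [] e.candidates = mmfm_yes I"
    using e.solve_correct unfolding len p_def .
  define res where "res = enc_bool (mmfm_yes I)"
  obtain m5 where m5: "m5 \<le> solve_cost"
    "out 8 [enc_constrs e.base_rows, Num 0, enc_vecs e.candidates, enc_p] = Some (m5, res)"
    using solve unfolding yes res_def[symmetric] by blast
  note vz = sz[THEN small]
  define T where "T = vectors_cost k 2 + 2 ^ k * row_cost k N + vectors_cost k (2 * k + 3) + k + solve_cost + 5"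
  have T: "m1 + m2 + m3 + m4 + m5 + 5 \<le> T" using m1(1) m2(1) m3(1) m4(1) m5(1) by (simp add: T_def)
  have start: "\<exists>m\<le>T. out 22 [?us, ?vs, ?es, ?cs, Num e.allowance, Num (int n), Num K, Num R] = Some (m, res)"
    by (rule outcome_le)
      (use m1(2) m2(2) m3(2) m4(2) m5(2)[unfolded enc] T vz in \<open>simp_all add: start_body_def\<close>)
  then obtain m6 where m6: "m6 \<le> T"
    "out 22 [?us, ?vs, ?es, ?cs, Num e.allowance, Num (int n), Num K, Num (32 * (K * K * (K * K) * pw))] = Some (m6, res)"
    unfolding R_eq[symmetric] by blast
  have "1 \<le> 2 * (K * K)" "(2 * (K * K)) ^ length vs < int Z" using KK ZN(9) len by auto
  then obtain m7 where m7: "m7 \<le> k" "out 13 [Num (2 * (K * K)), ?vs] = Some (m7, Num pw)"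
    using out_power[of "2 * (K * K)" vs val_of_nat] len by (auto simp: pw_def)
  have fl: "val_size (Num (int (fairness I))) \<le> Z" using fits(5) by (simp add: fits_def)
  have allow: "e.allowance = (if fairness I \<le> n then int (fairness I) else int n)"
    by (auto simp: e.allowance_def len)
  have "\<exists>m\<le>T + k + 2. out 21 [?us, ?vs, ?es, ?cs, Num (int (fairness I)), Num (int n), Num K] = Some (m, res)"
    by (rule outcome_le)
      (use m6 m7 vz fl in \<open>simp_all add: prepare_body_def allow split: if_splits\<close>)
  then obtain m8 where m8: "m8 \<le> T + k + 2"
    "out 21 [?us, ?vs, ?es, ?cs, Num (int (fairness I)), Num (int n), Num K] = Some (m8, res)"
    by blast
  obtain m9 where m9: "m9 \<le> n" "out 6 [?us] = Some (m9, Num (int n))"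
    using out_length[of us] ZN(2) len by auto
  obtain m10 where m10: "m10 \<le> k" "out 6 [?vs] = Some (m10, Num (int k))"
    using out_length[of vs] sz(13) len by auto
  have Kk: "int k + 1 = K" by (simp add: K_def)
  have cost: "m8 + m9 + m10 + 3 \<le> call_cost solve_cost k N"
    using m8(1) m9(1) m10(1) N(1) by (simp add: call_cost_def T_def)
  show ?thesis
    unfolding res_def[symmetric]
    by (rule outcome_le)
      (use m8(2) m9(2) m10(2) vz cost in \<open>simp_all add: main_body_def Kk val_of_nat_def[of "fairness I"]\<close>)
qed

end

text \<open>The base dominates everything that is raised to the power \<open>k\<close>: the numbers
  of rows and candidates, the branching factor and the base of
  \<open>relation_bound\<close>.\<close>

definition exp_factor :: "nat \<Rightarrow> nat" where
  "exp_factor k = (5000 * (k + 1) ^ 6) ^ k"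

text \<open>A class closed under sums, products and fixed powers, so that the time bound is
  classified by its structure alone. The condition \<open>k \<le> N\<close> lets \<open>k\<close>
  itself count as polynomial.\<close>

definition fpt :: "(nat \<Rightarrow> nat \<Rightarrow> nat) \<Rightarrow> bool" where
  "fpt f \<longleftrightarrow> (\<exists>c e j. \<forall>k N. k \<le> N \<longrightarrow> f k N \<le> c * (N + 1) ^ e * exp_factor k ^ j)"

lemma exp_factor_pos: "exp_factor k \<ge> 1"
  unfolding exp_factor_def by (intro one_le_power) simp

lemma fpt_const: "fpt (\<lambda>k N. c)"
  unfolding fpt_def by (intro exI[of _ c] exI[of _ 0] exI[of _ 0]) simp

lemma fpt_k: "fpt (\<lambda>k N. k)"
  unfolding fpt_def by (intro exI[of _ 1] exI[of _ 1] exI[of _ 0]) simp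

lemma fpt_N: "fpt (\<lambda>k N. N)"
  unfolding fpt_def by (intro exI[of _ 1] exI[of _ 1] exI[of _ 0]) simp

lemma fpt_exp: "(\<And>k. h k \<le> 5000 * (k + 1) ^ 6) \<Longrightarrow> fpt (\<lambda>k N. h k ^ k)"
proof -
  assume "\<And>k. h k \<le> 5000 * (k + 1) ^ 6"
  then have "h k ^ k \<le> exp_factor k" for k
    unfolding exp_factor_def by (intro power_mono) auto
  then show ?thesis
    unfolding fpt_def by (intro exI[of _ 1] exI[of _ 0] exI[of _ 1]) simp
qed

lemma fpt_mult: "fpt f \<Longrightarrow> fpt g \<Longrightarrow> fpt (\<lambda>k N. f k N * g k N)"
proof -
  assume "fpt f" "fpt g"
  then obtain c e j c' e' j' where
    f: "\<And>k N. k \<le> N \<Longrightarrow> f k N \<le> c * (N + 1) ^ e * exp_factor k ^ j" and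
    g: "\<And>k N. k \<le> N \<Longrightarrow> g k N \<le> c' * (N + 1) ^ e' * exp_factor k ^ j'"
    unfolding fpt_def by metis
  have "f k N * g k N \<le> (c * c') * (N + 1) ^ (e + e') * exp_factor k ^ (j + j')" if "k \<le> N" for k N
  proof -
    have "f k N * g k N \<le> (c * (N + 1) ^ e * exp_factor k ^ j) * (c' * (N + 1) ^ e' * exp_factor k ^ j')"
      by (intro mult_le_mono f g that)
    also have "\<dots> = (c * c') * (N + 1) ^ (e + e') * exp_factor k ^ (j + j')"
      unfolding power_add by (simp only: mult_ac)
    finally show ?thesis .
  qed
  then show ?thesis unfolding fpt_def by blast
qed

lemma fpt_add: "fpt f \<Longrightarrow> fpt g \<Longrightarrow> fpt (\<lambda>k N. f k N + g k N)"
proof -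
  assume "fpt f" "fpt g"
  then obtain c e j c' e' j' where
    f: "\<And>k N. k \<le> N \<Longrightarrow> f k N \<le> c * (N + 1) ^ e * exp_factor k ^ j" and
    g: "\<And>k N. k \<le> N \<Longrightarrow> g k N \<le> c' * (N + 1) ^ e' * exp_factor k ^ j'"
    unfolding fpt_def by metis
  have "f k N + g k N \<le> (c + c') * (N + 1) ^ (e + e') * exp_factor k ^ (j + j')" if "k \<le> N" for k N
  proof -
    have "f k N \<le> c * (N + 1) ^ (e + e') * exp_factor k ^ (j + j')"
      using f[OF that] by (rule order_trans) (intro mult_le_mono power_increasing order_refl exp_factor_pos; simp)
    moreover have "g k N \<le> c' * (N + 1) ^ (e + e') * exp_factor k ^ (j + j')"
      using g[OF that] by (rule order_trans) (intro mult_le_mono power_increasing order_refl exp_factor_pos; simp)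
    ultimately show ?thesis by (simp only: distrib_right)
  qed
  then show ?thesis unfolding fpt_def by blast
qed

lemma fpt_power: "fpt f \<Longrightarrow> fpt (\<lambda>k N. f k N ^ c)"
proof (induction c)
  case 0
  show ?case using fpt_const[of 1] by simp
next
  case (Suc c)
  then show ?case using fpt_mult[of f "\<lambda>k N. f k N ^ c"] by simp
qed

lemmas fpt_intros = fpt_const fpt_k fpt_N fpt_exp fpt_mult fpt_add fpt_power

text \<open>At \<open>k = 1\<close> the power of \<open>k\<close> leaves no room, hence the factor \<open>320000 = exp_factor 1\<close>.\<close>

lemma exp_factor_le: "exp_factor k ^ j \<le> 320000 ^ j * k ^ (25 * j * k)"
proof -
  consider "k = 0" | "k = 1" | "k \<ge> 2" by linarith
  then show ?thesis
  proof cases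
    case 2
    then have "exp_factor k = 320000" by (simp add: exp_factor_def del: One_nat_def add_2_eq_Suc' add_2_eq_Suc)
    then show ?thesis using 2 by simp
  next
    case 3
    have "(5000::nat) \<le> 2 ^ 13" by simp
    also have "\<dots> \<le> k ^ 13" using 3 by (intro power_mono) auto
    finally have 1: "5000 \<le> k ^ 13" .
    have "k + 1 \<le> k * 2" using 3 by simp
    also have "\<dots> \<le> k ^ 2" using 3 by (simp add: power2_eq_square)
    finally have "(k + 1) ^ 6 \<le> (k ^ 2) ^ 6" by (intro power_mono) auto
    then have "(k + 1) ^ 6 \<le> k ^ 12" by (simp flip: power_mult)
    then have "5000 * (k + 1) ^ 6 \<le> k ^ 13 * k ^ 12" using 1 by (intro mult_le_mono)
    also have "\<dots> = k ^ 25" by (simp flip: power_add)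
    finally have "exp_factor k \<le> (k ^ 25) ^ k" unfolding exp_factor_def by (intro power_mono) auto
    then have "exp_factor k ^ j \<le> ((k ^ 25) ^ k) ^ j" by (intro power_mono) auto
    also have "\<dots> = 1 * k ^ (25 * j * k)" by (simp add: mult_ac flip: power_mult)
    also have "\<dots> \<le> 320000 ^ j * k ^ (25 * j * k)" by (intro mult_le_mono) auto
    finally show ?thesis .
  qed (simp_all add: exp_factor_def)
qed

section \<open>Explicit bounds for the run\<close>

definition scale_bound :: "nat \<Rightarrow> nat" where
  "scale_bound k = 32 * (k + 1) ^ 4 * (2 * (k + 1)\<^sup>2) ^ k"

text \<open>A single monomial dominates every number of the search; its coefficient covers the
  factor \<open>4096\<close> of the threshold, and the summand \<open>N\<close> makes room for the
  names.\<close>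

definition size_bound :: "nat \<Rightarrow> nat \<Rightarrow> nat" where
  "size_bound k N = 12288 * ((k + 1) ^ 6 * (scale_bound k)\<^sup>2 * (N + 1)\<^sup>2) + 6000 + N"

definition perceptron_bound :: "nat \<Rightarrow> nat \<Rightarrow> nat \<Rightarrow> nat" where
  "perceptron_bound k N L = ((k + 1) * (scale_bound k)\<^sup>2 * N\<^sup>2 + 1) * (L * (k + 2) + k + 3)"

definition node_bound :: "nat \<Rightarrow> nat \<Rightarrow> nat \<Rightarrow> nat" where
  "node_bound k N L = (2 * ((k + 1)\<^sup>2 * N) + 1) * (perceptron_bound k N L + 2) + 2 * ((k + 1)\<^sup>2 * N) + L
     + 2 * (4096 * (k + 1) ^ 6) + 10"

definition solve_bound :: "nat \<Rightarrow> nat \<Rightarrow> nat" where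
  "solve_bound k N = node_bound k N (2 ^ k + (2 * k + 3) ^ k) * (4096 * (k + 1) ^ 6 + 1) ^ k *
     (((2 * k + 3) ^ k)\<^sup>2 + (2 * k + 3) ^ k + 1)"

definition time_bound :: "nat \<Rightarrow> nat \<Rightarrow> nat \<Rightarrow> nat" where
  "time_bound M k N = 2 + (M + call_cost (solve_bound k N) k N * M) * (2 * size_bound k N + 1)"

lemma self_le_power_6: "k + 1 \<le> (k + 1) ^ 6" for k :: nat
  using power_increasing[of 1 6 "k + 1"] by simp

lemma fpt_time_bound: "fpt (time_bound M)"
proof -
  have e: "fpt (\<lambda>k N. 2 ^ k)" "fpt (\<lambda>k N. (2 * k + 3) ^ k)" "fpt (\<lambda>k N. (4096 * (k + 1) ^ 6 + 1) ^ k)"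
    "fpt (\<lambda>k N. (2 * (k + 1)\<^sup>2) ^ k)"
  proof -
    have 1: "1 \<le> (k + 1) ^ 6" for k :: nat by (intro one_le_power) simp
    have "2 \<le> 5000 * (k + 1) ^ 6" "2 * k + 3 \<le> 5000 * (k + 1) ^ 6" "4096 * (k + 1) ^ 6 + 1 \<le> 5000 * (k + 1) ^ 6" for k :: nat
      using 1[of k] self_le_power_6[of k] by linarith+
    then show "fpt (\<lambda>k N. 2 ^ k)" "fpt (\<lambda>k N. (2 * k + 3) ^ k)" "fpt (\<lambda>k N. (4096 * (k + 1) ^ 6 + 1) ^ k)"
      by (intro fpt_exp; blast)+
    have "2 * (k + 1)\<^sup>2 \<le> 5000 * (k + 1) ^ 6" for k :: nat
      by (intro mult_le_mono power_increasing) auto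
    then show "fpt (\<lambda>k N. (2 * (k + 1)\<^sup>2) ^ k)" by (intro fpt_exp)
  qed
  have s: "fpt (\<lambda>k N. scale_bound k)" unfolding scale_bound_def by (intro e fpt_intros)
  have z: "fpt (\<lambda>k N. size_bound k N)" unfolding size_bound_def by (intro s fpt_intros)
  have "fpt (\<lambda>k N. solve_bound k N)"
    unfolding solve_bound_def node_bound_def perceptron_bound_def by (intro e s fpt_intros)
  then show ?thesis
    unfolding time_bound_def call_cost_def vectors_cost_def row_cost_def count_cost_def
    by (intro e z fpt_intros)
qed

lemma scale_eq: "scale (algo_params k n) = int (scale_bound k)"
  by (simp add: algo_params_def Let_def relation_bound_def scale_bound_def)

lemma fuel_eq: "fuel (algo_params k n) = (k + 1) * (scale_bound k)\<^sup>2 * n\<^sup>2"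
  by (simp add: algo_params_def Let_def relation_bound_def scale_bound_def)

lemma range_eq: "range (algo_params k n) = (k + 1)\<^sup>2 * n"
  by (simp add: algo_params_def Let_def)

lemma threshold_eq: "threshold (algo_params k n) = 4096 * (k + 1) ^ 6"
  by (simp add: algo_params_def Let_def)

lemma slack_eq: "slack (algo_params k n) = int ((k + 1) ^ 3)"
  by (simp add: algo_params_def Let_def)

lemma scale_bound_ge: "1 \<le> scale_bound k" "(2 * (k + 1)\<^sup>2) ^ k \<le> scale_bound k"
  "(k + 1) ^ 4 * (2 * (k + 1)\<^sup>2) ^ k \<le> scale_bound k"
proof -
  have 1: "1 \<le> (k + 1) ^ 4" "1 \<le> (2 * (k + 1)\<^sup>2) ^ k" by (intro one_le_power; simp)+
  have "1 * (2 * (k + 1)\<^sup>2) ^ k \<le> (k + 1) ^ 4 * (2 * (k + 1)\<^sup>2) ^ k" using 1(1) by (intro mult_le_mono1)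
  then show "(k + 1) ^ 4 * (2 * (k + 1)\<^sup>2) ^ k \<le> scale_bound k" "(2 * (k + 1)\<^sup>2) ^ k \<le> scale_bound k" "1 \<le> scale_bound k"
    using 1(2) unfolding scale_bound_def by simp_all
qed

text \<open>All numbers that \<open>Z\<close> must exceed are small combinations of such monomials,
  so the side conditions reduce to choices of exponents.\<close>

lemma monomial_le:
  assumes "a \<le> 6" "b \<le> 2" "c \<le> 2" "n \<le> N"
  shows "(k + 1) ^ a * scale_bound k ^ b * n ^ c \<le> (k + 1) ^ 6 * (scale_bound k)\<^sup>2 * (N + 1)\<^sup>2"
proof -
  have "n ^ c \<le> (N + 1) ^ c" using assms(4) by (intro power_mono) auto
  also have "\<dots> \<le> (N + 1)\<^sup>2" using assms(3) by (intro power_increasing) auto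
  finally have "n ^ c \<le> (N + 1)\<^sup>2" .
  then show ?thesis using assms scale_bound_ge(1)[of k] by (intro mult_le_mono power_increasing) auto
qed

lemma algo_size_bound:
  assumes "n \<le> N"
  shows "algo (size_bound k N) k n"
proof -
  let ?K = "k + 1" and ?R = "scale_bound k"
  define Q where "Q = ?K ^ 6 * ?R\<^sup>2 * (N + 1)\<^sup>2"
  have Z: "size_bound k N = 12288 * Q + 6000 + N" by (simp add: size_bound_def Q_def)
  note m = monomial_le[OF _ _ _ assms, of _ _ _ k, folded Q_def]
  have Q1: "1 \<le> Q" using m[of 0 0 0] by simp
  have 1: "?K * (?K * ((?K * ?R\<^sup>2 * n\<^sup>2 + 1) * ?K)) \<le> Q + Q"
  proof -
    have "?K * (?K * ((?K * ?R\<^sup>2 * n\<^sup>2 + 1) * ?K)) = ?K ^ 4 * ?R ^ 2 * n ^ 2 + ?K ^ 3 * ?R ^ 0 * n ^ 0"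
      by (simp add: power_numeral_reduce algebra_simps)
    also have "\<dots> \<le> Q + Q" by (intro add_mono m) auto
    finally show ?thesis .
  qed
  have 2: "?R * (?K\<^sup>2 * n) + ?K ^ 3 \<le> Q + Q"
    using m[of 2 1 1] m[of 3 0 0] by (simp add: mult_ac)
  have 3: "?K * ?R\<^sup>2 * n\<^sup>2 \<le> Q" "?K\<^sup>2 * n \<le> Q" "?K ^ 6 \<le> Q" "?R \<le> Q"
    using m[of 1 2 2] m[of 2 0 1] m[of 6 0 0] m[of 0 1 0] by simp_all
  show ?thesis
  proof
    show "5000 < size_bound k N" by (simp add: size_bound_def)
    have "?K * (?K * ((?K * ?R\<^sup>2 * n\<^sup>2 + 1) * ?K)) < size_bound k N" using 1 unfolding Z by linarith
    then have "int (?K * (?K * ((?K * ?R\<^sup>2 * n\<^sup>2 + 1) * ?K))) < int (size_bound k N)" by (simp only: of_nat_less_iff)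
    then show "(int k + 1) * ((int k + 1) * ((int (fuel (algo_params k n)) + 1) * (int k + 1))) < int (size_bound k N)"
      unfolding fuel_eq by (simp only: of_nat_mult of_nat_add of_nat_1)
    have "?R * (?K\<^sup>2 * n) + ?K ^ 3 < size_bound k N" using 2 unfolding Z by linarith
    then have "int (?R * (?K\<^sup>2 * n) + ?K ^ 3) < int (size_bound k N)" by (simp only: of_nat_less_iff)
    then show "scale (algo_params k n) * int (range (algo_params k n)) + slack (algo_params k n) < int (size_bound k N)"
      unfolding scale_eq range_eq slack_eq by (simp only: of_nat_mult of_nat_add)
    show "int (fuel (algo_params k n)) + 1 < int (size_bound k N)"
      using 3(1) unfolding fuel_eq Z by linarith
    show "2 * int (range (algo_params k n)) + 2 < int (size_bound k N)"
      using 3(2) unfolding range_eq Z by linarith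
    show "int (threshold (algo_params k n)) < int (size_bound k N)"
      using 3(3) unfolding threshold_eq Z by linarith
    show "scale (algo_params k n) < int (size_bound k N)"
      using 3(4) unfolding scale_eq Z by linarith
  qed
qed

lemma solve_cost_le:
  assumes "n \<le> N"
  shows "algo.solve_cost k n \<le> solve_bound k N"
proof -
  have algo: "algo (size_bound k N) k n" by (rule algo_size_bound[OF assms])
  have pc: "algo.perceptron_cost k n L \<le> perceptron_bound k N L" for L
    unfolding algo.perceptron_cost_def[OF algo] perceptron_bound_def fuel_eq
    using assms by (intro mult_le_mono add_mono power_mono) auto
  have nc: "algo.node_cost k n L \<le> node_bound k N L" for L
    unfolding algo.node_cost_def[OF algo] node_bound_def range_eq threshold_eq
    using assms by (intro mult_le_mono add_mono pc) auto
  show ?thesis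
    unfolding algo.solve_cost_def[OF algo] solve_bound_def Let_def threshold_eq
    by (intro mult_le_mono nc order_refl)
qed

lemma call_cost_mono: "c \<le> c' \<Longrightarrow> call_cost c k N \<le> call_cost c' k N"
  by (simp add: call_cost_def)

lemma val_size_elem_le: "x \<in> set xs \<Longrightarrow> val_size (f x) \<le> val_size (val_of_list f xs)"
  by (induction xs) auto

lemma length_le_val_size: "length xs \<le> val_size (val_of_list f xs)"
proof (induction xs)
  case (Cons x xs)
  then show ?case by simp
qed simp

lemma program_correct:
  fixes I :: "(nat, nat) mmfm"
  assumes inst: "mmfm_instance I" and code: "mmfm_code I x"
  defines "M \<equiv> sum_list (map esize program)"
  shows "card (right I) \<le> val_size x"
    and "\<exists>t. runs program x t (Num (if mmfm_yes I then 1 else 0)) \<and> t \<le> time_bound M (card (right I)) (val_size x)"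
proof -
  obtain us vs es cs where
    us: "distinct us" "set us = left I" and vs: "distinct vs" "set vs = right I" and
    es: "distinct es" "set es = {(u, v). u \<in> left I \<and> v \<in> right I \<and> {u, v} \<in> edges I}" and
    cs: "distinct cs" "set cs = colors I" and
    x: "x = Node (val_of_list (\<lambda>u. val_of_pair (u, coloring I u)) us)
           (Node (val_of_list val_of_nat vs)
           (Node (val_of_list val_of_pair es)
           (Node (val_of_list val_of_nat cs)
                 (val_of_nat (fairness I)))))"
    using code unfolding mmfm_code_def by blast
  have enc: "encoded_instance I us vs cs es"
    using inst us vs es cs by unfold_locales
  define k where "k = length vs"
  define n where "n = length us"
  define N where "N = val_size x"
  define Z where "Z = size_bound k N"
  have cardk: "card (right I) = k" using vs distinct_card k_def by metis
  let ?f = "\<lambda>u. val_of_pair (u, coloring I u)"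
  have parts: "val_size (val_of_list ?f us) \<le> N" "val_size (val_of_list val_of_nat vs) \<le> N"
    "val_size (val_of_list val_of_pair es) \<le> N" "val_size (val_of_list val_of_nat cs) \<le> N"
    "val_size (val_of_nat (fairness I)) \<le> N"
    unfolding N_def x by simp_all
  have le: "k \<le> N" "n \<le> N" "length es \<le> N" "length cs \<le> N"
    using length_le_val_size[of us ?f] length_le_val_size[of vs val_of_nat]
      length_le_val_size[of es val_of_pair] length_le_val_size[of cs val_of_nat] parts
    unfolding k_def n_def by linarith+
  show "card (right I) \<le> val_size x" using le(1) by (simp add: cardk N_def)
  have NZ: "N \<le> Z" by (simp add: Z_def size_bound_def)
  interpret a: algo Z k n "algo_params k n" "int k + 1" "scale (algo_params k n)" "slack (algo_params k n)"
    "int (range (algo_params k n))" "(int (fuel (algo_params k n)) + 1) * (int k + 1)"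
    unfolding Z_def using algo_size_bound[OF le(2)] by simp_all
  have fits: "\<forall>u\<in>set us. a.fits u \<and> a.fits (coloring I u)" "\<forall>v\<in>set vs. a.fits v"
    "\<forall>(a, b)\<in>set es. a.fits a \<and> a.fits b" "\<forall>c\<in>set cs. a.fits c" "a.fits (fairness I)"
  proof -
    have "val_size (?f u) \<le> Z" if "u \<in> set us" for u
      using val_size_elem_le[OF that, of ?f] parts(1) NZ by linarith
    then show "\<forall>u\<in>set us. a.fits u \<and> a.fits (coloring I u)"
      by (fastforce simp: a.fits_def)
    have "val_size (val_of_nat v) \<le> Z" if "v \<in> set vs" for v
      using val_size_elem_le[OF that, of val_of_nat] parts(2) NZ by linarith
    then show "\<forall>v\<in>set vs. a.fits v" by (simp add: a.fits_def val_of_nat_def)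
    have "val_size (val_of_pair e) \<le> Z" if "e \<in> set es" for e
      using val_size_elem_le[OF that, of val_of_pair] parts(3) NZ by linarith
    then show "\<forall>(a, b)\<in>set es. a.fits a \<and> a.fits b" by (fastforce simp: a.fits_def)
    have "val_size (val_of_nat v) \<le> Z" if "v \<in> set cs" for v
      using val_size_elem_le[OF that, of val_of_nat] parts(4) NZ by linarith
    then show "\<forall>v\<in>set cs. a.fits v" by (simp add: a.fits_def val_of_nat_def)
    show "a.fits (fairness I)" using parts(5) NZ by (simp add: a.fits_def val_of_nat_def)
  qed
  let ?K = "k + 1" and ?R = "scale_bound k"
  define Q where "Q = ?K ^ 6 * ?R\<^sup>2 * (N + 1)\<^sup>2"
  have Z: "Z = 12288 * Q + 6000 + N" by (simp add: Z_def size_bound_def Q_def)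
  note m = monomial_le[OF _ _ _ le(2), of _ _ _ k, folded Q_def]
  have R: "?R \<le> Q" using m[of 0 1 0] by simp
  have nat_bounds: "n * (k + 2) < Z" "n < Z" "3 * ?K + 2 < Z" "?K * ?K * (?K * ?K) < Z"
      "?K * (?K * ?K) * (?K * (?K * ?K)) < Z" "n * n < Z" "?R * ?R < Z" "?R * ?R * (n * n) < Z"
      "(2 * (?K * ?K)) ^ k < Z" "?K * ?K * (?K * ?K) * (2 * (?K * ?K)) ^ k < Z"
  proof -
    have "n * (k + 2) \<le> 2 * (?K * n)" by (simp add: algebra_simps)
    also have "\<dots> \<le> 2 * Q" using m[of 1 0 1] by simp
    finally show "n * (k + 2) < Z" unfolding Z by linarith
    show "n < Z" using m[of 0 0 1] unfolding Z by simp
    show "3 * ?K + 2 < Z" using m[of 1 0 0] unfolding Z by simp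
    have p: "x * x * (x * x) = x ^ 4" "x * (x * x) * (x * (x * x)) = x ^ 6" for x :: nat
      by (simp_all add: power_numeral_reduce)
    show "?K * ?K * (?K * ?K) < Z" "?K * (?K * ?K) * (?K * (?K * ?K)) < Z"
      using m[of 4 0 0] m[of 6 0 0] unfolding Z p power_0 mult_1_right by linarith+
    show "n * n < Z" using m[of 0 0 2] unfolding Z by (simp add: power2_eq_square)
    show "?R * ?R < Z" using m[of 0 2 0] unfolding Z by (simp add: power2_eq_square)
    show "?R * ?R * (n * n) < Z" using m[of 0 2 2] unfolding Z by (simp add: power2_eq_square)
    have "(2 * (?K * ?K)) ^ k \<le> Q" using scale_bound_ge(2)[of k] R by (simp add: power2_eq_square)
    then show "(2 * (?K * ?K)) ^ k < Z" unfolding Z by linarith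
    have "?K * ?K * (?K * ?K) * (2 * (?K * ?K)) ^ k \<le> Q"
      using scale_bound_ge(3)[of k] R unfolding p power2_eq_square by (rule order_trans)
    then show "?K * ?K * (?K * ?K) * (2 * (?K * ?K)) ^ k < Z" unfolding Z by linarith
  qed
  have "\<exists>m\<le>call_cost (algo.solve_cost k n) k N. outcome Z program 0 [x] = Some (m, Num (if mmfm_yes I then 1 else 0))"
    unfolding x
  proof (rule a.out_main[OF enc k_def[symmetric] n_def[symmetric] fits le(2-4)])

    show "int n * (int k + 2) < int Z" "int n < int Z" "3 * (int k + 1) + 2 < int Z"
      "(int k + 1) * (int k + 1) * ((int k + 1) * (int k + 1)) < int Z"
      "(int k + 1) * ((int k + 1) * (int k + 1)) * ((int k + 1) * ((int k + 1) * (int k + 1))) < int Z"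
      "int n * int n < int Z"
      "(2 * ((int k + 1) * (int k + 1))) ^ k < int Z"
      "(int k + 1) * (int k + 1) * ((int k + 1) * (int k + 1)) * (2 * ((int k + 1) * (int k + 1))) ^ k < int Z"
      using nat_bounds[THEN of_nat_less_iff[where 'a = int, THEN iffD2]]
      by (simp_all only: of_nat_mult of_nat_add of_nat_power of_nat_1 of_nat_numeral)
    show "scale (algo_params k n) * scale (algo_params k n) < int Z"
      "scale (algo_params k n) * scale (algo_params k n) * (int n * int n) < int Z"
      using nat_bounds(7,8)[THEN of_nat_less_iff[where 'a = int, THEN iffD2]]
      by (simp_all only: of_nat_mult scale_eq)
  qed
  then obtain m where m: "m \<le> call_cost (algo.solve_cost k n) k N"
    "outcome Z program 0 [x] = Some (m, Num (if mmfm_yes I then 1 else 0))" by blast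
  have "m \<le> call_cost (solve_bound k N) k N"
    using m(1) call_cost_mono[OF solve_cost_le[OF le(2), of k], of k N] by linarith
  moreover have "esize (program ! i) \<le> M" if "i < length program" for i
    unfolding M_def using that by (intro member_le_sum_list) auto
  ultimately show "\<exists>t. runs program x t (Num (if mmfm_yes I then 1 else 0)) \<and>
      t \<le> time_bound M (card (right I)) (val_size x)"
    using runs_if_outcome[OF _ m(2)] unfolding time_bound_def cardk N_def[symmetric] Z_def[symmetric] by blast
qed

theorem theorem8:
  "\<exists>g :: nat \<Rightarrow> nat. (\<lambda>k. real (g k)) \<in> O(\<lambda>k. real k) \<and>
     decidable_in_Ostar_time (mmfm_instance :: (nat, nat) mmfm \<Rightarrow> bool) mmfm_code mmfm_yes
       (\<lambda>I. card (right I) ^ g (card (right I)))"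
proof -
  define M where "M = sum_list (map esize program)"
  obtain c e j where bound: "\<And>k N. k \<le> N \<Longrightarrow> time_bound M k N \<le> c * (N + 1) ^ e * exp_factor k ^ j"
    using fpt_time_bound[of M] unfolding fpt_def by blast
  \<comment> \<open>The exponent is that of \<open>exp_factor_le\<close>; its constant
    \<open>320000 ^ j\<close> goes into the polynomial \<open>q\<close>.\<close>
  define g where "g k = 25 * j * k" for k
  define q :: "nat poly" where "q = [:c * 320000 ^ j:] * [:1, 1:] ^ e"
  have q: "poly q N = c * 320000 ^ j * (N + 1) ^ e" for N
    by (simp add: q_def poly_power)
  have "(\<lambda>k. real (g k)) \<in> O(\<lambda>k. real k)"
    by (intro bigoI[of _ "real (25 * j)"]) (simp add: g_def)
  moreover have "decidable_in_Ostar_time (mmfm_instance :: (nat, nat) mmfm \<Rightarrow> bool) mmfm_code mmfm_yes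
       (\<lambda>I. card (right I) ^ g (card (right I)))"
    unfolding decidable_in_Ostar_time_def
  proof (intro exI[of _ program] exI[of _ q] allI impI)
    fix I :: "(nat, nat) mmfm" and x
    assume I: "mmfm_instance I" "mmfm_code I x"
    let ?k = "card (right I)" and ?N = "val_size x"
    obtain t where t: "runs program x t (Num (if mmfm_yes I then 1 else 0))" "t \<le> time_bound M ?k ?N"
      using program_correct(2)[OF I] unfolding M_def by blast
    note t(2)
    also have "time_bound M ?k ?N \<le> c * (?N + 1) ^ e * exp_factor ?k ^ j"
      by (rule bound[OF program_correct(1)[OF I]])
    also have "\<dots> \<le> c * (?N + 1) ^ e * (320000 ^ j * ?k ^ (25 * j * ?k))"
      by (intro mult_le_mono order_refl exp_factor_le)
    also have "\<dots> = ?k ^ g ?k * poly q ?N" unfolding q g_def by (simp only: mult_ac)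
    finally show "\<exists>t. runs program x t (Num (if mmfm_yes I then 1 else 0)) \<and> t \<le> ?k ^ g ?k * poly q ?N"
      using t(1) by blast
  qed
  ultimately show ?thesis by blast
qed

end
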